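(* Assume (A1)–(A6). Then there exists $\lambda^*>0$ such that problem $(P_{\lambda^*})$ possesses a singular solution $u^*_{\lambda^*}$ satisfying, as $r\to 0^+$, $$u^*_{\lambda^*}(r)=g(Z(r))+O\big(g''(\ln r^{-\theta})\big),$$ where $$Z(r)=\ln\{\theta^{\beta+1}(\alpha-\beta-1)\}-\ln\lambda^*-\theta\ln r+(\beta+1)\ln\big\{g'(\tau)+(\beta+1)g''(\tau)\ln g'(\tau)\big\},\qquad \tau=\ln\Big\{\frac{\beta+1}{\lambda^* r^{\theta}}\Big\}.$$
   Context: Let $\alpha,\beta,\gamma\in\mathbb R$ and define the radial operator $L(u)(r)=r^{-\gamma}\big(r^{\alpha}|u'(r)|^{\beta}u'(r)\big)'$, and $\theta=\gamma+2+\beta-\alpha$. Let $f$ be given and $g=f^{-1}$ its inverse. For a function $x(t)$, "$x(t)=O(g''(t))$" means $|x(t)|\le C|g''(t)|$ for some $C$ and all large $t$; $o(t)$ denotes any function $h$ with $h(t)/t\to0$. Assumptions: (A1) $f\in C^4([0,\infty))$, $f'>0$, $f(u)\to+\infty$ as $u\to+\infty$. (A2) $g''(t)\to0$ as $t\to+\infty$, and $\lim_{t\to+\infty} f(g(t)+\varepsilon(t))/t=1$ for every function $\varepsilon(t)=O(g''(t))$. (A3) $\lim_{t\to+\infty} g'(t)/g'(t+h(t))=1$ for every $h(t)=o(t)$. (A4) $\lim_{t\to+\infty}\frac{g''(t)}{g'(t)}\ln g'(t)=0$. (A5) (a) $g'''(t)(\ln g'(t))^n=O(g''(t))$ for $n=0,1,2$,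 and $g^{(4)}(t)\ln g'(t)=O(g''(t))$; (b) $\sup_{s\ge t}|g''(s)|=O(g''(t))$ and $g''(t+h(t))=O(g''(t))$ for every $h(t)=o(t)$. (A6) $\alpha>\beta+1$, $\beta\ge0$, $\theta>0$. Problem $(P_\lambda)$, $\lambda>0$: $L(u)+\lambda e^{f(u)}=0$ for $0\le r<1$, $u>0$ on $[0,1)$, $u(1)=0$. A singular solution of $(P_\lambda)$ is a function $u\in C^2((0,1])$ satisfying $L(u)+\lambda e^{f(u)}=0$ and $u>0$ on $(0,1)$, $u(1)=0$, and $u(r)\to+\infty$ as $r\to0^+$. *)

theory Defs
  imports "HOL-Analysis.Analysis" "HOL-Library.Landau_Symbols"
begin

definition C4_nonneg :: "(real \<Rightarrow> real) \<Rightarrow> (nat \<Rightarrow> real \<Rightarrow> real) \<Rightarrow> bool" where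
  "C4_nonneg f D \<longleftrightarrow> D 0 = f \<and>
     (\<forall>k<4. \<forall>u\<ge>0. (D k has_real_derivative D (Suc k) u) (at u within {0..})) \<and>
     continuous_on {0..} (D 4)"

definition C2_on_01 :: "(real \<Rightarrow> real) \<Rightarrow> bool" where
  "C2_on_01 u \<longleftrightarrow> (\<exists>u1 u2.
     (\<forall>r\<in>{0<..1}. (u has_real_derivative u1 r) (at r within {0<..1}) \<and>
                    (u1 has_real_derivative u2 r) (at r within {0<..1})) \<and>
     continuous_on {0<..1} u2)"

definition radial_L :: "real \<Rightarrow> real \<Rightarrow> real \<Rightarrow> (real \<Rightarrow> real) \<Rightarrow> real \<Rightarrow> real" where
  "radial_L \<alpha> \<beta> \<gamma> u r =
     r powr (-\<gamma>) * deriv (\<lambda>s. s powr \<alpha> * \<bar>deriv u s\<bar> powr \<beta> * deriv u s) r"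

definition singular_solution ::
  "real \<Rightarrow> real \<Rightarrow> real \<Rightarrow> (real \<Rightarrow> real) \<Rightarrow> real \<Rightarrow> (real \<Rightarrow> real) \<Rightarrow> bool" where
  "singular_solution \<alpha> \<beta> \<gamma> f lam u \<longleftrightarrow>
     C2_on_01 u \<and>
     (\<forall>r\<in>{0<..<1}. radial_L \<alpha> \<beta> \<gamma> u r + lam * exp (f (u r)) = 0) \<and>
     (\<forall>r\<in>{0<..<1}. u r > 0) \<and> u 1 = 0 \<and>
     filterlim u at_top (at_right 0)"

end

theory Submission
  imports Defs
begin

text \<open>
  Write \<open>p = \<beta> + 1\<close>, \<open>\<kappa> = (\<alpha> - p) / \<theta>\<close>, \<open>u(r) = g(z)\<close> and \<open>t = ln (\<theta>\<^sup>p (\<alpha> - p) / \<lambda>) - \<theta> ln r\<close>.  With the phase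
  \<open>s = z - p ln g'(z) - t\<close> and \<open>n = ln (dz/dt)\<close>, and with \<open>z\<close> as the independent variable, the equation
  becomes exactly
  \<open>s' = 1 - exp (-n) - p \<epsilon>(z)\<close>, \<open>n' = (\<kappa>/p) (exp (-n) - exp (s - (p+1) n)) - \<epsilon>(z)\<close>, where
  \<open>\<epsilon> = g''/g'\<close> tends to 0 and is the only inhomogeneity.  At the origin the characteristic polynomial is
  \<open>\<mu>\<^sup>2 - \<kappa> \<mu> + \<kappa>/p\<close>, whose roots both have positive real part, so the bounded solution is obtained by
  integrating from infinity; a contraction argument gives \<open>s, n = O(\<epsilon>)\<close>.  Inverting
  \<open>t = z - p ln g'(z) - s(z)\<close> yields a solution near \<open>r = 0\<close>, and two applications of the mean value
  theorem turn \<open>z = t + p ln g'(z) + O(\<epsilon>)\<close> into the stated expansion.  As a first-order system for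
  \<open>u\<close> and the flux \<open>\<Phi> = r\<^sup>\<alpha> |u'|\<^sup>p\<close>, the solution continues to larger \<open>r\<close>; since \<open>\<theta> > 0\<close> it reaches 0 at
  some \<open>r\<^sub>z\<close>, and rescaling \<open>r\<close> by \<open>r\<^sub>z\<close> gives \<open>\<lambda>\<^sup>* = r\<^sub>z\<^sup>\<theta>\<close> when one starts from \<open>\<lambda> = 1\<close>.
\<close>

section \<open>Solutions of the linear system bounded at infinity\<close>

text \<open>The error claimed is \<open>O(g'')\<close>, and \<open>g''\<close> may decay at any
  rate, so a sup-norm bound is not enough: \<open>s\<close> and \<open>n\<close> must be estimated
  by the value of \<epsilon> at the very point considered. Integration from infinity makes this
  possible. Such an integral at \<open>z\<close> sees only arguments beyond \<open>z\<close>; there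
  (A5)(b) dominates \<open>g''\<close> by its value at \<open>z\<close>, and \<open>1/g'\<close>
  grows at most at a small exponential rate because \<epsilon> tends to 0. With \<open>z\<close> as
  independent variable \<epsilon> is a given function; in the variable \<open>t\<close> it would be
  evaluated at the unknown. The constant in \<open>t\<close> is the one for which
  \<open>s = n = 0\<close> is an equilibrium once \<epsilon> is dropped. The phase is known up to
  \<open>O(g''/g')\<close>; applying \<open>g\<close> multiplies this error by \<open>g'\<close>,
  which gives \<open>O(g'')\<close>. The continuation meets three obstacles: \<open>f\<close> is
  controlled only on the half line, \<open>exp (f u)\<close> is not globally Lipschitz, and the
  power \<open>1/p\<close> is singular at zero flux. Each is removed by a truncation that turns out
  to be inactive where the equation is needed.\<close>

definition exp_kernel :: "complex \<Rightarrow> (real \<Rightarrow> complex) \<Rightarrow> real \<Rightarrow> complex" where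
  "exp_kernel \<mu> h z = - integral {z..} (\<lambda>x. exp (\<mu> * of_real (z - x)) * h x)"

text \<open>The kernel decays like \<open>exp (- Re \<mu> * (x - z))\<close>, so it still beats a
  source that grows at a rate \<delta> < Re \<mu>. The bound at \<open>z\<close> involves only the
  source beyond \<open>z\<close>; the pointwise estimates later rest on this.\<close>

lemma exp_kernel_integrable:
  fixes h :: "real \<Rightarrow> complex"
  assumes cont: "continuous_on UNIV h" and a: "0 \<le> \<delta>" "\<delta> < Re \<mu>"
    and bd: "\<And>x. z \<le> x \<Longrightarrow> norm (h x) \<le> b * exp (\<delta> * (x - z))"
  shows "(\<lambda>x. exp (\<mu> * of_real (z - x)) * h x) integrable_on {z..}" (is "?F integrable_on _")
    and "norm (exp_kernel \<mu> h z) \<le> b / (Re \<mu> - \<delta>)"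
proof -
  define c where "c = Re \<mu> - \<delta>"
  have c: "c > 0" using a by (simp add: c_def)
  have G: "((\<lambda>x. (b * exp (c * z)) * exp (- c * x)) has_integral (b * exp (c * z)) * (exp (- c * z) / c)) {z..}"
    by (intro has_integral_mult_right has_integral_exp_minus_to_infinity c)
  have le: "norm (?F x) \<le> (b * exp (c * z)) * exp (- c * x)" if "x \<in> {z..}" for x
  proof -
    have "norm (?F x) = exp (Re \<mu> * (z - x)) * norm (h x)"
      by (simp add: norm_mult)
    also have "\<dots> \<le> exp (Re \<mu> * (z - x)) * (b * exp (\<delta> * (x - z)))"
      using bd[of x] that by (intro mult_left_mono) auto
    also have "\<dots> = (b * exp (c * z)) * exp (- c * x)"
      by (simp add: c_def flip: exp_add) (simp add: algebra_simps flip: exp_add)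
    finally show ?thesis .
  qed
  have "?F absolutely_integrable_on {z..}"
  proof (rule measurable_bounded_by_integrable_imp_absolutely_integrable)
    have "continuous_on {z..} ?F"
      by (intro continuous_intros continuous_on_subset[OF cont]) auto
    thus "?F \<in> borel_measurable (lebesgue_on {z..})"
      by (rule continuous_imp_measurable_on_sets_lebesgue) auto
  qed (use G le in \<open>auto simp: has_integral_integrable\<close>)
  thus int: "?F integrable_on {z..}"
    by (simp add: absolutely_integrable_on_def)
  have "norm (exp_kernel \<mu> h z) \<le> integral {z..} (\<lambda>x. (b * exp (c * z)) * exp (- c * x))"
    unfolding exp_kernel_def norm_minus_cancel
    using G le by (intro integral_norm_bound_integral int) (auto simp: has_integral_integrable)
  also have "\<dots> = (b * exp (c * z)) * (exp (- c * z) / c)"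
    using G by (rule integral_unique)
  also have "\<dots> = b / c"
    by (simp add: exp_minus field_simps)
  finally show "norm (exp_kernel \<mu> h z) \<le> b / (Re \<mu> - \<delta>)"
    by (simp add: c_def)
qed

lemma exp_kernel_diff:
  fixes h k :: "real \<Rightarrow> complex"
  assumes "continuous_on UNIV h" "\<And>x. norm (h x) \<le> b" "continuous_on UNIV k" "\<And>x. norm (k x) \<le> b'"
    and "Re \<mu> > 0"
  shows "exp_kernel \<mu> (\<lambda>x. h x - k x) z = exp_kernel \<mu> h z - exp_kernel \<mu> k z"
proof -
  have "(\<lambda>x. exp (\<mu> * of_real (z - x)) * h x) integrable_on {z..}"
    using assms by (intro exp_kernel_integrable(1)[where \<delta>=0 and b=b]) auto
  moreover have "(\<lambda>x. exp (\<mu> * of_real (z - x)) * k x) integrable_on {z..}"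
    using assms by (intro exp_kernel_integrable(1)[where \<delta>=0 and b=b']) auto
  ultimately show ?thesis
    by (simp add: exp_kernel_def right_diff_distrib integral_diff)
qed

text \<open>This is variation of constants for \<open>y' = \<mu> y + h\<close> with boundedness at
  infinity in place of an initial value. As Re \<mu> > 0, nonzero homogeneous solutions blow up, so
  no free constant remains.\<close>

lemma exp_kernel_has_derivative:
  fixes h :: "real \<Rightarrow> complex"
  assumes cont: "continuous_on UNIV h" and bd: "\<And>x. norm (h x) \<le> b" and \<mu>: "Re \<mu> > 0"
  shows "(exp_kernel \<mu> h has_vector_derivative \<mu> * exp_kernel \<mu> h z + h z) (at z)"
proof -
  \<comment> \<open>A base point to the left of \<open>z\<close> splits the improper integral into
    an integral over a compact interval, to which the fundamental theorem applies, and a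
    constant.\<close>
  define z0 where "z0 = z - 1"
  define \<phi> where "\<phi> = (\<lambda>x. exp (- \<mu> * of_real x) * h x)"
  have \<phi>c: "continuous_on S \<phi>" for S
    unfolding \<phi>_def by (intro continuous_intros continuous_on_subset[OF cont]) auto
  have int0: "(\<lambda>x. exp (\<mu> * of_real (y - x)) * h x) integrable_on {y..}" for y
    using assms by (intro exp_kernel_integrable(1)[where \<delta>=0 and b=b]) auto
  have \<phi>e: "exp (\<mu> * of_real (y - x)) * h x = exp (\<mu> * of_real y) * \<phi> x" for x y
    by (simp add: \<phi>_def algebra_simps exp_diff exp_minus field_simps)
  have \<phi>int: "\<phi> integrable_on {y..}" for y
    using int0[of y] unfolding \<phi>e by (simp add: integrable_on_cmult_left_iff)
  have K: "exp_kernel \<mu> h y = exp (\<mu> * of_real y) * (integral {z0..y} \<phi> - integral {z0..} \<phi>)"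
    if "y \<in> {z0..z+1}" for y
  proof -
    have "integral {z0..y} \<phi> + integral {y..} \<phi> = integral ({z0..y} \<union> {y..}) \<phi>"
      using that by (intro integral_Un[symmetric] integrable_continuous_real \<phi>c \<phi>int)
         (auto simp: negligible_subset[OF negligible_sing[of y]])
    also have "{z0..y} \<union> {y..} = {z0..}" using that by auto
    finally have "- integral {y..} \<phi> = integral {z0..y} \<phi> - integral {z0..} \<phi>"
      by (simp add: algebra_simps)
    thus ?thesis
      unfolding exp_kernel_def \<phi>e by (metis (no_types) integral_mult_right mult_minus_right)
  qed
  have "((\<lambda>y. integral {z0..y} \<phi>) has_vector_derivative \<phi> z) (at z within {z0..z+1})"
    by (rule integral_has_vector_derivative) (auto simp: \<phi>c z0_def)
  hence I: "((\<lambda>y. integral {z0..y} \<phi>) has_vector_derivative \<phi> z) (at z)"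
    using at_within_Icc_at[of z0 z "z+1"] by (simp add: z0_def)
  have E: "((\<lambda>y. exp (\<mu> * of_real y)) has_vector_derivative \<mu> * exp (\<mu> * of_real z)) (at z)"
  proof (rule has_vector_derivative_real_field)
    show "((\<lambda>x. exp (\<mu> * x)) has_field_derivative \<mu> * exp (\<mu> * of_real z)) (at (of_real z))"
      by (rule derivative_eq_intros refl | simp)+
  qed
  have "((\<lambda>y. exp (\<mu> * of_real y) * (integral {z0..y} \<phi> - integral {z0..} \<phi>)) has_vector_derivative
      exp (\<mu> * of_real z) * \<phi> z + \<mu> * exp (\<mu> * of_real z) * (integral {z0..z} \<phi> - integral {z0..} \<phi>)) (at z)"
  proof (rule has_vector_derivative_mult[OF E])
    show "((\<lambda>y. integral {z0..y} \<phi> - integral {z0..} \<phi>) has_vector_derivative \<phi> z) (at z)"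
      using has_vector_derivative_diff[OF I has_vector_derivative_const] by simp
  qed
  moreover have "exp (\<mu> * of_real z) * \<phi> z = h z"
    using \<phi>e[of z z] by simp
  moreover have "\<mu> * exp (\<mu> * of_real z) * (integral {z0..z} \<phi> - integral {z0..} \<phi>) = \<mu> * exp_kernel \<mu> h z"
    by (subst K) (auto simp: z0_def)
  ultimately have "((\<lambda>y. exp (\<mu> * of_real y) * (integral {z0..y} \<phi> - integral {z0..} \<phi>)) has_vector_derivative
      \<mu> * exp_kernel \<mu> h z + h z) (at z)" by (simp add: add.commute)
  thus ?thesis
    by (rule has_vector_derivative_transform_within_open[where S="{z0<..<z+1}"])
       (auto simp: z0_def K[unfolded z0_def])
qed

text \<open>The roots are half of \<kappa> + \<sigma> and \<kappa> - \<sigma>, where \<sigma> is a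
  square root of the real discriminant and hence real or imaginary. A real \<sigma> is smaller than
  \<kappa> because \<open>4*q > 0\<close>; an imaginary one has real part 0.\<close>

lemma positive_real_part_roots:
  assumes "\<kappa> > (0::real)" "q > 0"
  obtains \<mu>1 \<mu>2 :: complex where "\<mu>1 + \<mu>2 = of_real \<kappa>" "\<mu>1 * \<mu>2 = of_real q" "Re \<mu>1 > 0" "Re \<mu>2 > 0"
proof -
  define \<sigma> where "\<sigma> = csqrt (of_real (\<kappa>^2 - 4*q))"
  have sq: "\<sigma>^2 = of_real (\<kappa>^2 - 4*q)" by (simp add: \<sigma>_def)
  have Re0: "Re \<sigma> \<ge> 0" using csqrt_principal[of "of_real (\<kappa>^2 - 4*q)"] by (auto simp: \<sigma>_def)
  have "Re \<sigma> < \<kappa>"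
  proof (rule ccontr)
    assume A: "\<not> Re \<sigma> < \<kappa>"
    have "Im (\<sigma>^2) = 0" "Re (\<sigma>^2) = \<kappa>^2 - 4*q" by (simp_all add: sq)
    hence "Re \<sigma> * Im \<sigma> = 0" and R: "(Re \<sigma>)^2 - (Im \<sigma>)^2 = \<kappa>^2 - 4*q"
      by (auto simp: power2_eq_square)
    hence "Im \<sigma> = 0" using A assms by auto
    with R have "(Re \<sigma>)^2 < \<kappa>^2" using assms by simp
    moreover have "\<kappa>^2 \<le> (Re \<sigma>)^2" using A assms by (intro power_mono) auto
    ultimately show False by simp
  qed
  moreover have "(of_real \<kappa> + \<sigma>) / 2 * ((of_real \<kappa> - \<sigma>) / 2) = (of_real \<kappa>^2 - \<sigma>^2) / 4"
    by (simp add: power2_eq_square algebra_simps)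
  ultimately show ?thesis
    using Re0 assms by (intro that[of "(of_real \<kappa> + \<sigma>) / 2" "(of_real \<kappa> - \<sigma>) / 2"])
      (auto simp: sq field_simps)
qed

lemma exp_kernel_continuous:
  assumes "continuous_on UNIV h" "\<And>x. norm (h x) \<le> b" "Re \<mu> > 0"
  shows "continuous_on S (exp_kernel \<mu> h)"
  using exp_kernel_has_derivative[OF assms]
  by (meson continuous_at_imp_continuous_on has_vector_derivative_continuous)

text \<open>The operator \<open>D\<^sup>2 - \<kappa> D + q\<close> factors as \<open>(D - \<mu>1) (D - \<mu>2)\<close> over the complex numbers; this treats
  real, double and non-real roots alike, and real parts of solutions solve the real system.\<close>

definition lin_y2 :: "complex \<Rightarrow> complex \<Rightarrow> (real \<Rightarrow> real) \<Rightarrow> (real \<Rightarrow> real) \<Rightarrow> real \<Rightarrow> complex" where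
  "lin_y2 \<mu>1 \<mu>2 h1 h2 = exp_kernel \<mu>2 (\<lambda>x. of_real (h2 x) - \<mu>1 * of_real (h1 x))"

text \<open>In the coordinates \<open>y1 = s\<close>, \<open>y2 = n - \<mu>1 s\<close> the system
  \<open>s' = n + h1\<close>, \<open>n' = \<kappa> n - q s + h2\<close> is triangular: the equation
  for \<open>y2\<close> is closed, and \<open>y2\<close> is then a source for
  \<open>y1\<close>.\<close>

definition lin_y1 :: "complex \<Rightarrow> complex \<Rightarrow> (real \<Rightarrow> real) \<Rightarrow> (real \<Rightarrow> real) \<Rightarrow> real \<Rightarrow> complex" where
  "lin_y1 \<mu>1 \<mu>2 h1 h2 = exp_kernel \<mu>1 (\<lambda>x. lin_y2 \<mu>1 \<mu>2 h1 h2 x + of_real (h1 x))"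

definition lin_s where "lin_s \<mu>1 \<mu>2 h1 h2 x = Re (lin_y1 \<mu>1 \<mu>2 h1 h2 x)"
definition lin_n where "lin_n \<mu>1 \<mu>2 h1 h2 x = Re (lin_y2 \<mu>1 \<mu>2 h1 h2 x + \<mu>1 * lin_y1 \<mu>1 \<mu>2 h1 h2 x)"

context
  fixes \<mu>1 \<mu>2 :: complex
  assumes Re: "Re \<mu>1 > 0" "Re \<mu>2 > 0"
begin

text \<open>The weight is anchored at the fixed \<open>z\<close>, not at the running point, so that
  the bound on \<open>y2\<close> can be fed into the second kernel. The uniform bound and the
  continuity of \<open>y2\<close> are what differentiability and linearity of the second kernel
  require.\<close>

lemma lin_weighted_bounds:
  assumes c: "continuous_on UNIV h1" "continuous_on UNIV h2"
    and bd: "\<And>x. \<bar>h1 x\<bar> \<le> b'" "\<And>x. \<bar>h2 x\<bar> \<le> b'"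
    and \<delta>: "0 \<le> \<delta>" "\<delta> < Re \<mu>1" "\<delta> < Re \<mu>2"
    and le: "\<And>x. z \<le> x \<Longrightarrow> \<bar>h1 x\<bar> \<le> b * exp (\<delta> * (x - z))" "\<And>x. z \<le> x \<Longrightarrow> \<bar>h2 x\<bar> \<le> b * exp (\<delta> * (x - z))"
    and c2: "c2 = (1 + norm \<mu>1) / (Re \<mu>2 - \<delta>)"
  shows "z \<le> x \<Longrightarrow> norm (lin_y2 \<mu>1 \<mu>2 h1 h2 x) \<le> c2 * b * exp (\<delta> * (x - z))"
    and "norm (lin_y2 \<mu>1 \<mu>2 h1 h2 x) \<le> (1 + norm \<mu>1) / Re \<mu>2 * b'"
    and "continuous_on S (lin_y2 \<mu>1 \<mu>2 h1 h2)"
    and "norm (lin_y1 \<mu>1 \<mu>2 h1 h2 z) \<le> (c2 + 1) / (Re \<mu>1 - \<delta>) * b"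
proof -
  let ?h = "\<lambda>x. complex_of_real (h2 x) - \<mu>1 * of_real (h1 x)"
  have hc: "continuous_on UNIV ?h" by (intro continuous_intros c)
  have hb: "norm (?h x) \<le> (1 + norm \<mu>1) * B" if "\<bar>h1 x\<bar> \<le> B" "\<bar>h2 x\<bar> \<le> B" for x B
  proof -
    have "norm (?h x) \<le> \<bar>h2 x\<bar> + norm \<mu>1 * \<bar>h1 x\<bar>"
      by (rule order_trans[OF norm_triangle_ineq4]) (simp add: norm_mult)
    also have "\<dots> \<le> B + norm \<mu>1 * B" using that by (intro add_mono mult_left_mono) auto
    finally show ?thesis by (simp add: algebra_simps)
  qed
  have y2: "norm (lin_y2 \<mu>1 \<mu>2 h1 h2 x) \<le> c2 * b * exp (\<delta> * (x - z))" if "z \<le> x" for x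
  proof -
    have "norm (lin_y2 \<mu>1 \<mu>2 h1 h2 x) \<le> ((1 + norm \<mu>1) * (b * exp (\<delta> * (x - z)))) / (Re \<mu>2 - \<delta>)"
      unfolding lin_y2_def
    proof (rule exp_kernel_integrable(2)[OF hc \<delta>(1,3)])
      fix y assume "x \<le> y"
      hence "norm (?h y) \<le> (1 + norm \<mu>1) * (b * exp (\<delta> * (y - z)))"
        using that by (intro hb le) auto
      thus "norm (?h y) \<le> (1 + norm \<mu>1) * (b * exp (\<delta> * (x - z))) * exp (\<delta> * (y - x))"
        by (simp add: mult.assoc flip: exp_add) (simp add: algebra_simps)
    qed
    thus ?thesis by (simp add: c2)
  qed
  thus "z \<le> x \<Longrightarrow> norm (lin_y2 \<mu>1 \<mu>2 h1 h2 x) \<le> c2 * b * exp (\<delta> * (x - z))" .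
  have y2b: "norm (lin_y2 \<mu>1 \<mu>2 h1 h2 x) \<le> (1 + norm \<mu>1) / Re \<mu>2 * b'" for x
  proof -
    have "norm (lin_y2 \<mu>1 \<mu>2 h1 h2 x) \<le> ((1 + norm \<mu>1) * b') / (Re \<mu>2 - 0)"
      unfolding lin_y2_def
      by (rule exp_kernel_integrable(2)[OF hc]) (use Re hb bd in auto)
    thus ?thesis by simp
  qed
  thus "norm (lin_y2 \<mu>1 \<mu>2 h1 h2 x) \<le> (1 + norm \<mu>1) / Re \<mu>2 * b'" .
  have y2c: "continuous_on S (lin_y2 \<mu>1 \<mu>2 h1 h2)" for S
    unfolding lin_y2_def using bd
    by (intro exp_kernel_continuous[where b="(1 + norm \<mu>1) * b'"] hc hb Re) auto
  thus "continuous_on S (lin_y2 \<mu>1 \<mu>2 h1 h2)" .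
  have "norm (lin_y1 \<mu>1 \<mu>2 h1 h2 z) \<le> ((c2 + 1) * b) / (Re \<mu>1 - \<delta>)"
    unfolding lin_y1_def
  proof (rule exp_kernel_integrable(2)[OF _ \<delta>(1,2)])
    show "continuous_on UNIV (\<lambda>x. lin_y2 \<mu>1 \<mu>2 h1 h2 x + complex_of_real (h1 x))"
      by (intro continuous_intros y2c c)
    fix x assume "z \<le> x"
    hence "norm (lin_y2 \<mu>1 \<mu>2 h1 h2 x + complex_of_real (h1 x)) \<le> c2 * b * exp (\<delta> * (x - z)) + b * exp (\<delta> * (x - z))"
      using y2[of x] le[of x] by (intro norm_triangle_mono) auto
    thus "norm (lin_y2 \<mu>1 \<mu>2 h1 h2 x + complex_of_real (h1 x)) \<le> (c2 + 1) * b * exp (\<delta> * (x - z))"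
      by (simp add: algebra_simps)
  qed
  thus "norm (lin_y1 \<mu>1 \<mu>2 h1 h2 z) \<le> (c2 + 1) / (Re \<mu>1 - \<delta>) * b" by simp
qed

lemma lin_derivative:
  assumes c: "continuous_on UNIV h1" "continuous_on UNIV h2"
    and bd: "\<And>x. \<bar>h1 x\<bar> \<le> b'" "\<And>x. \<bar>h2 x\<bar> \<le> b'"
    and \<mu>: "\<mu>1 + \<mu>2 = of_real \<kappa>" "\<mu>1 * \<mu>2 = of_real q"
  shows "(lin_s \<mu>1 \<mu>2 h1 h2 has_real_derivative lin_n \<mu>1 \<mu>2 h1 h2 z + h1 z) (at z)"
    and "(lin_n \<mu>1 \<mu>2 h1 h2 has_real_derivative
            \<kappa> * lin_n \<mu>1 \<mu>2 h1 h2 z - q * lin_s \<mu>1 \<mu>2 h1 h2 z + h2 z) (at z)"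
proof -
  have hb: "norm (complex_of_real (h2 x) - \<mu>1 * of_real (h1 x)) \<le> b' + norm \<mu>1 * b'" for x
    by (rule order_trans[OF norm_triangle_ineq4])
       (use bd in \<open>auto simp: norm_mult intro!: add_mono mult_left_mono\<close>)
  let ?y1 = "lin_y1 \<mu>1 \<mu>2 h1 h2" and ?y2 = "lin_y2 \<mu>1 \<mu>2 h1 h2"
  have D2: "(?y2 has_vector_derivative \<mu>2 * ?y2 z + (of_real (h2 z) - \<mu>1 * of_real (h1 z))) (at z)"
    unfolding lin_y2_def
    by (rule exp_kernel_has_derivative[OF _ hb Re(2)]) (intro continuous_intros c)
  have y2: "norm (?y2 x) \<le> (1 + norm \<mu>1) / Re \<mu>2 * b'" "continuous_on S ?y2" for x S
    using bd Re by (intro lin_weighted_bounds(2,3)[OF c bd, where \<delta>=0 and b=b'] refl; simp)+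
  have "norm (?y2 x + of_real (h1 x)) \<le> (1 + norm \<mu>1) / Re \<mu>2 * b' + b'" for x
    by (intro norm_triangle_mono y2) (use bd in auto)
  hence D1: "(?y1 has_vector_derivative \<mu>1 * ?y1 z + (?y2 z + of_real (h1 z))) (at z)"
    unfolding lin_y1_def
    by (intro exp_kernel_has_derivative[where b="(1 + norm \<mu>1) / Re \<mu>2 * b' + b'"] continuous_intros c y2 Re)
  have ReD: "((\<lambda>x. Re (y x)) has_real_derivative Re y') (at z)" if "(y has_vector_derivative y') (at z)" for y y'
    unfolding has_real_derivative_iff_has_vector_derivative
    using bounded_linear.has_vector_derivative[OF bounded_linear_Re that] .
  show "(lin_s \<mu>1 \<mu>2 h1 h2 has_real_derivative lin_n \<mu>1 \<mu>2 h1 h2 z + h1 z) (at z)"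
    using ReD[OF D1] unfolding lin_s_def[abs_def] by (simp add: lin_n_def algebra_simps)
  have "((\<lambda>x. ?y2 x + \<mu>1 * ?y1 x) has_vector_derivative
      (\<mu>2 * ?y2 z + (of_real (h2 z) - \<mu>1 * of_real (h1 z))) + \<mu>1 * (\<mu>1 * ?y1 z + (?y2 z + of_real (h1 z)))) (at z)"
    by (intro has_vector_derivative_add D2 has_vector_derivative_mult_right D1)
  \<comment> \<open>After regrouping, only the sum and the product of the roots occur. Both are
    real, so taking real parts commutes with the right-hand side.\<close>
  moreover have "(\<mu>2 * ?y2 z + (of_real (h2 z) - \<mu>1 * of_real (h1 z))) + \<mu>1 * (\<mu>1 * ?y1 z + (?y2 z + of_real (h1 z)))
     = (\<mu>1 + \<mu>2) * (?y2 z + \<mu>1 * ?y1 z) - (\<mu>1 * \<mu>2) * ?y1 z + of_real (h2 z)"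
    by (simp add: algebra_simps)
  ultimately have "((\<lambda>x. ?y2 x + \<mu>1 * ?y1 x) has_vector_derivative
     of_real \<kappa> * (?y2 z + \<mu>1 * ?y1 z) - of_real q * ?y1 z + of_real (h2 z)) (at z)"
    by (simp only: \<mu>)
  from ReD[OF this] show "(lin_n \<mu>1 \<mu>2 h1 h2 has_real_derivative
            \<kappa> * lin_n \<mu>1 \<mu>2 h1 h2 z - q * lin_s \<mu>1 \<mu>2 h1 h2 z + h2 z) (at z)"
    unfolding lin_n_def[abs_def] by (simp add: lin_s_def)
qed

lemma lin_diff:
  assumes c: "continuous_on UNIV h1" "continuous_on UNIV h2" "continuous_on UNIV k1" "continuous_on UNIV k2"
    and bd: "\<And>x. \<bar>h1 x\<bar> \<le> b" "\<And>x. \<bar>h2 x\<bar> \<le> b" "\<And>x. \<bar>k1 x\<bar> \<le> b" "\<And>x. \<bar>k2 x\<bar> \<le> b"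
  shows "lin_s \<mu>1 \<mu>2 (\<lambda>x. h1 x - k1 x) (\<lambda>x. h2 x - k2 x) z = lin_s \<mu>1 \<mu>2 h1 h2 z - lin_s \<mu>1 \<mu>2 k1 k2 z"
    and "lin_n \<mu>1 \<mu>2 (\<lambda>x. h1 x - k1 x) (\<lambda>x. h2 x - k2 x) z = lin_n \<mu>1 \<mu>2 h1 h2 z - lin_n \<mu>1 \<mu>2 k1 k2 z"
proof -
  have hb: "norm (complex_of_real (h2 x) - \<mu>1 * of_real (h1 x)) \<le> b + norm \<mu>1 * b"
    if "\<And>x. \<bar>h1 x\<bar> \<le> b" "\<And>x. \<bar>h2 x\<bar> \<le> b" for x h1 h2
    by (rule order_trans[OF norm_triangle_ineq4])
       (use that in \<open>auto simp: norm_mult intro!: add_mono mult_left_mono\<close>)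
  have y2: "lin_y2 \<mu>1 \<mu>2 (\<lambda>x. h1 x - k1 x) (\<lambda>x. h2 x - k2 x) z = lin_y2 \<mu>1 \<mu>2 h1 h2 z - lin_y2 \<mu>1 \<mu>2 k1 k2 z" for z
    unfolding lin_y2_def
    by (subst exp_kernel_diff[symmetric, OF _ hb _ hb Re(2)]) 
       (use c bd in \<open>auto intro!: continuous_intros arg_cong2[where f="exp_kernel \<mu>2"] arg_cong[where f="\<lambda>h. exp_kernel \<mu>2 h z"] simp: algebra_simps\<close>)
  have 1: "norm (lin_y2 \<mu>1 \<mu>2 h1 h2 x) \<le> (1 + norm \<mu>1) / Re \<mu>2 * b" "continuous_on S (lin_y2 \<mu>1 \<mu>2 h1 h2)" for x S
    using bd Re by (intro lin_weighted_bounds(2,3)[OF c(1,2) bd(1,2), where \<delta>=0 and b=b] refl; simp)+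
  have 2: "norm (lin_y2 \<mu>1 \<mu>2 k1 k2 x) \<le> (1 + norm \<mu>1) / Re \<mu>2 * b" "continuous_on S (lin_y2 \<mu>1 \<mu>2 k1 k2)" for x S
    using bd Re by (intro lin_weighted_bounds(2,3)[OF c(3,4) bd(3,4), where \<delta>=0 and b=b] refl; simp)+
  have 3: "norm (lin_y2 \<mu>1 \<mu>2 h1 h2 x + of_real (h1 x)) \<le> (1 + norm \<mu>1) / Re \<mu>2 * b + b" for x
    by (intro norm_triangle_mono 1) (use bd in auto)
  have 4: "norm (lin_y2 \<mu>1 \<mu>2 k1 k2 x + of_real (k1 x)) \<le> (1 + norm \<mu>1) / Re \<mu>2 * b + b" for x
    by (intro norm_triangle_mono 2) (use bd in auto)
  have y1: "lin_y1 \<mu>1 \<mu>2 (\<lambda>x. h1 x - k1 x) (\<lambda>x. h2 x - k2 x) z = lin_y1 \<mu>1 \<mu>2 h1 h2 z - lin_y1 \<mu>1 \<mu>2 k1 k2 z"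
    unfolding lin_y1_def y2
    by (subst exp_kernel_diff[symmetric, OF _ 3 _ 4 Re(1)])
       (use c 1 2 in \<open>auto intro!: continuous_intros arg_cong[where f="\<lambda>h. exp_kernel \<mu>1 h z"] simp: algebra_simps\<close>)
  show "lin_s \<mu>1 \<mu>2 (\<lambda>x. h1 x - k1 x) (\<lambda>x. h2 x - k2 x) z = lin_s \<mu>1 \<mu>2 h1 h2 z - lin_s \<mu>1 \<mu>2 k1 k2 z"
    "lin_n \<mu>1 \<mu>2 (\<lambda>x. h1 x - k1 x) (\<lambda>x. h2 x - k2 x) z = lin_n \<mu>1 \<mu>2 h1 h2 z - lin_n \<mu>1 \<mu>2 k1 k2 z"
    by (simp_all add: lin_s_def lin_n_def y1 y2 algebra_simps)
qed

end

section \<open>The perturbed autonomous system\<close>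

text \<open>Banach's theorem for ordinary functions instead of elements of the type of bounded
  continuous functions. The sets \<open>X x\<close> carry pointwise constraints, such as a bound by
  a given function of \<open>x\<close>.\<close>

lemma bcontfun_fixpoint:
  fixes T :: "('a::metric_space \<Rightarrow> 'b::banach) \<Rightarrow> 'a \<Rightarrow> 'b" and X :: "'a \<Rightarrow> 'b set"
  defines "A \<equiv> {f \<in> bcontfun. \<forall>x. f x \<in> X x}"
  assumes closed: "\<And>x. closed (X x)" and ne: "f0 \<in> A"
    and T: "\<And>f. f \<in> A \<Longrightarrow> T f \<in> A"
    and c: "0 \<le> c" "c < 1"
    and contr: "\<And>f g d x. \<lbrakk>f \<in> A; g \<in> A; \<And>x. dist (f x) (g x) \<le> d\<rbrakk> \<Longrightarrow> dist (T f x) (T g x) \<le> c * d"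
  obtains f where "f \<in> A" "T f = f"
proof -
  let ?S = "PiC UNIV X"
  have S: "H \<in> ?S \<longleftrightarrow> apply_bcontfun H \<in> A" for H
    by (auto simp: A_def mem_PiC_iff apply_bcontfun)
  define T' where "T' H = Bcontfun (T (apply_bcontfun H))" for H
  have T': "apply_bcontfun (T' H) = T (apply_bcontfun H)" if "H \<in> ?S" for H
    unfolding T'_def by (rule Bcontfun_inverse) (use T[of H] that S in \<open>auto simp: A_def\<close>)
  have "\<exists>!H\<in>?S. T' H = H"
  proof (rule Banach_fix[OF _ _ c])
    show "complete ?S"
      using closed by (simp add: complete_eq_closed closed_PiC)
    have "apply_bcontfun (Bcontfun f0) = f0" using ne by (intro Bcontfun_inverse) (auto simp: A_def)
    hence "Bcontfun f0 \<in> ?S" using ne by (simp add: S)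
    thus "?S \<noteq> {}" by auto
    show "T' ` ?S \<subseteq> ?S"
      using T by (auto simp: S T')
  next
    fix H K assume HK: "H \<in> ?S" "K \<in> ?S"
    show "dist (T' H) (T' K) \<le> c * dist H K"
      using HK by (intro dist_bound) (auto simp: T' S dist_bounded intro!: contr)
  qed
  then obtain H where H: "H \<in> ?S" "T' H = H" by blast
  show ?thesis
    by (rule that[of "apply_bcontfun H"]) (use H S T'[of H] in auto)
qed

text \<open>The derivative \<open>exp x - 1\<close> is at most \<open>2 * \<rho>\<close> in size on
  the interval. A Lipschitz constant proportional to \<rho> is what lets smallness beat the norm of
  the linear solution operator.\<close>

lemma exp_remainder_lipschitz:
  fixes x y :: real
  assumes "\<bar>x\<bar> \<le> \<rho>" "\<bar>y\<bar> \<le> \<rho>" "\<rho> \<le> 1"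
  shows "\<bar>(exp x - 1 - x) - (exp y - 1 - y)\<bar> \<le> 2 * \<rho> * \<bar>x - y\<bar>"
proof -
  have "norm ((exp x - 1 - x) - (exp y - 1 - y)) \<le> 2 * \<rho> * norm (x - y)"
  proof (rule field_differentiable_bound[where S="{-\<rho>..\<rho>}" and f="\<lambda>x. exp x - 1 - x" and f'="\<lambda>x. exp x - 1"])
    fix z assume z: "z \<in> {-\<rho>..\<rho>}"
    show "((\<lambda>x. exp x - 1 - x) has_field_derivative exp z - 1) (at z within {-\<rho>..\<rho>})"
      by (auto intro!: derivative_eq_intros)
    have "exp z - 1 \<le> 2 * \<rho>"
    proof (cases "z \<ge> 0")
      case True
      have "exp z \<le> 1 + z + z^2" using True z assms by (intro exp_bound) auto
      moreover have "z^2 \<le> z * 1" using True z assms unfolding power2_eq_square by (intro mult_left_mono) auto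
      ultimately show ?thesis using z by auto
    next
      case False
      hence "exp z \<le> 1" by simp
      thus ?thesis using assms by linarith
    qed
    moreover have "1 + z \<le> exp z" by (rule exp_ge_add_one_self)
    moreover have "-\<rho> \<le> z" "z \<le> \<rho>" using z by auto
    ultimately show "norm (exp z - 1) \<le> 2 * \<rho>" unfolding real_norm_def abs_le_iff by linarith
  qed (use assms in auto)
  thus ?thesis by simp
qed

text \<open>Hides the complex coordinates: the nonlinear argument uses only the real operators
  \<open>S\<close>, \<open>N\<close>, their weighted norm \<open>K\<close> and the admissible growth
  rate \<delta>.\<close>

lemma lin_solution_operator:
  fixes \<kappa> q :: real
  assumes "\<kappa> > 0" "q > 0"
  obtains K \<delta> :: real and S N :: "(real \<Rightarrow> real) \<Rightarrow> (real \<Rightarrow> real) \<Rightarrow> real \<Rightarrow> real"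
  where "K > 0" "\<delta> > 0"
    and "\<And>h1 h2 b z. \<lbrakk>continuous_on UNIV h1; continuous_on UNIV h2; \<And>x. \<bar>h1 x\<bar> \<le> b; \<And>x. \<bar>h2 x\<bar> \<le> b\<rbrakk>
       \<Longrightarrow> (S h1 h2 has_real_derivative N h1 h2 z + h1 z) (at z) \<and>
           (N h1 h2 has_real_derivative \<kappa> * N h1 h2 z - q * S h1 h2 z + h2 z) (at z)"
    and "\<And>h1 h2 b b' z. \<lbrakk>continuous_on UNIV h1; continuous_on UNIV h2; \<And>x. \<bar>h1 x\<bar> \<le> b'; \<And>x. \<bar>h2 x\<bar> \<le> b';
         \<And>x. z \<le> x \<Longrightarrow> \<bar>h1 x\<bar> \<le> b * exp (\<delta> * (x - z)); \<And>x. z \<le> x \<Longrightarrow> \<bar>h2 x\<bar> \<le> b * exp (\<delta> * (x - z))\<rbrakk>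
       \<Longrightarrow> \<bar>S h1 h2 z\<bar> \<le> K * b \<and> \<bar>N h1 h2 z\<bar> \<le> K * b"
    and "\<And>h1 h2 k1 k2 b z. \<lbrakk>continuous_on UNIV h1; continuous_on UNIV h2; continuous_on UNIV k1; continuous_on UNIV k2;
         \<And>x. \<bar>h1 x\<bar> \<le> b; \<And>x. \<bar>h2 x\<bar> \<le> b; \<And>x. \<bar>k1 x\<bar> \<le> b; \<And>x. \<bar>k2 x\<bar> \<le> b\<rbrakk>
       \<Longrightarrow> S (\<lambda>x. h1 x - k1 x) (\<lambda>x. h2 x - k2 x) z = S h1 h2 z - S k1 k2 z \<and>
           N (\<lambda>x. h1 x - k1 x) (\<lambda>x. h2 x - k2 x) z = N h1 h2 z - N k1 k2 z"
proof -
  obtain \<mu>1 \<mu>2 :: complex where \<mu>: "\<mu>1 + \<mu>2 = of_real \<kappa>" "\<mu>1 * \<mu>2 = of_real q" and Re: "Re \<mu>1 > 0" "Re \<mu>2 > 0"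
    using positive_real_part_roots[OF assms] by metis
  \<comment> \<open>Half the smaller real part: sources may grow at this rate and still lose
    strictly against both kernels.\<close>
  define \<delta> where "\<delta> = min (Re \<mu>1) (Re \<mu>2) / 2"
  have \<delta>: "\<delta> > 0" "\<delta> < Re \<mu>1" "\<delta> < Re \<mu>2" using Re by (auto simp: \<delta>_def min_def)
  define c2 where "c2 = (1 + norm \<mu>1) / (Re \<mu>2 - \<delta>)"
  define c1 where "c1 = (c2 + 1) / (Re \<mu>1 - \<delta>)"
  have c: "c1 > 0" "c2 > 0" using \<delta> by (auto simp: c1_def c2_def add_pos_nonneg)
  define K where "K = c1 + c2 + norm \<mu>1 * c1"
  show ?thesis
  proof (rule that[of K \<delta> "lin_s \<mu>1 \<mu>2" "lin_n \<mu>1 \<mu>2"], goal_cases)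
    case 1 show ?case using c by (auto simp: K_def add_pos_nonneg)
  next
    case 2 show ?case by (rule \<delta>)
  next
    case (3 h1 h2 b z)
    show ?case by (intro conjI lin_derivative[OF Re 3 \<mu>])
  next
    case (4 h1 h2 b b' z)
    note L = lin_weighted_bounds[OF Re 4(1-4) less_imp_le[OF \<delta>(1)] \<delta>(2,3) 4(5,6) c2_def]
    have "0 \<le> \<bar>h1 z\<bar>" by simp
    also have "\<dots> \<le> b" using 4(5)[of z] by simp
    finally have b: "b \<ge> 0" .
    have y2: "norm (lin_y2 \<mu>1 \<mu>2 h1 h2 z) \<le> c2 * b" using L(1)[of z] by simp
    have y1: "norm (lin_y1 \<mu>1 \<mu>2 h1 h2 z) \<le> c1 * b" using L(4) by (simp add: c1_def)
    have "\<bar>lin_s \<mu>1 \<mu>2 h1 h2 z\<bar> \<le> c1 * b"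
      unfolding lin_s_def by (rule order_trans[OF abs_Re_le_cmod y1])
    also have "\<dots> \<le> K * b" using b c by (intro mult_right_mono) (auto simp: K_def)
    finally have "\<bar>lin_s \<mu>1 \<mu>2 h1 h2 z\<bar> \<le> K * b" .
    moreover have "\<bar>lin_n \<mu>1 \<mu>2 h1 h2 z\<bar> \<le> norm (lin_y2 \<mu>1 \<mu>2 h1 h2 z) + norm (\<mu>1 * lin_y1 \<mu>1 \<mu>2 h1 h2 z)"
      unfolding lin_n_def by (rule order_trans[OF abs_Re_le_cmod norm_triangle_ineq])
    moreover have "norm (lin_y2 \<mu>1 \<mu>2 h1 h2 z) + norm (\<mu>1 * lin_y1 \<mu>1 \<mu>2 h1 h2 z) \<le> c2 * b + norm \<mu>1 * (c1 * b)"
      unfolding norm_mult by (intro add_mono mult_left_mono y1 y2) auto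
    moreover have "c2 * b + norm \<mu>1 * (c1 * b) \<le> K * b" using b c by (simp add: K_def algebra_simps)
    ultimately show ?case by linarith
  next
    case (5 h1 h2 k1 k2 b z)
    show ?case by (intro conjI lin_diff[OF Re 5])
  qed
qed

text \<open>The exponential growth condition on \<open>e\<close> says that \<open>\<bar>e\<bar>\<close> survives integration from infinity
  against a kernel decaying faster than \<open>exp (- \<delta> x)\<close>; this is what makes the set
  \<open>\<bar>h\<bar> \<le> B0 \<bar>e\<bar>\<close> of inhomogeneities invariant.\<close>

lemma perturbed_system_solution:
  fixes \<kappa> p C :: real
  assumes \<kappa>: "\<kappa> > 0" and p: "p > 0" and C: "C \<ge> 1"
  obtains \<delta> \<epsilon>0 B :: real where "\<delta> > 0" "\<epsilon>0 > 0" "B \<ge> 0"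
    "\<And>e :: real \<Rightarrow> real. \<lbrakk>continuous_on UNIV e; \<And>x. \<bar>e x\<bar> \<le> \<epsilon>0;
        \<And>z x. z \<le> x \<Longrightarrow> \<bar>e x\<bar> \<le> C * \<bar>e z\<bar> * exp (\<delta> * (x - z))\<rbrakk> \<Longrightarrow>
      \<exists>s n. \<forall>z. \<bar>s z\<bar> \<le> B * \<bar>e z\<bar> \<and> \<bar>n z\<bar> \<le> B * \<bar>e z\<bar> \<and>
        (s has_real_derivative 1 - exp (- n z) - p * e z) (at z) \<and>
        (n has_real_derivative \<kappa> / p * (exp (- n z) - exp (s z - (p + 1) * n z)) - e z) (at z)"
proof -
  define q where "q = \<kappa> / p"
  have q: "q > 0" using \<kappa> p by (simp add: q_def)
  show ?thesis
  proof (rule lin_solution_operator[OF \<kappa> q], goal_cases)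
    case (1 K \<delta> S N)
    note K = 1(1) and \<delta> = 1(2) and der = 1(3) and bnd = 1(4) and dif = 1(5)
    \<comment> \<open>At \<open>s = n = 0\<close> the inhomogeneity is at most
      \<open>(p + 1) * \<bar>e\<bar>\<close>. Doubling leaves the same amount for its
      variation.\<close>
    define B0 where "B0 = 2 * (p + 1)"
    \<comment> \<open>\<open>M * \<rho>\<close> will be a Lipschitz constant of both nonlinear
      terms: \<open>2\<close> comes from \<open>E (- n)\<close>, and
      \<open>2 * q * (1 + (p + 1))\<close> from the two remainders in the second equation.\<close>
    define M where "M = 2 + 2 * q * (p + 2)"
    have B0: "B0 > 0" using p by (simp add: B0_def)
    have M: "M > 0" unfolding M_def using p q by (intro add_pos_pos mult_pos_pos) auto
    \<comment> \<open>The 1 makes the remainder estimate applicable. The factor 8 yields a quarter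
      in each component, which serves both invariance of the set and contraction with constant
      1/2.\<close>
    define \<rho> where "\<rho> = min 1 (1 / (8 * M * K * C))"
    have \<rho>: "0 < \<rho>" "\<rho> \<le> 1" "8 * M * K * C * \<rho> \<le> 1"
    proof -
      have P: "8 * M * K * C > 0" using M K C by simp
      show "0 < \<rho>" "\<rho> \<le> 1" using P by (auto simp: \<rho>_def)
      have "\<rho> \<le> 1 / (8 * M * K * C)" by (simp add: \<rho>_def)
      thus "8 * M * K * C * \<rho> \<le> 1" using P by (simp only: pos_le_divide_eq mult.commute)
    qed
    \<comment> \<open>Chosen so that
      \<open>\<bar>s\<bar>, \<bar>n\<bar> \<le> B * \<epsilon>0\<close> keeps both arguments of
      \<open>E\<close>, namely \<open>- n\<close> and \<open>s - (p + 1) * n\<close>, within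
      \<rho>.\<close>
    define \<epsilon>0 where "\<epsilon>0 = \<rho> / ((p + 2) * (K * B0 * C))"
    define B where "B = K * B0 * C"
    have B: "B > 0" using K B0 C by (simp add: B_def)
    have \<epsilon>0: "\<epsilon>0 > 0" "(p + 2) * (B * \<epsilon>0) = \<rho>"
      using B \<rho> p by (auto simp: \<epsilon>0_def B_def[symmetric])
    define E where "E x = exp x - 1 - x" for x :: real
    have E0: "E 0 = 0" by (simp add: E_def)
    have EL: "\<bar>E x - E y\<bar> \<le> 2 * \<rho> * \<bar>x - y\<bar>" if "\<bar>x\<bar> \<le> \<rho>" "\<bar>y\<bar> \<le> \<rho>" for x y
      unfolding E_def using that \<rho>(2) by (rule exp_remainder_lipschitz)
    define N1 where "N1 e s n = - E (- n) - p * e" for e s n :: real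
    define N2 where "N2 e s n = q * (E (- n) - E (s - (p + 1) * n)) - e" for e s n :: real
    have lip: "\<bar>N1 e s n - N1 e s' n'\<bar> \<le> M * \<rho> * (\<bar>s - s'\<bar> + \<bar>n - n'\<bar>)"
              "\<bar>N2 e s n - N2 e s' n'\<bar> \<le> M * \<rho> * (\<bar>s - s'\<bar> + \<bar>n - n'\<bar>)"
      if "\<bar>s\<bar> \<le> B * \<epsilon>0" "\<bar>s'\<bar> \<le> B * \<epsilon>0" "\<bar>n\<bar> \<le> B * \<epsilon>0" "\<bar>n'\<bar> \<le> B * \<epsilon>0" for s s' n n' e
    proof -
      have a1: "\<bar>- n\<bar> \<le> \<rho>" if "\<bar>n\<bar> \<le> B * \<epsilon>0" for n
      proof -
        have "1 * (B * \<epsilon>0) \<le> (p + 2) * (B * \<epsilon>0)" using p B \<epsilon>0 by (intro mult_right_mono) auto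
        thus ?thesis using that \<epsilon>0 by simp
      qed
      have a2: "\<bar>s - (p + 1) * n\<bar> \<le> \<rho>" if "\<bar>s\<bar> \<le> B * \<epsilon>0" "\<bar>n\<bar> \<le> B * \<epsilon>0" for s n
      proof -
        have "\<bar>s - (p + 1) * n\<bar> \<le> \<bar>s\<bar> + \<bar>(p + 1) * n\<bar>" by (rule abs_triangle_ineq4)
        also have "\<dots> = \<bar>s\<bar> + (p + 1) * \<bar>n\<bar>" using p by (simp add: abs_mult)
        also have "\<dots> \<le> B * \<epsilon>0 + (p + 1) * (B * \<epsilon>0)" using that p by (intro add_mono mult_left_mono) auto
        finally show ?thesis using \<epsilon>0(2) by (simp add: algebra_simps)
      qed
      let ?d = "\<bar>s - s'\<bar> + \<bar>n - n'\<bar>"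
      have e1: "\<bar>E (- n) - E (- n')\<bar> \<le> 2 * \<rho> * ?d"
        by (rule order_trans[OF EL]) (use that a1 \<rho> in \<open>auto intro!: mult_left_mono\<close>)
      have e2: "\<bar>E (s - (p + 1) * n) - E (s' - (p + 1) * n')\<bar> \<le> 2 * \<rho> * ((p + 1) * ?d)"
      proof (rule order_trans[OF EL])
        have "\<bar>(s - (p + 1) * n) - (s' - (p + 1) * n')\<bar> = \<bar>(s - s') - (p + 1) * (n - n')\<bar>" by (simp add: algebra_simps)
        also have "\<dots> \<le> \<bar>s - s'\<bar> + \<bar>(p + 1) * (n - n')\<bar>" by (rule abs_triangle_ineq4)
        also have "\<dots> = 1 * \<bar>s - s'\<bar> + (p + 1) * \<bar>n - n'\<bar>" using p by (simp add: abs_mult)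
        also have "\<dots> \<le> (p + 1) * \<bar>s - s'\<bar> + (p + 1) * \<bar>n - n'\<bar>" using p by (intro add_mono mult_right_mono order_refl) auto
        finally show "2 * \<rho> * \<bar>(s - (p + 1) * n) - (s' - (p + 1) * n')\<bar> \<le> 2 * \<rho> * ((p + 1) * ?d)"
          using \<rho> by (intro mult_left_mono) (auto simp: algebra_simps)
      qed (use that a2 in auto)
      have "\<bar>N1 e s n - N1 e s' n'\<bar> = \<bar>E (- n) - E (- n')\<bar>" by (simp add: N1_def abs_minus_commute)
      also have "\<dots> \<le> 2 * (\<rho> * ?d)" using e1 by simp
      also have "\<dots> \<le> M * (\<rho> * ?d)" using p q \<rho> by (intro mult_right_mono) (simp_all add: M_def)
      finally show "\<bar>N1 e s n - N1 e s' n'\<bar> \<le> M * \<rho> * ?d" by (simp add: mult.assoc)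
      have "N2 e s n - N2 e s' n' = q * ((E (- n) - E (- n')) - (E (s - (p + 1) * n) - E (s' - (p + 1) * n')))"
        by (simp add: N2_def algebra_simps)
      hence "\<bar>N2 e s n - N2 e s' n'\<bar> = q * \<bar>(E (- n) - E (- n')) - (E (s - (p + 1) * n) - E (s' - (p + 1) * n'))\<bar>"
        using q by (simp add: abs_mult)
      also have "\<dots> \<le> q * (2 * \<rho> * ?d + 2 * \<rho> * ((p + 1) * ?d))"
        using q by (intro mult_left_mono order_trans[OF abs_triangle_ineq4] add_mono e1 e2) auto
      also have "\<dots> = 2 * q * (p + 2) * (\<rho> * ?d)" by (simp add: algebra_simps)
      also have "\<dots> \<le> M * (\<rho> * ?d)" using \<rho> by (intro mult_right_mono) (simp_all add: M_def)
      finally show "\<bar>N2 e s n - N2 e s' n'\<bar> \<le> M * \<rho> * ?d" by (simp add: mult.assoc)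
    qed
    show ?thesis
    proof (rule that[OF \<delta> \<epsilon>0(1) less_imp_le[OF B]], goal_cases)
      case (1 e)
      note ec = 1(1) and eb = 1(2) and eg = 1(3)
      \<comment> \<open>The unknown of the fixed-point problem is the inhomogeneity
        \<open>H = (h1, h2)\<close>, not the pair \<open>(s, n)\<close>. Only continuity of
        \<open>H\<close> has to be preserved; differentiability of \<open>(s, n)\<close> comes from
        the linear theory.\<close>
      define X where "X x = {- B0 * \<bar>e x\<bar> .. B0 * \<bar>e x\<bar>} \<times> {- B0 * \<bar>e x\<bar> .. B0 * \<bar>e x\<bar>}" for x
      define sol where "sol H = S (\<lambda>x. fst (H x)) (\<lambda>x. snd (H x))" for H :: "real \<Rightarrow> real \<times> real"
      define nol where "nol H = N (\<lambda>x. fst (H x)) (\<lambda>x. snd (H x))" for H :: "real \<Rightarrow> real \<times> real"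
      define A where "A = {f \<in> bcontfun. \<forall>x. f x \<in> X x}"
      have A1: "\<bar>fst (H x)\<bar> \<le> B0 * \<bar>e x\<bar>" "\<bar>snd (H x)\<bar> \<le> B0 * \<bar>e x\<bar>" if "H \<in> A" for H x
        using that by (auto simp: A_def X_def mem_Times_iff abs_le_iff dest!: spec[of _ x])
      have A2: "\<bar>fst (H x)\<bar> \<le> B0 * \<epsilon>0" "\<bar>snd (H x)\<bar> \<le> B0 * \<epsilon>0" if "H \<in> A" for H x
        using A1[OF that, of x] mult_left_mono[OF eb[of x], of B0] B0 by linarith+
      have AC: "continuous_on UNIV (\<lambda>x. fst (H x))" "continuous_on UNIV (\<lambda>x. snd (H x))" if "H \<in> A" for H
        using that by (auto simp: A_def bcontfun_def intro!: continuous_intros)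
      have sb: "\<bar>sol H z\<bar> \<le> B * \<bar>e z\<bar> \<and> \<bar>nol H z\<bar> \<le> B * \<bar>e z\<bar>" if "H \<in> A" for H z
      proof -
        \<comment> \<open>The growth condition on \<open>e\<close> is used exactly here: it turns a
          bound by \<open>\<bar>e x\<bar>\<close> at all later \<open>x\<close> into a weighted
          bound by \<open>\<bar>e z\<bar>\<close>.\<close>
        have G: "B0 * \<bar>e x\<bar> \<le> (B0 * C * \<bar>e z\<bar>) * exp (\<delta> * (x - z))" if "z \<le> x" for x
          using mult_left_mono[OF eg[OF that], of B0] B0 by (simp add: mult_ac)
        have "\<bar>sol H z\<bar> \<le> K * (B0 * C * \<bar>e z\<bar>) \<and> \<bar>nol H z\<bar> \<le> K * (B0 * C * \<bar>e z\<bar>)"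
          unfolding sol_def nol_def
        proof (rule bnd[OF AC[OF that] A2[OF that]])
          show "\<bar>fst (H x)\<bar> \<le> (B0 * C * \<bar>e z\<bar>) * exp (\<delta> * (x - z))" if "z \<le> x" for x
            by (rule order_trans[OF A1(1)[OF \<open>H \<in> A\<close>] G[OF that]])
          show "\<bar>snd (H x)\<bar> \<le> (B0 * C * \<bar>e z\<bar>) * exp (\<delta> * (x - z))" if "z \<le> x" for x
            by (rule order_trans[OF A1(2)[OF \<open>H \<in> A\<close>] G[OF that]])
        qed
        thus ?thesis by (simp add: B_def mult_ac)
      qed
      have sb': "\<bar>sol H z\<bar> \<le> B * \<epsilon>0" "\<bar>nol H z\<bar> \<le> B * \<epsilon>0" if "H \<in> A" for H z
        using sb[OF that, of z] mult_left_mono[OF eb[of z], of B] B by linarith+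
      have sder: "(sol H has_real_derivative nol H z + fst (H z)) (at z) \<and>
             (nol H has_real_derivative \<kappa> * nol H z - q * sol H z + snd (H z)) (at z)" if "H \<in> A" for H z
        unfolding sol_def nol_def by (rule der[OF AC[OF that] A2[OF that]])
      have snc: "continuous_on UNIV (sol H)" "continuous_on UNIV (nol H)" if "H \<in> A" for H
        by (rule DERIV_continuous_on, rule DERIV_subset[OF conjunct1[OF sder[OF that]] subset_UNIV],
            rule DERIV_continuous_on, rule DERIV_subset[OF conjunct2[OF sder[OF that]] subset_UNIV])
      define T where "T H x = (N1 (e x) (sol H x) (nol H x), N2 (e x) (sol H x) (nol H x))" for H x
      have "\<exists>H. H \<in> A \<and> T H = H"
      proof (rule bcontfun_fixpoint[where X=X and T=T and c="1/2" and ?f0.0="\<lambda>x. (0,0)", folded A_def])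
        show "closed (X x)" for x by (simp add: X_def closed_Times)
        show "(\<lambda>x. (0,0)) \<in> A" using B0 by (auto simp: A_def X_def const_bcontfun)
      next
        fix H assume H: "H \<in> A"
        have TX: "T H x \<in> X x" for x
        proof -
          let ?s = "sol H x" and ?n = "nol H x"
          have *: "M * \<rho> * (\<bar>?s - 0\<bar> + \<bar>?n - 0\<bar>) \<le> (p + 1) * \<bar>e x\<bar>"
          proof -
            have "M * \<rho> * (\<bar>?s - 0\<bar> + \<bar>?n - 0\<bar>) \<le> M * \<rho> * (2 * (B * \<bar>e x\<bar>))"
              using sb[OF H, of x] M \<rho> by (intro mult_left_mono) auto
            also have "\<dots> = (8 * M * K * C * \<rho>) * (B0 * \<bar>e x\<bar> / 4)"
              by (simp add: B_def)
            also have "\<dots> \<le> 1 * (B0 * \<bar>e x\<bar> / 4)"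
              using \<rho>(3) B0 by (intro mult_right_mono) auto
            also have "\<dots> \<le> (p + 1) * \<bar>e x\<bar>" using p by (simp add: B0_def) (simp add: algebra_simps)
            finally show ?thesis .
          qed
          have z: "\<bar>0::real\<bar> \<le> B * \<epsilon>0" using B \<epsilon>0 by simp
          have "\<bar>N1 (e x) 0 0\<bar> \<le> (p + 1) * \<bar>e x\<bar>" "\<bar>N2 (e x) 0 0\<bar> \<le> (p + 1) * \<bar>e x\<bar>"
            using p by (simp_all add: N1_def N2_def E0 abs_mult algebra_simps)
          hence "\<bar>N1 (e x) ?s ?n\<bar> \<le> B0 * \<bar>e x\<bar>" "\<bar>N2 (e x) ?s ?n\<bar> \<le> B0 * \<bar>e x\<bar>"
            using lip[OF sb'(1)[OF H, of x] z sb'(2)[OF H, of x] z, of "e x"] * unfolding B0_def by linarith+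
          thus ?thesis by (auto simp: T_def X_def abs_le_iff)
        qed
        have "continuous_on UNIV (T H)"
          unfolding T_def N1_def N2_def E_def
          by (intro continuous_intros snc[OF H] ec)
        moreover have "norm (T H x) \<le> 2 * (B0 * \<epsilon>0)" for x
        proof -
          have "\<bar>fst (T H x)\<bar> \<le> B0 * \<bar>e x\<bar>" "\<bar>snd (T H x)\<bar> \<le> B0 * \<bar>e x\<bar>"
            using TX[of x] by (auto simp: X_def mem_Times_iff abs_le_iff)
          moreover have "B0 * \<bar>e x\<bar> \<le> B0 * \<epsilon>0" using eb[of x] B0 by (intro mult_left_mono) auto
          moreover have "norm (T H x) \<le> \<bar>fst (T H x)\<bar> + \<bar>snd (T H x)\<bar>"
            using norm_Pair_le[of "fst (T H x)" "snd (T H x)"] by simp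
          ultimately show ?thesis by linarith
        qed
        ultimately have "T H \<in> bcontfun" by (rule bcontfun_normI)
        thus "T H \<in> A" using TX by (auto simp: A_def)
      next
        fix H J d x assume HJ: "H \<in> A" "J \<in> A" and d: "\<And>x. dist (H x) (J x) \<le> d"
        have d0: "0 \<le> d" using d[of 0] zero_le_dist order_trans by blast
        have dd: "\<bar>fst (H x) - fst (J x)\<bar> \<le> d" "\<bar>snd (H x) - snd (J x)\<bar> \<le> d" for x
          using d[of x] dist_fst_le[of "H x" "J x"] dist_snd_le[of "H x" "J x"] by (auto simp: dist_real_def)
        have 1: "sol H x - sol J x = S (\<lambda>x. fst (H x) - fst (J x)) (\<lambda>x. snd (H x) - snd (J x)) x \<and>
              nol H x - nol J x = N (\<lambda>x. fst (H x) - fst (J x)) (\<lambda>x. snd (H x) - snd (J x)) x"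
          using dif[OF AC[OF HJ(1)] AC[OF HJ(2)] A2[OF HJ(1)] A2[OF HJ(2)], of x] by (simp add: sol_def nol_def)
        have "\<bar>S (\<lambda>x. fst (H x) - fst (J x)) (\<lambda>x. snd (H x) - snd (J x)) x\<bar> \<le> K * d \<and>
              \<bar>N (\<lambda>x. fst (H x) - fst (J x)) (\<lambda>x. snd (H x) - snd (J x)) x\<bar> \<le> K * d"
        proof (rule bnd[where b'=d])
          \<comment> \<open>For differences a constant bound is enough; the weight is at least 1 and
            is inserted only to match the operator estimate.\<close>
          have "d \<le> d * exp (\<delta> * (y - x))" if "x \<le> y" for y
            using mult_left_mono[of 1 "exp (\<delta> * (y - x))" d] \<delta> d0 that by auto
          from order_trans[OF dd(1) this] order_trans[OF dd(2) this]
          show "\<bar>fst (H y) - fst (J y)\<bar> \<le> d * exp (\<delta> * (y - x))" "\<bar>snd (H y) - snd (J y)\<bar> \<le> d * exp (\<delta> * (y - x))"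
            if "x \<le> y" for y using that by blast+
        qed (auto intro!: continuous_intros AC HJ dd)
        hence 2: "\<bar>sol H x - sol J x\<bar> + \<bar>nol H x - nol J x\<bar> \<le> 2 * (K * d)" using 1 by simp
        have "M * \<rho> * (\<bar>sol H x - sol J x\<bar> + \<bar>nol H x - nol J x\<bar>) \<le> M * \<rho> * (2 * (K * d))"
          using 2 M \<rho> by (intro mult_left_mono) auto
        also have "\<dots> = (8 * M * K * \<rho>) * (d / 4)" by simp
        also have "\<dots> \<le> 1 * (d / 4)"
        proof (intro mult_right_mono)
          have "8 * M * K * \<rho> * 1 \<le> 8 * M * K * \<rho> * C" using C M K \<rho> by (intro mult_left_mono) auto
          thus "8 * M * K * \<rho> \<le> 1" using \<rho>(3) by (simp add: mult_ac)
        qed (use d0 in auto)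
        finally have 3: "M * \<rho> * (\<bar>sol H x - sol J x\<bar> + \<bar>nol H x - nol J x\<bar>) \<le> d / 4" by simp
        have "dist (T H x) (T J x) \<le> \<bar>N1 (e x) (sol H x) (nol H x) - N1 (e x) (sol J x) (nol J x)\<bar>
             + \<bar>N2 (e x) (sol H x) (nol H x) - N2 (e x) (sol J x) (nol J x)\<bar>"
          unfolding T_def dist_norm diff_Pair by (rule order_trans[OF norm_Pair_le]) simp
        also have "\<dots> \<le> d / 4 + d / 4"
          by (intro add_mono order_trans[OF lip(1) 3] order_trans[OF lip(2) 3] sb' HJ)
        finally show "dist (T H x) (T J x) \<le> 1/2 * d" by simp
      qed auto
      then obtain H where H: "H \<in> A" "T H = H" by blast
      show ?case
      proof (intro exI allI conjI)
        fix z
        show "\<bar>sol H z\<bar> \<le> B * \<bar>e z\<bar>" "\<bar>nol H z\<bar> \<le> B * \<bar>e z\<bar>" using sb[OF H(1)] by auto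
        have *: "fst (H z) = N1 (e z) (sol H z) (nol H z)" "snd (H z) = N2 (e z) (sol H z) (nol H z)"
          using fun_cong[OF H(2), of z] by (auto simp: T_def prod_eq_iff)
        have D: "(sol H has_real_derivative nol H z + fst (H z)) (at z)"
          "(nol H has_real_derivative \<kappa> * nol H z - q * sol H z + snd (H z)) (at z)"
          using sder[OF H(1), of z] by auto
        have "nol H z + fst (H z) = 1 - exp (- nol H z) - p * e z"
          by (simp add: * N1_def E_def)
        with D(1) show "(sol H has_real_derivative 1 - exp (- nol H z) - p * e z) (at z)" by simp
        have "\<kappa> * nol H z - q * sol H z + snd (H z) =
            \<kappa> / p * (exp (- nol H z) - exp (sol H z - (p + 1) * nol H z)) - e z"
          using p by (simp add: * N2_def E_def q_def field_simps)
        with D(2) show "(nol H has_real_derivative \<kappa> / p * (exp (- nol H z) - exp (sol H z - (p + 1) * nol H z)) - e z) (at z)"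
          by simp
      qed
    qed
  qed
qed

section \<open>Continuation of the flux system\<close>

text \<open>With a Lipschitz condition that is global in the state, the solution exists on the whole
  interval at once, without any discussion of maximal solutions.\<close>

lemma picard_lindelof:
  fixes V :: "real \<Rightarrow> 'a::banach \<Rightarrow> 'a"
  assumes ab: "a \<le> b" and L: "L > 0"
    and cont: "continuous_on ({a..b} \<times> UNIV) (\<lambda>(t, x). V t x)"
    and lip: "\<And>t x y. t \<in> {a..b} \<Longrightarrow> dist (V t x) (V t y) \<le> L * dist x y"
  obtains x where "x a = x0"
    "\<And>t. t \<in> {a..b} \<Longrightarrow> (x has_vector_derivative V t (x t)) (at t within {a..b})"
proof -
  \<comment> \<open>Bielecki's weight \<open>exp (- K (t - a))\<close> makes the integral operator a contraction on all of \<open>{a..b}\<close>.\<close>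
  define K where "K = 2 * L"
  have K: "K > 0" using L by (simp add: K_def)
  \<comment> \<open>Clamping time to the interval extends functions to the whole line, since the
    fixed-point lemma works with functions on a full type.\<close>
  define cl where "cl t = max a (min b t)" for t
  have cl: "cl t \<in> {a..b}" for t using ab by (auto simp: cl_def)
  have clc: "continuous_on S cl" for S unfolding cl_def by (intro continuous_intros)
  define J where "J f t = integral {a..t} (\<lambda>s. V s (exp (K * (s - a)) *\<^sub>R f s))" for f t
  \<comment> \<open>\<open>f\<close> stands for the rescaled trajectory
    \<open>exp (- K * (t - a))\<close> times \<open>x t\<close>, so the plain sup norm of
    \<open>f\<close> is the weighted norm of \<open>x\<close>.\<close>
  define T where "T f t = exp (- K * (cl t - a)) *\<^sub>R (x0 + J f (cl t))" for f t
  have Vc: "continuous_on {a..b} (\<lambda>s. V s (exp (K * (s - a)) *\<^sub>R f s))" if "continuous_on UNIV f" for f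
  proof -
    have "continuous_on {a..b} ((\<lambda>(t, x). V t x) \<circ> (\<lambda>s. (s, exp (K * (s - a)) *\<^sub>R f s)))"
      by (intro continuous_on_compose continuous_intros continuous_on_subset[OF that]
                continuous_on_subset[OF cont]) auto
    thus ?thesis by (simp add: o_def)
  qed
  have Jc: "continuous_on {a..b} (J f)" if "continuous_on UNIV f" for f
    unfolding J_def by (intro indefinite_integral_continuous_1 integrable_continuous_real Vc that)
  have "\<exists>f. f \<in> {f \<in> bcontfun. \<forall>x. f x \<in> UNIV} \<and> T f = f"
  proof (rule bcontfun_fixpoint[where X="\<lambda>_. UNIV" and T=T and c="1/2" and ?f0.0="\<lambda>_. 0"])
    show "(\<lambda>_::real. 0::'a) \<in> {f \<in> bcontfun. \<forall>x. f x \<in> UNIV}" by (simp add: const_bcontfun)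
  next
    fix f :: "real \<Rightarrow> 'a" assume "f \<in> {f \<in> bcontfun. \<forall>x. f x \<in> UNIV}"
    hence f: "continuous_on UNIV f" by (simp add: bcontfun_def)
    let ?g = "\<lambda>r. exp (- K * (r - a)) *\<^sub>R (x0 + J f r)"
    have g: "continuous_on {a..b} ?g"
      by (intro continuous_intros Jc f)
    hence "continuous_on UNIV (?g \<circ> cl)"
      by (intro continuous_on_compose clc) (rule continuous_on_subset, use cl in auto)
    hence 1: "continuous_on UNIV (T f)" by (simp add: T_def o_def)
    have "bounded (?g ` {a..b})" by (intro compact_imp_bounded compact_continuous_image g) auto
    then obtain B where B: "\<And>r. r \<in> {a..b} \<Longrightarrow> norm (?g r) \<le> B" unfolding bounded_iff by (metis image_eqI)
    have "norm (T f t) \<le> B" for t using B[OF cl[of t]] by (simp only: T_def)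
    from bcontfun_normI[OF 1 this] show "T f \<in> {f \<in> bcontfun. \<forall>x. f x \<in> UNIV}" by simp
  next
    fix f g :: "real \<Rightarrow> 'a" and d t
    assume "f \<in> {f \<in> bcontfun. \<forall>x. f x \<in> UNIV}" "g \<in> {f \<in> bcontfun. \<forall>x. f x \<in> UNIV}"
    hence f: "continuous_on UNIV f" and g: "continuous_on UNIV g" by (simp_all add: bcontfun_def)
    assume d: "\<And>x. dist (f x) (g x) \<le> d"
    have d0: "d \<ge> 0" using d[of 0] zero_le_dist order_trans by blast
    let ?r = "cl t" let ?F = "\<lambda>f s. V s (exp (K * (s - a)) *\<^sub>R f s)"
    have r: "a \<le> ?r" "?r \<le> b" using cl[of t] by auto
    have int: "?F f integrable_on {a..?r}" if "continuous_on UNIV f" for f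
      by (rule integrable_continuous_real, rule continuous_on_subset[OF Vc[OF that]]) (use r in auto)
    have G: "((\<lambda>s. L * d * exp (K * (s - a))) has_integral (L * d / K * exp (K * (?r - a)) - L * d / K * exp (K * (a - a)))) {a..?r}"
    proof (rule fundamental_theorem_of_calculus[OF r(1)])
      fix s assume "s \<in> {a..?r}"
      have "((\<lambda>s. L * d / K * exp (K * (s - a))) has_real_derivative L * d / K * (exp (K * (s - a)) * K)) (at s within {a..?r})"
        by (auto intro!: derivative_eq_intros)
      thus "((\<lambda>s. L * d / K * exp (K * (s - a))) has_vector_derivative L * d * exp (K * (s - a))) (at s within {a..?r})"
        using K by (simp add: has_real_derivative_iff_has_vector_derivative mult_ac)
    qed
    have "norm (J f ?r - J g ?r) = norm (integral {a..?r} (\<lambda>s. ?F f s - ?F g s))"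
      unfolding J_def by (subst integral_diff[OF int[OF f] int[OF g]]) simp
    also have "\<dots> \<le> integral {a..?r} (\<lambda>s. L * d * exp (K * (s - a)))"
    proof (rule integral_norm_bound_integral)
      show "(\<lambda>s. ?F f s - ?F g s) integrable_on {a..?r}" by (intro integrable_diff int f g)
      show "(\<lambda>s. L * d * exp (K * (s - a))) integrable_on {a..?r}" using G by blast
      fix s assume s: "s \<in> {a..?r}"
      have "norm (?F f s - ?F g s) \<le> L * dist (exp (K * (s - a)) *\<^sub>R f s) (exp (K * (s - a)) *\<^sub>R g s)"
        using lip[of s] s r by (simp add: dist_norm)
      also have "\<dots> = L * (exp (K * (s - a)) * dist (f s) (g s))"
        by (simp add: dist_norm flip: scaleR_diff_right)
      also have "\<dots> \<le> L * (exp (K * (s - a)) * d)"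
        using L d by (intro mult_left_mono) auto
      finally show "norm (?F f s - ?F g s) \<le> L * d * exp (K * (s - a))" by (simp add: mult_ac)
    qed
    also have "\<dots> = L * d / K * (exp (K * (?r - a)) - 1)"
      using integral_unique[OF G] by (simp add: algebra_simps)
    also have "\<dots> \<le> L * d / K * exp (K * (?r - a))" using L K d0 by (intro mult_left_mono) auto
    also have "\<dots> = d / 2 * exp (K * (?r - a))" using L by (simp add: K_def)
    finally have *: "norm (J f ?r - J g ?r) \<le> d / 2 * exp (K * (?r - a))" .
    have "dist (T f t) (T g t) = exp (- K * (?r - a)) * norm (J f ?r - J g ?r)"
      by (simp add: T_def dist_norm flip: scaleR_diff_right)
    also have "\<dots> \<le> exp (- K * (?r - a)) * (d / 2 * exp (K * (?r - a)))"
      by (intro mult_left_mono *) auto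
    also have "\<dots> = 1/2 * d" by (simp add: exp_minus)
    finally show "dist (T f t) (T g t) \<le> 1/2 * d" .
  qed auto
  then obtain f where f: "f \<in> bcontfun" "T f = f" by auto
  hence fc: "continuous_on UNIV f" by (simp add: bcontfun_def)
  define x where "x t = x0 + J f t" for t
  have x: "exp (K * (t - a)) *\<^sub>R f t = x t" if "t \<in> {a..b}" for t
  proof -
    have "cl t = t" using that by (auto simp: cl_def)
    hence "f t = exp (- K * (t - a)) *\<^sub>R x t" using fun_cong[OF f(2), of t] by (simp add: T_def x_def)
    thus ?thesis by (simp flip: exp_add)
  qed
  show ?thesis
  proof (rule that[of x])
    show "x a = x0" by (simp add: x_def J_def)
    fix t assume t: "t \<in> {a..b}"
    have "(J f has_vector_derivative V t (exp (K * (t - a)) *\<^sub>R f t)) (at t within {a..b})"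
      unfolding J_def by (rule integral_has_vector_derivative[OF Vc[OF fc] t])
    thus "(x has_vector_derivative V t (x t)) (at t within {a..b})"
      unfolding x[OF t] unfolding x_def[abs_def] by (auto intro!: derivative_eq_intros)
  qed
qed

text \<open>For \<open>q < 1\<close> the derivative of the power is unbounded at 0 but decreasing,
  so beyond \<open>c\<close> its value at \<open>c\<close> is the largest.\<close>

lemma powr_lipschitz_above:
  fixes c q x y :: real
  assumes "c > 0" "0 < q" "q \<le> 1" "x \<ge> c" "y \<ge> c"
  shows "\<bar>x powr q - y powr q\<bar> \<le> q * c powr (q - 1) * \<bar>x - y\<bar>"
proof -
  have "norm (x powr q - y powr q) \<le> q * c powr (q - 1) * norm (x - y)"
  proof (rule field_differentiable_bound[where S="{c..}" and f="\<lambda>x. x powr q" and f'="\<lambda>x. q * x powr (q - 1)"])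
    fix z assume z: "z \<in> {c..}"
    show "((\<lambda>x. x powr q) has_field_derivative q * z powr (q - 1)) (at z within {c..})"
      using z assms by (auto intro!: derivative_eq_intros)
    have "z powr (q - 1) \<le> c powr (q - 1)" using z assms by (intro powr_mono2') auto
    thus "norm (q * z powr (q - 1)) \<le> q * c powr (q - 1)" using assms by (simp add: abs_mult mult_left_mono)
  qed (use assms in auto)
  thus ?thesis by simp
qed

text \<open>The vector field uses \<open>max c1 \<Phi>\<close> in place of \<Phi>, which makes it
  globally Lipschitz. Since \<open>F \<ge> 0\<close>, the flux only increases from its initial value
  \<open>c1\<close>, so the truncation is never felt.\<close>

lemma radial_flux_ivp:
  fixes \<alpha> \<gamma> p r1 R u1 c1 :: real
  assumes p: "p \<ge> 1" and r1: "r1 > 0" "r1 \<le> R" and c1: "c1 > 0"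
    and F0: "\<And>x. F x \<ge> 0" and FL: "\<And>x y. \<bar>F x - F y\<bar> \<le> LF * \<bar>x - y\<bar>"
  obtains u \<Phi> where "u r1 = u1" "\<Phi> r1 = c1"
    "\<And>r. r \<in> {r1..R} \<Longrightarrow> (u has_real_derivative - ((r powr (-\<alpha>) * \<Phi> r) powr (1/p))) (at r within {r1..R})"
    "\<And>r. r \<in> {r1..R} \<Longrightarrow> (\<Phi> has_real_derivative r powr \<gamma> * F (u r)) (at r within {r1..R})"
    "\<And>r. r \<in> {r1..R} \<Longrightarrow> \<Phi> r \<ge> c1"
proof -
  define q where "q = 1 / p"
  have q: "0 < q" "q \<le> 1" using p by (auto simp: q_def)
  define V where "V r x = (- ((r powr (-\<alpha>) * max c1 (snd x)) powr q), r powr \<gamma> * F (fst x))" for r and x :: "real \<times> real"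
  have "0 \<le> \<bar>F 0 - F 1\<bar>" by simp
  hence LF: "LF \<ge> 0" using FL[of 0 1] by simp
  have Fc: "continuous_on S F" for S
    by (rule continuous_on_subset[OF lipschitz_on_continuous_on[of LF UNIV]])
       (auto intro!: lipschitz_onI LF simp: dist_real_def FL)
  have "bounded ((\<lambda>r. (r powr (-\<alpha>)) powr q) ` {r1..R})"
    using r1 by (intro compact_imp_bounded compact_continuous_image continuous_intros) auto
  then obtain M1 where M1: "\<And>r. r \<in> {r1..R} \<Longrightarrow> (r powr (-\<alpha>)) powr q \<le> M1"
    unfolding bounded_iff by (metis image_eqI norm_of_real abs_le_D1 real_norm_def)
  have "bounded ((\<lambda>r. r powr \<gamma>) ` {r1..R})"
    using r1 by (intro compact_imp_bounded compact_continuous_image continuous_intros) auto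
  then obtain M2 where M2: "\<And>r. r \<in> {r1..R} \<Longrightarrow> r powr \<gamma> \<le> M2"
    unfolding bounded_iff by (metis image_eqI norm_of_real abs_le_D1 real_norm_def)
  have "0 \<le> (r1 powr (-\<alpha>)) powr q" "0 \<le> r1 powr \<gamma>" by simp_all
  hence M0: "M1 \<ge> 0" "M2 \<ge> 0" using M1[of r1] M2[of r1] r1 by (metis atLeastAtMost_iff order_refl order_trans)+
  define L1 where "L1 = M1 * (q * c1 powr (q - 1))"
  have L1: "L1 \<ge> 0" using M0 q by (simp add: L1_def)
  define L where "L = L1 + M2 * LF + 1"
  have lip: "dist (V r x) (V r y) \<le> L * dist x y" if r: "r \<in> {r1..R}" for r x y
  proof -
    have d: "\<bar>fst x - fst y\<bar> \<le> dist x y" "\<bar>snd x - snd y\<bar> \<le> dist x y"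
      using dist_fst_le[of x y] dist_snd_le[of x y] by (auto simp: dist_real_def)
    let ?a = "max c1 (snd x)" and ?b = "max c1 (snd y)"
    have "\<bar>fst (V r x) - fst (V r y)\<bar> = (r powr (-\<alpha>)) powr q * \<bar>?a powr q - ?b powr q\<bar>"
      using r r1 c1 by (simp add: V_def powr_mult abs_mult abs_minus_commute flip: right_diff_distrib)
    also have "\<dots> \<le> M1 * (q * c1 powr (q - 1) * \<bar>?a - ?b\<bar>)"
      using M1[OF r] c1 q M0 by (intro mult_mono powr_lipschitz_above) auto
    also have "\<dots> \<le> M1 * (q * c1 powr (q - 1) * dist x y)"
      using M0 q d(2) by (intro mult_left_mono) auto
    finally have 1: "\<bar>fst (V r x) - fst (V r y)\<bar> \<le> L1 * dist x y" by (simp add: L1_def mult_ac)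
    have "\<bar>snd (V r x) - snd (V r y)\<bar> = r powr \<gamma> * \<bar>F (fst x) - F (fst y)\<bar>"
      by (simp add: V_def abs_mult flip: right_diff_distrib)
    also have "\<dots> \<le> M2 * (LF * dist x y)"
      using M2[OF r] M0 LF by (intro mult_mono order_trans[OF FL] mult_left_mono d) auto
    finally have 2: "\<bar>snd (V r x) - snd (V r y)\<bar> \<le> M2 * LF * dist x y" by (simp add: mult_ac)
    have "dist (V r x) (V r y) \<le> \<bar>fst (V r x) - fst (V r y)\<bar> + \<bar>snd (V r x) - snd (V r y)\<bar>"
      using norm_Pair_le[of "fst (V r x) - fst (V r y)" "snd (V r x) - snd (V r y)"]
      by (simp add: dist_norm minus_prod_def)
    also have "\<dots> \<le> L1 * dist x y + M2 * LF * dist x y" by (intro add_mono 1 2)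
    also have "\<dots> \<le> L * dist x y" by (simp add: L_def algebra_simps)
    finally show ?thesis .
  qed
  have Vc: "continuous_on ({r1..R} \<times> UNIV) (\<lambda>(r, x). V r x)"
  proof -
    have F': "continuous_on ({r1..R} \<times> (UNIV :: (real \<times> real) set)) (\<lambda>x. F (fst (snd x)))"
      by (rule continuous_on_compose2[OF Fc[of UNIV]]) (auto intro!: continuous_intros)
    show ?thesis
      unfolding V_def case_prod_beta
      using r1 c1 by (intro continuous_intros F') (auto simp: less_max_iff_disj)
  qed
  have L0: "L > 0" using L1 M0 LF by (simp add: L_def add_nonneg_pos)
  obtain x where x0: "x r1 = (u1, c1)"
    and x: "\<And>t. t \<in> {r1..R} \<Longrightarrow> (x has_vector_derivative V t (x t)) (at t within {r1..R})"
    using picard_lindelof[OF r1(2) L0 Vc lip, of "(u1,c1)"] by blast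
  define u where "u t = fst (x t)" for t
  define \<Phi> where "\<Phi> t = snd (x t)" for t
  have u': "(u has_real_derivative - ((r powr (-\<alpha>) * max c1 (\<Phi> r)) powr q)) (at r within {r1..R})"
    and \<Phi>': "(\<Phi> has_real_derivative r powr \<gamma> * F (u r)) (at r within {r1..R})"
    if r: "r \<in> {r1..R}" for r
    using bounded_linear.has_vector_derivative[OF bounded_linear_fst x[OF r]]
      bounded_linear.has_vector_derivative[OF bounded_linear_snd x[OF r]]
    unfolding has_real_derivative_iff_has_vector_derivative u_def \<Phi>_def V_def by simp_all
  have \<Phi>c: "\<Phi> r \<ge> c1" if r: "r \<in> {r1..R}" for r
  proof -
    have "\<Phi> r1 \<le> \<Phi> r"
    proof (rule DERIV_nonneg_imp_increasing_open[where f=\<Phi>])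
      show "continuous_on {r1..r} \<Phi>"
        by (rule continuous_on_subset[OF DERIV_continuous_on[OF \<Phi>']]) (use r in auto)
      fix s assume s: "r1 < s" "s < r"
      have "(\<Phi> has_real_derivative s powr \<gamma> * F (u s)) (at s)"
        using \<Phi>'[of s] s r at_within_Icc_at[of r1 s R] by auto
      thus "\<exists>y. (\<Phi> has_real_derivative y) (at s) \<and> 0 \<le> y" using F0 by (meson mult_nonneg_nonneg powr_ge_zero)
    qed (use r in auto)
    thus ?thesis by (simp add: \<Phi>_def x0)
  qed
  show ?thesis
  proof (rule that[of u \<Phi>])
    show "u r1 = u1" "\<Phi> r1 = c1" by (simp_all add: u_def \<Phi>_def x0)
    fix r assume r: "r \<in> {r1..R}"
    have "max c1 (\<Phi> r) = \<Phi> r" using \<Phi>c[OF r] by simp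
    with u'[OF r] show "(u has_real_derivative - ((r powr (-\<alpha>) * \<Phi> r) powr (1/p))) (at r within {r1..R})"
      by (simp add: q_def)
  qed (use \<Phi>' \<Phi>c in auto)
qed

text \<open>From \<open>F \<ge> m\<close> the flux is at least a multiple of
  \<open>r powr (\<gamma> + 1)\<close>. Hence \<open>- u'\<close> is at least a multiple of
  \<open>r powr (\<theta> / p - 1)\<close>, whose primitive is unbounded because \<theta> > 0; so
  \<open>u\<close> must become negative.\<close>

lemma radial_flux_ivp_vanishing:
  fixes \<alpha> \<gamma> \<theta> p r1 u1 c1 m :: real
  assumes p: "p \<ge> 1" and r1: "r1 > 0" and c1: "c1 > 0" and m: "m > 0"
    and exps: "\<theta> > 0" "\<gamma> + 1 > 0" "\<gamma> + 1 + p - \<alpha> = \<theta>"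
    and Fm: "\<And>x. F x \<ge> m" and FL: "\<And>x y. \<bar>F x - F y\<bar> \<le> LF * \<bar>x - y\<bar>"
  obtains u \<Phi> R where "R > r1" "u r1 = u1" "\<Phi> r1 = c1" "u R < 0"
    "\<And>r. r \<in> {r1..R} \<Longrightarrow> (u has_real_derivative - ((r powr (-\<alpha>) * \<Phi> r) powr (1/p))) (at r within {r1..R})"
    "\<And>r. r \<in> {r1..R} \<Longrightarrow> (\<Phi> has_real_derivative r powr \<gamma> * F (u r)) (at r within {r1..R})"
    "\<And>r. r \<in> {r1..R} \<Longrightarrow> \<Phi> r > 0"
proof -
  \<comment> \<open>The first entry makes \<open>c * r powr (\<gamma> + 1)\<close> start below the
    flux at \<open>r1\<close>, the second makes it grow no faster.\<close>
  define c where "c = min (c1 / r1 powr (\<gamma> + 1)) (m / (\<gamma> + 1))"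
  have c: "c > 0" "c * r1 powr (\<gamma> + 1) \<le> c1" "c * (\<gamma> + 1) \<le> m"
  proof -
    show "c > 0" using c1 m r1 exps by (simp add: c_def)
    have "c \<le> c1 / r1 powr (\<gamma> + 1)" by (simp add: c_def)
    thus "c * r1 powr (\<gamma> + 1) \<le> c1" using r1 by (simp add: pos_le_divide_eq)
    have "c \<le> m / (\<gamma> + 1)" by (simp add: c_def)
    thus "c * (\<gamma> + 1) \<le> m" using exps by (simp add: pos_le_divide_eq)
  qed
  define k where "k = c powr (1/p) * (p / \<theta>)"
  have k: "k > 0" using c p exps by (simp add: k_def)
  define Y where "Y = (\<bar>u1\<bar> + 1) / k + r1 powr (\<theta> / p)"
  have Y: "Y > r1 powr (\<theta> / p)" "k * Y = \<bar>u1\<bar> + 1 + k * r1 powr (\<theta> / p)" using k by (auto simp: Y_def field_simps)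
  \<comment> \<open>At this radius the comparison function \<open>k * r powr (\<theta> / p)\<close>
    has gained exactly \<open>\<bar>u1\<bar> + 1\<close> since \<open>r1\<close>.\<close>
  define R where "R = Y powr (p / \<theta>)"
  have Y0: "Y > 0" using Y(1) powr_ge_zero[of r1 "\<theta>/p"] by linarith
  have RY: "R powr (\<theta> / p) = Y" using Y0 p exps by (simp add: R_def powr_powr)
  have R: "R > r1"
  proof (rule ccontr)
    assume "\<not> R > r1"
    hence "R powr (\<theta> / p) \<le> r1 powr (\<theta> / p)" using p exps by (intro powr_mono2) (auto simp: R_def)
    thus False using Y(1) RY by simp
  qed
  have F0: "F x \<ge> 0" for x using Fm[of x] m by linarith
  obtain u \<Phi> where S: "u r1 = u1" "\<Phi> r1 = c1"
    "\<And>r. r \<in> {r1..R} \<Longrightarrow> (u has_real_derivative - ((r powr (-\<alpha>) * \<Phi> r) powr (1/p))) (at r within {r1..R})"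
    "\<And>r. r \<in> {r1..R} \<Longrightarrow> (\<Phi> has_real_derivative r powr \<gamma> * F (u r)) (at r within {r1..R})"
    "\<And>r. r \<in> {r1..R} \<Longrightarrow> \<Phi> r \<ge> c1"
    using radial_flux_ivp[OF p r1 less_imp_le[OF R] c1 F0 FL, of u1 \<alpha> \<gamma>] by blast
  have \<Phi>lb: "\<Phi> r \<ge> c * r powr (\<gamma> + 1)" if r: "r \<in> {r1..R}" for r
  proof -
    let ?\<psi> = "\<lambda>s. \<Phi> s - c * s powr (\<gamma> + 1)"
    have d: "(?\<psi> has_real_derivative s powr \<gamma> * (F (u s) - c * (\<gamma> + 1))) (at s within {r1..R})" if "s \<in> {r1..R}" for s
      using that r1 by (auto intro!: derivative_eq_intros S(4) simp: algebra_simps)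
    have "?\<psi> r1 \<le> ?\<psi> r"
    proof (rule DERIV_nonneg_imp_increasing_open[where f="?\<psi>"])
      show "continuous_on {r1..r} ?\<psi>"
        by (rule continuous_on_subset[OF DERIV_continuous_on[OF d]]) (use r in auto)
      fix s assume s: "r1 < s" "s < r"
      have "(?\<psi> has_real_derivative s powr \<gamma> * (F (u s) - c * (\<gamma> + 1))) (at s)"
        using d[of s] s r at_within_Icc_at[of r1 s R] by auto
      moreover have "s powr \<gamma> * (F (u s) - c * (\<gamma> + 1)) \<ge> 0" using Fm[of "u s"] c(3) by simp
      ultimately show "\<exists>y. (?\<psi> has_real_derivative y) (at s) \<and> 0 \<le> y" by blast
    qed (use r in auto)
    thus ?thesis using S(2) c(2) by simp
  qed
  let ?\<chi> = "\<lambda>s. u s + k * s powr (\<theta> / p)"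
  have d: "(?\<chi> has_real_derivative - ((s powr (-\<alpha>) * \<Phi> s) powr (1/p)) + c powr (1/p) * s powr (\<theta> / p - 1)) (at s within {r1..R})"
    if "s \<in> {r1..R}" for s
    using that r1 p exps by (auto intro!: derivative_eq_intros S(3) simp: k_def)
  have "?\<chi> R \<le> ?\<chi> r1"
  proof (rule DERIV_nonpos_imp_decreasing_open[where f="?\<chi>"])
    show "continuous_on {r1..R} ?\<chi>" by (rule DERIV_continuous_on[OF d])
    fix s assume s: "r1 < s" "s < R"
    have "c powr (1/p) * s powr (\<theta> / p - 1) = (s powr (-\<alpha>) * (c * s powr (\<gamma> + 1))) powr (1/p)"
    proof -
      have e: "s powr (-\<alpha>) * (c * s powr (\<gamma> + 1)) = c * s powr (\<theta> - p)"
      proof -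
        have "- \<alpha> + (\<gamma> + 1) = \<theta> - p" using exps(3) by simp
        thus ?thesis by (metis (no_types) mult.left_commute powr_add)
      qed
      have "(\<theta> - p) * (1 / p) = \<theta> / p - 1" using p by (simp add: field_simps)
      thus ?thesis unfolding e using c s r1 by (simp add: powr_mult powr_powr)
    qed
    also have "\<dots> \<le> (s powr (-\<alpha>) * \<Phi> s) powr (1/p)"
      using \<Phi>lb[of s] s c p by (intro powr_mono2 mult_left_mono) auto
    finally show "\<exists>y. (?\<chi> has_real_derivative y) (at s) \<and> y \<le> 0"
      using d[of s] s at_within_Icc_at[of r1 s R] by fastforce
  qed (use R in auto)
  hence "u R \<le> u1 - \<bar>u1\<bar> - 1" using RY Y(2) S(1) by (simp add: algebra_simps)
  hence "u R < 0" by linarith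
  show ?thesis
  proof (rule that[of R u \<Phi>])
    show "\<Phi> r > 0" if "r \<in> {r1..R}" for r using S(5)[OF that] c1 by linarith
  qed (use R S \<open>u R < 0\<close> in auto)
qed

section \<open>Inverse functions\<close>

text \<open>Serves both for \<open>f\<close> and for the map from \<open>z\<close> to
  \<open>t\<close>. Derivatives are asked for only to the right of \<open>a\<close>, since
  \<open>f\<close> has merely a one-sided derivative at 0.\<close>

lemma increasing_inverse_at_top:
  fixes F F' :: "real \<Rightarrow> real"
  assumes cont: "continuous_on {a..} F" and der: "\<And>x. x > a \<Longrightarrow> (F has_real_derivative F' x) (at x)"
    and pos: "\<And>x. x > a \<Longrightarrow> F' x > 0" and lim: "filterlim F at_top at_top"
  obtains \<zeta> where "\<And>t. t > F a \<Longrightarrow> F (\<zeta> t) = t" "\<And>t. t > F a \<Longrightarrow> \<zeta> t > a"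
    "\<And>x. x > a \<Longrightarrow> \<zeta> (F x) = x"
    "\<And>t. t > F a \<Longrightarrow> (\<zeta> has_real_derivative inverse (F' (\<zeta> t))) (at t)"
    "filterlim \<zeta> at_top at_top"
proof -
  have mono: "F x < F y" if "a \<le> x" "x < y" for x y
  proof (rule DERIV_pos_imp_increasing_open[where f=F])
    show "continuous_on {x..y} F" using that by (auto intro: continuous_on_subset[OF cont])
    fix w assume "x < w" "w < y"
    thus "\<exists>d. (F has_real_derivative d) (at w) \<and> 0 < d" using der[of w] pos[of w] that by auto
  qed (use that in auto)
  hence inj: "inj_on F {a<..}" by (intro inj_onI) (metis greaterThan_iff less_imp_le linorder_neqE less_irrefl)
  define \<zeta> where "\<zeta> = inv_into {a<..} F"
  have left: "\<zeta> (F x) = x" if "x > a" for x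
    unfolding \<zeta>_def using that by (intro inv_into_f_f inj) auto
  have right: "F (\<zeta> t) = t \<and> \<zeta> t > a" if t: "t > F a" for t
  proof -
    have "\<forall>\<^sub>F u in at_top. F u \<ge> t \<and> u \<ge> a"
      using lim by (intro eventually_conj eventually_ge_at_top) (auto simp: filterlim_at_top)
    then obtain U where U: "F U \<ge> t" "U \<ge> a" by (auto dest!: eventually_happens)
    obtain x where x: "a \<le> x" "x \<le> U" "F x = t"
      using IVT'[of F a t U] U t continuous_on_subset[OF cont, of "{a..U}"] by auto
    have "x \<noteq> a" using x t by auto
    thus ?thesis using x left by (metis less_eq_real_def)
  qed
  show ?thesis
  proof (rule that[of \<zeta>])
    fix t assume t: "t > F a"
    have "isCont \<zeta> (F (\<zeta> t))"
    proof (rule isCont_inverse_function[where f=F and d="(\<zeta> t - a) / 2"])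
      show "0 < (\<zeta> t - a) / 2" using right[OF t] by simp
      fix z :: real assume "\<bar>z - \<zeta> t\<bar> \<le> (\<zeta> t - a) / 2"
      hence "\<zeta> t - z \<le> (\<zeta> t - a) / 2" using abs_ge_minus_self[of "z - \<zeta> t"] by linarith
      hence "z > a" using right[OF t] by (simp add: field_simps)
      thus "\<zeta> (F z) = z" "isCont F z" using left der[of z] by (auto intro: DERIV_isCont)
    qed
    hence "isCont \<zeta> t" using right[OF t] by simp
    thus "(\<zeta> has_real_derivative inverse (F' (\<zeta> t))) (at t)"
    proof (intro DERIV_inverse_function[where f=F and g=\<zeta> and a="F a" and b="t+1"] der)
      show "F' (\<zeta> t) \<noteq> 0" using pos[of "\<zeta> t"] right[OF t] by simp
    qed (use t right in auto)
  next
    show "filterlim \<zeta> at_top at_top" unfolding filterlim_at_top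
    proof (rule allI)
      fix Z :: real
      show "\<forall>\<^sub>F t in at_top. Z \<le> \<zeta> t"
        using eventually_gt_at_top[of "max (F a) (F (max Z a))"]
      proof eventually_elim
        case (elim t)
        hence t: "F (\<zeta> t) = t" "\<zeta> t > a" using right[of t] by auto
        show ?case
        proof (rule ccontr)
          assume "\<not> Z \<le> \<zeta> t"
          hence "F (\<zeta> t) < F (max Z a)" using t(2) by (intro mono) auto
          thus False using t(1) elim by simp
        qed
      qed
    qed
  qed (use left right in auto)
qed

section \<open>Regularity of the inverse function \<open>g\<close>\<close>

lemma C4_nonneg_derivative:
  assumes "C4_nonneg f D" "k < 4" "u > 0"
  shows "(D k has_real_derivative D (Suc k) u) (at u)"
proof -
  have "(D k has_real_derivative D (Suc k) u) (at u within {0..})"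
    using assms by (auto simp: C4_nonneg_def)
  thus ?thesis using assms(3) at_within_interior[of u "{0..}"] by simp
qed

lemma C4_nonneg_continuous: "C4_nonneg f D \<Longrightarrow> k < 4 \<Longrightarrow> continuous_on {0..} (D k)"
  by (rule DERIV_continuous_on[where D="D (Suc k)"]) (auto simp: C4_nonneg_def)

text \<open>The only information on \<open>g\<close> is \<open>g (f u) = u\<close> for
  \<open>u \<ge> 0\<close>, so its values below \<open>f 0\<close> are arbitrary. Restricting to
  \<open>t > f 0\<close> gives an open set on which \<open>g\<close> agrees with the true
  inverse.\<close>

lemma C4_nonneg_inverse:
  assumes g_inv: "\<forall>u\<ge>0. g (f u) = u" and f: "C4_nonneg f D" "\<forall>u\<ge>0. D 1 u > 0"
    and lim: "filterlim f at_top at_top"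
  shows "\<And>t. t > f 0 \<Longrightarrow> f (g t) = t" "\<And>t. t > f 0 \<Longrightarrow> g t > 0"
    "\<And>t. t > f 0 \<Longrightarrow> (g has_real_derivative inverse (D 1 (g t))) (at t)"
    "filterlim g at_top at_top"
proof -
  have D0: "D 0 = f" using f by (simp add: C4_nonneg_def)
  have fc: "continuous_on {0..} f" using C4_nonneg_continuous[OF f(1), of 0] D0 by simp
  have der: "(f has_real_derivative D 1 u) (at u)" if "u > 0" for u
    using C4_nonneg_derivative[OF f(1), of 0 u] that D0 by simp
  have pos: "D 1 u > 0" if "u > 0" for u using f(2) less_imp_le[OF that] by blast
  obtain \<zeta> where \<zeta>: "\<And>t. t > f 0 \<Longrightarrow> f (\<zeta> t) = t" "\<And>t. t > f 0 \<Longrightarrow> \<zeta> t > 0"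
    "\<And>t. t > f 0 \<Longrightarrow> (\<zeta> has_real_derivative inverse (D 1 (\<zeta> t))) (at t)"
    "filterlim \<zeta> at_top at_top"
    using increasing_inverse_at_top[OF fc der pos lim] by metis
  have eq: "g t = \<zeta> t" if "t > f 0" for t
    using \<zeta>(1,2)[OF that] g_inv by (metis less_imp_le)
  show "f (g t) = t" "g t > 0" if "t > f 0" for t using \<zeta>(1,2)[OF that] eq[OF that] by simp_all
  show "(g has_real_derivative inverse (D 1 (g t))) (at t)" if "t > f 0" for t
    unfolding eq[OF that] using \<zeta>(3)[OF that]
    by (rule has_field_derivative_transform_within_open[where S="{f 0<..}"]) (use that eq in auto)
  have "\<forall>\<^sub>F t in at_top. \<zeta> t = g t"
    using eventually_gt_at_top[of "f 0"] by eventually_elim (simp add: eq)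
  thus "filterlim g at_top at_top" using \<zeta>(4) filterlim_cong[OF refl refl] by blast
qed

text \<open>The hypotheses speak of iterates of \<open>deriv\<close>, which is meaningful only where
  derivatives exist. Differentiating \<open>g' = 1 / f'(g)\<close> gives
  \<open>g'' = - f''(g) g'^3\<close>, and this is again differentiable.\<close>

lemma C4_nonneg_inverse_derivatives:
  assumes g_inv: "\<forall>u\<ge>0. g (f u) = u" and f: "C4_nonneg f D" "\<forall>u\<ge>0. D 1 u > 0"
    and lim: "filterlim f at_top at_top" and t: "t > f 0"
  shows "(g has_real_derivative deriv g t) (at t)" "deriv g t > 0"
    "(deriv g has_real_derivative (deriv ^^ 2) g t) (at t)"
    "((deriv ^^ 2) g has_real_derivative (deriv ^^ 3) g t) (at t)"
proof -
  note inv = C4_nonneg_inverse[OF g_inv f lim]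
  have d1: "deriv g t = inverse (D 1 (g t))" "(g has_real_derivative deriv g t) (at t)" "deriv g t > 0" if "t > f 0" for t
    using inv(1-3)[OF that] f(2) by (auto simp: DERIV_imp_deriv)
  show "(g has_real_derivative deriv g t) (at t)" "deriv g t > 0" using d1 t by auto
  have D1': "(D 1 has_real_derivative D 2 (g t)) (at (g t))" if "t > f 0" for t
    using C4_nonneg_derivative[OF f(1), of 1 "g t"] inv(1-3)[OF that] by (simp add: numeral_2_eq_2)
  have D2': "(D 2 has_real_derivative D 3 (g t)) (at (g t))" if "t > f 0" for t
    using C4_nonneg_derivative[OF f(1), of 2 "g t"] inv(1-3)[OF that] by (simp add: numeral_3_eq_3 numeral_2_eq_2)
  have d2: "(deriv g has_real_derivative - D 2 (g t) * (deriv g t)^3) (at t)" if t: "t > f 0" for t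
  proof -
    have "D 1 (g t) > 0" using f(2) less_imp_le[OF inv(2)[OF t]] by blast
    hence nz: "D 1 (g t) \<noteq> 0" by linarith
    have "((\<lambda>t. inverse (D 1 (g t))) has_real_derivative - (inverse (D 1 (g t)) * (D 2 (g t) * deriv g t) * inverse (D 1 (g t)))) (at t)"
      by (rule DERIV_inverse'[OF DERIV_chain2[OF D1'[OF t] d1(2)[OF t]] nz])
    moreover have "- (inverse (D 1 (g t)) * (D 2 (g t) * deriv g t) * inverse (D 1 (g t))) = - D 2 (g t) * (deriv g t)^3"
      by (simp add: d1(1)[OF t] power3_eq_cube)
    ultimately have "((\<lambda>t. inverse (D 1 (g t))) has_real_derivative - D 2 (g t) * (deriv g t)^3) (at t)" by (simp only:)
    thus ?thesis
      by (rule has_field_derivative_transform_within_open[where S="{f 0<..}"]) (use t d1(1) in auto)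
  qed
  have e2: "(deriv ^^ 2) g t = - D 2 (g t) * (deriv g t)^3" if "t > f 0" for t
    using DERIV_imp_deriv[OF d2[OF that]] by (simp add: numeral_2_eq_2)
  show "(deriv g has_real_derivative (deriv ^^ 2) g t) (at t)"
    using d2[OF t] e2[OF t] by simp
  \<comment> \<open>The value of the third derivative is irrelevant: once some derivative exists, it
    is \<open>deriv\<close> by definition.\<close>
  have "\<exists>d. ((\<lambda>t. - D 2 (g t) * (deriv g t)^3) has_real_derivative d) (at t)"
    by (rule exI, rule DERIV_mult[OF DERIV_minus[OF DERIV_chain2[OF D2'[OF t] d1(2)[OF t]]] DERIV_power[OF d2[OF t]]])
  then obtain d where "((\<lambda>t. - D 2 (g t) * (deriv g t)^3) has_real_derivative d) (at t)" by blast
  hence "((deriv ^^ 2) g has_real_derivative d) (at t)"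
    by (rule has_field_derivative_transform_within_open[where S="{f 0<..}"]) (use t e2 in auto)
  thus "((deriv ^^ 2) g has_real_derivative (deriv ^^ 3) g t) (at t)"
    using DERIV_imp_deriv[of "(deriv ^^ 2) g" d t] by (simp add: numeral_3_eq_3 numeral_2_eq_2)
qed

section \<open>The solution near the singularity\<close>

text \<open>The order of \<open>x\<close> and \<open>y\<close> is left open, and the intermediate
  point is located by its distance to both of them, which is the form needed to see it as an
  \<open>o(t)\<close> perturbation of \<open>t\<close>.\<close>

lemma mvt_between:
  fixes F F' :: "real \<Rightarrow> real"
  assumes "\<And>x. x > a \<Longrightarrow> (F has_real_derivative F' x) (at x)" "x > a" "y > a"
  shows "\<exists>\<xi>. \<bar>\<xi> - x\<bar> \<le> \<bar>y - x\<bar> \<and> \<bar>\<xi> - y\<bar> \<le> \<bar>y - x\<bar> \<and> F y - F x = F' \<xi> * (y - x)"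
proof (cases x y rule: linorder_cases)
  case less
  then obtain \<xi> where "x < \<xi>" "\<xi> < y" "F y - F x = (y - x) * F' \<xi>"
    using MVT2[of x y F F'] assms by auto
  thus ?thesis by (intro exI[of _ \<xi>]) auto
next
  case greater
  then obtain \<xi> where "y < \<xi>" "\<xi> < x" "F x - F y = (x - y) * F' \<xi>"
    using MVT2[of y x F F'] assms by auto
  thus ?thesis by (intro exI[of _ \<xi>]) (auto simp: algebra_simps)
qed auto

section \<open>Slow variation of \<open>g'\<close> and \<open>g''\<close>, the phase, and its
  expansion\<close>

locale slowly_varying_inverse =
  fixes g g1 g2 g3 :: "real \<Rightarrow> real" and t0 :: real
  assumes deriv_g: "t > t0 \<Longrightarrow> (g has_real_derivative g1 t) (at t)"
    and g1_pos: "t > t0 \<Longrightarrow> g1 t > 0"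
    and deriv_g1: "t > t0 \<Longrightarrow> (g1 has_real_derivative g2 t) (at t)"
    and deriv_g2: "t > t0 \<Longrightarrow> (g2 has_real_derivative g3 t) (at t)"
    and g2_0: "(g2 \<longlongrightarrow> 0) at_top"
    and g1_shift: "h \<in> o(\<lambda>t. t) \<Longrightarrow> ((\<lambda>t. g1 t / g1 (t + h t)) \<longlongrightarrow> 1) at_top"
    and g2_log: "((\<lambda>t. g2 t / g1 t * ln (g1 t)) \<longlongrightarrow> 0) at_top"
    and g3_log: "n \<le> (2::nat) \<Longrightarrow> (\<lambda>t. g3 t * ln (g1 t) ^ n) \<in> O(g2)"
    and g2_Sup: "(\<lambda>t. SUP s\<in>{t..}. \<bar>g2 s\<bar>) \<in> O(g2)"
    and g2_shift: "h \<in> o(\<lambda>t. t) \<Longrightarrow> (\<lambda>t. g2 (t + h t)) \<in> O(g2)"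
begin

definition "lg t = ln (g1 t)"
definition "\<epsilon> t = g2 t / g1 t"

lemma deriv_lg: "t > t0 \<Longrightarrow> (lg has_real_derivative \<epsilon> t) (at t)"
  unfolding lg_def[abs_def] \<epsilon>_def
  by (rule DERIV_cong[OF DERIV_chain2[OF DERIV_ln[OF g1_pos] deriv_g1]]) (auto simp: field_simps)

lemma continuous_\<epsilon>: "continuous_on {t0<..} \<epsilon>"
proof -
  have "continuous_on {t0<..} g1" "continuous_on {t0<..} g2"
    using deriv_g1 deriv_g2 by (auto intro!: continuous_at_imp_continuous_on DERIV_isCont)
  thus ?thesis unfolding \<epsilon>_def[abs_def]
    using g1_pos by (intro continuous_on_divide) force+
qed

text \<open>Where \<open>\<bar>ln g'\<bar> \<ge> 1\<close>, (A4) bounds \<epsilon> directly.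
  Elsewhere \<open>g' \<ge> exp (-1)\<close>, and the decay of \<open>g''\<close> suffices.\<close>

lemma \<epsilon>_tendsto_0: "(\<epsilon> \<longlongrightarrow> 0) at_top"
proof (rule tendstoI)
  fix e :: real assume e: "e > 0"
  have "\<forall>\<^sub>F t in at_top. dist (g2 t) 0 < e * exp (-1)" using e by (intro tendstoD[OF g2_0]) auto
  moreover have "\<forall>\<^sub>F t in at_top. dist (g2 t / g1 t * ln (g1 t)) 0 < e" using e by (intro tendstoD[OF g2_log])
  ultimately show "\<forall>\<^sub>F t in at_top. dist (\<epsilon> t) 0 < e"
    using eventually_gt_at_top[of t0]
  proof eventually_elim
    case (elim t)
    have p: "g1 t > 0" using g1_pos elim(3) .
    show ?case
    proof (cases "\<bar>ln (g1 t)\<bar> \<ge> 1")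
      case True
      have "\<bar>\<epsilon> t\<bar> * 1 \<le> \<bar>\<epsilon> t\<bar> * \<bar>ln (g1 t)\<bar>" using True by (intro mult_left_mono) auto
      thus ?thesis using elim(2) by (simp add: \<epsilon>_def abs_mult)
    next
      case False
      hence "exp (-1) \<le> exp (ln (g1 t))" unfolding exp_le_cancel_iff by linarith
      hence "exp (-1) \<le> g1 t" using p by simp
      hence "e * exp (-1) \<le> e * g1 t" using e by (intro mult_left_mono) auto
      hence "\<bar>g2 t\<bar> < e * g1 t" using elim(1) by simp
      thus ?thesis using p by (simp add: \<epsilon>_def pos_divide_less_eq)
    qed
  qed
qed

text \<open>The derivative of \<open>lg^2\<close> is \<open>2 * \<epsilon> * lg\<close>, which tends
  to 0 by (A4). So \<open>lg^2 / t\<close> tends to 0 by l'Hospital, and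
  \<open>\<bar>lg\<bar> \<le> 1 + lg^2\<close>.\<close>

lemma lg_sublinear: "((\<lambda>t. lg t / t) \<longlongrightarrow> 0) at_top"
proof -
  have "((\<lambda>t. lg t ^ 2 / t) \<longlongrightarrow> 0) at_top"
  proof (rule lhospital_at_top_at_top[where f'="\<lambda>t. 2 * (\<epsilon> t * lg t)" and g'="\<lambda>_. 1"])
    show "\<forall>\<^sub>F t in at_top. ((\<lambda>t. lg t ^ 2) has_real_derivative 2 * (\<epsilon> t * lg t)) (at t)"
      using eventually_gt_at_top[of t0]
    proof eventually_elim
      case (elim t)
      show ?case using DERIV_power[OF deriv_lg[OF elim], of 2] by (simp add: mult_ac)
    qed
    have "((\<lambda>t. 2 * (\<epsilon> t * lg t)) \<longlongrightarrow> 2 * 0) at_top"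
      unfolding \<epsilon>_def lg_def by (intro tendsto_intros g2_log)
    thus "((\<lambda>t. 2 * (\<epsilon> t * lg t) / 1) \<longlongrightarrow> 0) at_top" by simp
  qed (auto intro: filterlim_ident)
  hence lim: "((\<lambda>t. 1 / t + lg t ^ 2 / t) \<longlongrightarrow> 0 + 0) at_top"
    by (intro tendsto_add) (simp add: tendsto_divide_0[OF tendsto_const] filterlim_at_top_imp_at_infinity filterlim_ident)
  show ?thesis
  proof (rule Lim_null_comparison[OF _ lim[simplified]])
    show "\<forall>\<^sub>F t in at_top. norm (lg t / t) \<le> 1 / t + (lg t)\<^sup>2 / t"
      using eventually_gt_at_top[of 0]
    proof eventually_elim
      case (elim t)
      have "\<bar>lg t\<bar> \<le> 1 + lg t ^ 2"
        using zero_le_power2[of "\<bar>lg t\<bar> - 1/2"] by (simp add: power2_eq_square algebra_simps)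
      thus ?case using elim by (simp add: divide_right_mono flip: add_divide_distrib)
    qed
  qed
qed

lemma g2_tail_bound:
  obtains C N where "C \<ge> 1" "N > t0" "\<And>z x. N \<le> z \<Longrightarrow> z \<le> x \<Longrightarrow> \<bar>g2 x\<bar> \<le> C * \<bar>g2 z\<bar>"
proof -
  obtain c where c: "c > 0" "\<forall>\<^sub>F t in at_top. norm (SUP s\<in>{t..}. \<bar>g2 s\<bar>) \<le> c * norm (g2 t)"
    using landau_o.bigE[OF g2_Sup] by blast
  moreover have "\<forall>\<^sub>F t in at_top. dist (g2 t) 0 < 1" by (intro tendstoD[OF g2_0]) auto
  ultimately have "\<forall>\<^sub>F t in at_top. norm (SUP s\<in>{t..}. \<bar>g2 s\<bar>) \<le> c * norm (g2 t) \<and> dist (g2 t) 0 < 1 \<and> t > t0"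
    by (intro eventually_conj eventually_gt_at_top) auto
  then obtain N where N: "\<And>t. t \<ge> N \<Longrightarrow> norm (SUP s\<in>{t..}. \<bar>g2 s\<bar>) \<le> c * norm (g2 t)"
    "\<And>t. t \<ge> N \<Longrightarrow> \<bar>g2 t\<bar> < 1" "\<And>t. t \<ge> N \<Longrightarrow> t > t0"
    by (auto simp: eventually_at_top_linorder)
  show ?thesis
  proof (rule that[of "max 1 c" N])
    fix z x assume zx: "N \<le> z" "z \<le> x"
    \<comment> \<open>A real \<open>SUP\<close> bounds its members only if the set is bounded above;
      this comes from \<open>g''\<close> tending to 0.\<close>
    have "bdd_above ((\<lambda>s. \<bar>g2 s\<bar>) ` {z..})"
      using N(2) zx by (intro bdd_aboveI2[where M=1]) (force intro: less_imp_le)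
    hence "\<bar>g2 x\<bar> \<le> (SUP s\<in>{z..}. \<bar>g2 s\<bar>)" using zx by (intro cSUP_upper) auto
    also have "\<dots> \<le> norm (SUP s\<in>{z..}. \<bar>g2 s\<bar>)" by simp
    also have "\<dots> \<le> c * \<bar>g2 z\<bar>" using N(1)[OF zx(1)] by simp
    also have "\<dots> \<le> max 1 c * \<bar>g2 z\<bar>" by (intro mult_right_mono) auto
    finally show "\<bar>g2 x\<bar> \<le> max 1 c * \<bar>g2 z\<bar>" .
  qed (use N(3) in auto)
qed

text \<open>The factor \<open>g''\<close> is controlled by its value at \<open>z\<close>. The factor
  \<open>1/g'\<close> grows at most at rate \<delta>, because the logarithmic derivative of
  \<open>g'\<close> is \<epsilon> \<ge> -\<delta>.\<close>

lemma \<epsilon>_exponential_bound: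
  assumes \<delta>: "\<delta> > 0" and N: "N > t0" and C: "C \<ge> 0"
    and g2: "\<And>z x. N \<le> z \<Longrightarrow> z \<le> x \<Longrightarrow> \<bar>g2 x\<bar> \<le> C * \<bar>g2 z\<bar>"
    and \<epsilon>: "\<And>t. t \<ge> N \<Longrightarrow> \<bar>\<epsilon> t\<bar> \<le> \<delta>" and zx: "N \<le> z" "z \<le> x"
  shows "\<bar>\<epsilon> x\<bar> \<le> C * \<bar>\<epsilon> z\<bar> * exp (\<delta> * (x - z))"
proof -
  have p: "g1 x > 0" "g1 z > 0" using g1_pos N zx by auto
  have "lg z + \<delta> * z \<le> lg x + \<delta> * x"
  proof (rule DERIV_nonneg_imp_nondecreasing[where f="\<lambda>x. lg x + \<delta> * x", OF zx(2)])
    fix y assume "z \<le> y" "y \<le> x"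
    hence "((\<lambda>x. lg x + \<delta> * x) has_real_derivative \<epsilon> y + \<delta>) (at y)"
      using N zx by (auto intro!: derivative_eq_intros deriv_lg)
    moreover have "\<epsilon> y + \<delta> \<ge> 0" using \<epsilon>[of y] zx \<open>z \<le> y\<close> by (auto simp: abs_le_iff)
    ultimately show "\<exists>d. ((\<lambda>x. lg x + \<delta> * x) has_real_derivative d) (at y) \<and> 0 \<le> d" by blast
  qed
  hence "exp (lg z) \<le> exp (lg x + \<delta> * (x - z))" unfolding exp_le_cancel_iff by (simp add: algebra_simps)
  hence "g1 z \<le> g1 x * exp (\<delta> * (x - z))" using p by (simp add: lg_def exp_add)
  hence "inverse (g1 x) \<le> inverse (g1 z) * exp (\<delta> * (x - z))"
    using p by (simp add: field_simps)
  hence "\<bar>g2 x\<bar> * inverse (g1 x) \<le> (C * \<bar>g2 z\<bar>) * (inverse (g1 z) * exp (\<delta> * (x - z)))"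
    using g2[OF zx] p C by (intro mult_mono) auto
  thus ?thesis using p by (simp add: \<epsilon>_def divide_inverse abs_mult mult_ac)
qed

text \<open>The order of choices matters: \<open>C\<close> comes from \<open>g''\<close> alone, then
  \<delta>, \<open>\<epsilon>0\<close> and \<open>B\<close> from the perturbed system, and only then
  the threshold \<open>Z\<close> beyond which \<epsilon> is small enough.\<close>

lemma singular_phase_solution:
  assumes \<kappa>: "\<kappa> > 0" and p: "p > 0"
  obtains Z B s n where "Z > t0" "B \<ge> 0"
    "\<And>z. \<bar>s z\<bar> \<le> B" "\<And>z. \<bar>n z\<bar> \<le> 1"
    "\<And>z. z \<ge> Z \<Longrightarrow> \<bar>s z\<bar> \<le> B * \<bar>\<epsilon> z\<bar>"
    "\<And>z. z \<ge> Z \<Longrightarrow> (s has_real_derivative 1 - exp (- n z) - p * \<epsilon> z) (at z)"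
    "\<And>z. z \<ge> Z \<Longrightarrow> (n has_real_derivative \<kappa> / p * (exp (- n z) - exp (s z - (p + 1) * n z)) - \<epsilon> z) (at z)"
proof -
  obtain C N where CN: "C \<ge> 1" "N > t0" "\<And>z x. N \<le> z \<Longrightarrow> z \<le> x \<Longrightarrow> \<bar>g2 x\<bar> \<le> C * \<bar>g2 z\<bar>"
    using g2_tail_bound by metis
  show ?thesis
  proof (rule perturbed_system_solution[OF \<kappa> p CN(1)], goal_cases)
    case (1 \<delta> \<epsilon>0 B)
    \<comment> \<open>Three demands: at most \<delta> for the exponential bound, at most
      \<open>\<epsilon>0\<close> for the perturbed system, and
      \<open>B * \<epsilon>1 \<le> 1\<close>, which gives
      \<open>\<bar>n\<bar> \<le> 1\<close>.\<close>
    define \<epsilon>1 where "\<epsilon>1 = min (min \<delta> \<epsilon>0) (1 / (B + 1))"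
    have \<epsilon>1: "\<epsilon>1 > 0" using 1(1-3) by (auto simp: \<epsilon>1_def)
    have B\<epsilon>1: "B * \<epsilon>1 \<le> 1"
    proof -
      have "B * \<epsilon>1 \<le> B * (1 / (B + 1))" using 1(3) by (intro mult_left_mono) (auto simp: \<epsilon>1_def)
      also have "\<dots> \<le> 1" using 1(3) by (simp add: field_simps)
      finally show ?thesis .
    qed
    have "\<forall>\<^sub>F t in at_top. dist (\<epsilon> t) 0 < \<epsilon>1" by (intro tendstoD[OF \<epsilon>_tendsto_0] \<epsilon>1)
    hence "\<forall>\<^sub>F t in at_top. \<bar>\<epsilon> t\<bar> < \<epsilon>1 \<and> t \<ge> N" by (auto intro: eventually_conj eventually_ge_at_top)
    then obtain Z where Z: "\<And>t. t \<ge> Z \<Longrightarrow> \<bar>\<epsilon> t\<bar> < \<epsilon>1" "Z \<ge> N"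
      by (auto simp: eventually_at_top_linorder)
    \<comment> \<open>\<open>\<epsilon>\<close> is frozen to the left of \<open>Z\<close> so that the fixed point lives on the whole line.\<close>
    define e where "e z = \<epsilon> (max Z z)" for z
    have Zt: "Z > t0" using Z CN by simp
    have ec: "continuous_on UNIV e"
      unfolding e_def by (rule continuous_on_compose2[OF continuous_\<epsilon>]) (use Zt in \<open>auto intro!: continuous_intros\<close>)
    have e1: "\<bar>e x\<bar> \<le> \<epsilon>1" for x using Z(1)[of "max Z x"] by (simp add: e_def)
    have eb: "\<bar>e x\<bar> \<le> \<epsilon>0" for x using e1[of x] by (simp add: \<epsilon>1_def)
    have eg: "\<bar>e x\<bar> \<le> C * \<bar>e z\<bar> * exp (\<delta> * (x - z))" if "z \<le> x" for z x
    proof -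
      have "\<bar>e x\<bar> \<le> C * \<bar>e z\<bar> * exp (\<delta> * (max Z x - max Z z))"
        unfolding e_def
      proof (rule \<epsilon>_exponential_bound[of \<delta> Z C])
        show "\<bar>\<epsilon> t\<bar> \<le> \<delta>" if "t \<ge> Z" for t using Z(1)[OF that] by (simp add: \<epsilon>1_def)
      qed (use 1 CN Zt Z that in auto)
      \<comment> \<open>Moving both points to the right of \<open>Z\<close> can only shorten the
        distance between them.\<close>
      also have "\<dots> \<le> C * \<bar>e z\<bar> * exp (\<delta> * (x - z))"
        using 1 CN that by (intro mult_left_mono) auto
      finally show ?thesis .
    qed
    obtain s n where sn: "\<forall>z. \<bar>s z\<bar> \<le> B * \<bar>e z\<bar> \<and> \<bar>n z\<bar> \<le> B * \<bar>e z\<bar> \<and>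
        (s has_real_derivative 1 - exp (- n z) - p * e z) (at z) \<and>
        (n has_real_derivative \<kappa> / p * (exp (- n z) - exp (s z - (p + 1) * n z)) - e z) (at z)"
      using 1(4)[OF ec eb eg] by blast
    have Be: "B * \<bar>e z\<bar> \<le> B * \<epsilon>1" for z using e1[of z] 1(3) by (intro mult_left_mono) auto
    show ?thesis
    proof (rule that[of Z "max 1 B" s n])
      fix z
      show "\<bar>s z\<bar> \<le> max 1 B" "\<bar>n z\<bar> \<le> 1" using sn Be[of z] B\<epsilon>1 by (smt (verit))+
      assume z: "z \<ge> Z"
      hence ez: "e z = \<epsilon> z" by (simp add: e_def max_def)
      show "(s has_real_derivative 1 - exp (- n z) - p * \<epsilon> z) (at z)"
        "(n has_real_derivative \<kappa> / p * (exp (- n z) - exp (s z - (p + 1) * n z)) - \<epsilon> z) (at z)"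
        using sn unfolding ez[symmetric] by blast+
      have "\<bar>s z\<bar> \<le> B * \<bar>\<epsilon> z\<bar>" using sn ez by metis
      also have "\<dots> \<le> max 1 B * \<bar>\<epsilon> z\<bar>" by (intro mult_right_mono) auto
      finally show "\<bar>s z\<bar> \<le> max 1 B * \<bar>\<epsilon> z\<bar>" .
    qed (use Zt in auto)
  qed
qed

text \<open>One sublinear majorant \<open>H\<close> serves all displaced arguments, including
  intermediate points of the mean value theorem. (A5)(b) compares \<open>g''\<close> at the two
  arguments; by (A3) the ratio of the values of \<open>g'\<close> tends to 1, so it ends up between
  1/2 and 2.\<close>

lemma controlled_shift:
  assumes H: "H \<in> o(\<lambda>t. t)" and \<xi>: "\<forall>\<^sub>F t in at_top. \<bar>\<xi> t - t\<bar> \<le> H t"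
  shows "filterlim \<xi> at_top at_top"
    and "\<exists>C\<ge>0. \<forall>\<^sub>F t in at_top. \<bar>g2 (\<xi> t)\<bar> \<le> C * \<bar>g2 t\<bar>"
    and "\<forall>\<^sub>F t in at_top. \<bar>lg (\<xi> t) - lg t\<bar> \<le> 1 \<and> g1 t \<le> 2 * g1 (\<xi> t) \<and> g1 (\<xi> t) \<le> 2 * g1 t"
proof -
  have h: "(\<lambda>t. \<xi> t - t) \<in> o(\<lambda>t. t)"
  proof (rule landau_o.big_small_trans[OF _ H])
    show "(\<lambda>t. \<xi> t - t) \<in> O(H)"
      using \<xi> by (intro bigoI[where c=1]) (auto elim: eventually_mono)
  qed
  have lim: "filterlim \<xi> at_top at_top"
  proof (rule filterlim_at_top_mono[where f="\<lambda>t. 1/2 * t"])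
    show "filterlim (\<lambda>t::real. 1/2 * t) at_top at_top"
      by (rule filterlim_tendsto_pos_mult_at_top[OF tendsto_const _ filterlim_ident]) simp
    have "\<forall>\<^sub>F t in at_top. norm (\<xi> t - t) \<le> 1/2 * norm t"
      by (rule landau_o.smallD[OF h]) simp
    thus "\<forall>\<^sub>F t in at_top. 1/2 * t \<le> \<xi> t"
      using eventually_gt_at_top[of 0]
    proof eventually_elim
      case (elim t)
      thus ?case using abs_ge_minus_self[of "\<xi> t - t"] by simp
    qed
  qed
  show "filterlim \<xi> at_top at_top" by (rule lim)
  have "(\<lambda>t. g2 (\<xi> t)) \<in> O(g2)" using g2_shift[OF h] by simp
  then obtain C where "C > 0" "\<forall>\<^sub>F t in at_top. norm (g2 (\<xi> t)) \<le> C * norm (g2 t)"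
    by (rule landau_o.bigE) auto
  thus "\<exists>C\<ge>0. \<forall>\<^sub>F t in at_top. \<bar>g2 (\<xi> t)\<bar> \<le> C * \<bar>g2 t\<bar>"
    by (intro exI[of _ C]) auto
  have r: "((\<lambda>t. g1 t / g1 (\<xi> t)) \<longlongrightarrow> 1) at_top" using g1_shift[OF h] by simp
  have "\<forall>\<^sub>F t in at_top. g1 t / g1 (\<xi> t) > 1/2" "\<forall>\<^sub>F t in at_top. g1 t / g1 (\<xi> t) < 2"
    by (rule order_tendstoD[OF r]; simp)+
  moreover have "\<forall>\<^sub>F t in at_top. \<xi> t > t0" using lim by (simp add: filterlim_at_top_dense)
  ultimately show "\<forall>\<^sub>F t in at_top. \<bar>lg (\<xi> t) - lg t\<bar> \<le> 1 \<and> g1 t \<le> 2 * g1 (\<xi> t) \<and> g1 (\<xi> t) \<le> 2 * g1 t"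
    using eventually_gt_at_top[of t0]
  proof eventually_elim
    case (elim t)
    have p: "g1 t > 0" "g1 (\<xi> t) > 0" using g1_pos elim by auto
    have a: "g1 t < 2 * g1 (\<xi> t)" "g1 (\<xi> t) < 2 * g1 t"
      using elim(1,2) p by (simp_all add: field_simps)
    have "ln (g1 t) \<le> ln (2 * g1 (\<xi> t))" "ln (g1 (\<xi> t)) \<le> ln (2 * g1 t)"
      using a p by simp_all
    moreover have "ln (2::real) \<le> 1" using ln_2_less_1 by simp
    ultimately show ?case using a p by (simp add: lg_def ln_mult abs_le_iff)
  qed
qed

text \<open>Write \<tau> for \<open>t + c\<close>. Since \<zeta> - \<tau> is
  \<open>p * lg \<tau>\<close> up to a bounded term, expanding \<open>g'(\<zeta>)\<close> to first
  order at \<tau> gives the argument of the outer logarithm up to \<open>O(g'')\<close>; the cases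
  \<open>n = 0, 2\<close> of (A5)(a) absorb the quadratic remainder. Taking logarithms divides this
  error by \<open>g'\<close>, and the mean value theorem for \<open>g\<close> multiplies it by
  \<open>g'\<close> again.\<close>

lemma singular_expansion:
  assumes \<zeta>: "filterlim \<zeta> at_top at_top" and p: "p > 0"
    and eq: "\<forall>\<^sub>F t in at_top. \<zeta> t - p * lg (\<zeta> t) - s (\<zeta> t) = t"
    and sB: "\<And>z. \<bar>s z\<bar> \<le> B" "\<forall>\<^sub>F z in at_top. \<bar>s z\<bar> \<le> B * \<bar>\<epsilon> z\<bar>"
  shows "(\<lambda>t. g (\<zeta> t) - g (t + p * ln (g1 (t + c) + p * g2 (t + c) * ln (g1 (t + c))))) \<in> O(g2)"
proof -
  have B: "B \<ge> 0" using sB(1)[of 0] by linarith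
  have inv0: "((\<lambda>t::real. a / t) \<longlongrightarrow> 0) at_top" for a
    by (simp add: tendsto_divide_0[OF tendsto_const] filterlim_at_top_imp_at_infinity filterlim_ident)
  \<comment> \<open>Dividing the defining equation by \<zeta> shows that \<open>t / \<zeta>\<close>
    tends to 1, as \<open>lg\<close> is sublinear and \<open>s\<close> bounded.\<close>
  have h: "(\<lambda>t. \<zeta> t - t) \<in> o(\<lambda>t. t)"
  proof -
    have s0: "((\<lambda>z. s z / z) \<longlongrightarrow> 0) at_top"
    proof (rule Lim_null_comparison[OF _ inv0[of B]])
      show "\<forall>\<^sub>F z in at_top. norm (s z / z) \<le> B / z"
        using eventually_gt_at_top[of 0] by eventually_elim (auto intro: divide_right_mono sB)
    qed
    have "((\<lambda>z. 1 - (p * (lg z / z) + s z / z)) \<longlongrightarrow> 1 - (p * 0 + 0)) at_top"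
      by (intro tendsto_intros lg_sublinear s0)
    from filterlim_compose[OF this \<zeta>]
    have "((\<lambda>t. 1 - (p * (lg (\<zeta> t) / \<zeta> t) + s (\<zeta> t) / \<zeta> t)) \<longlongrightarrow> 1) at_top" by simp
    moreover have "\<forall>\<^sub>F t in at_top. 1 - (p * (lg (\<zeta> t) / \<zeta> t) + s (\<zeta> t) / \<zeta> t) = t / \<zeta> t"
    proof -
      have "\<forall>\<^sub>F t in at_top. \<zeta> t > 0" using \<zeta> by (simp add: filterlim_at_top_dense)
      thus ?thesis using eq
      proof eventually_elim
        case (elim t)
        have "(1 - (p * (lg (\<zeta> t) / \<zeta> t) + s (\<zeta> t) / \<zeta> t)) * \<zeta> t = t"
          using elim by (simp add: algebra_simps)
        thus ?case using elim(1) by (simp add: nonzero_eq_divide_eq)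
      qed
    qed
    ultimately have "((\<lambda>t. t / \<zeta> t) \<longlongrightarrow> 1) at_top" by (rule Lim_transform_eventually)
    hence "((\<lambda>t. inverse (t / \<zeta> t) - 1) \<longlongrightarrow> inverse 1 - 1) at_top"
      by (intro tendsto_intros) auto
    moreover have "\<forall>\<^sub>F t in at_top. inverse (t / \<zeta> t) - 1 = (\<zeta> t - t) / t"
      using eventually_gt_at_top[of 0] by eventually_elim (simp add: field_simps)
    ultimately have "((\<lambda>t. (\<zeta> t - t) / t) \<longlongrightarrow> inverse 1 - 1) at_top" by (rule Lim_transform_eventually)
    thus ?thesis by (intro smalloI_tendsto) (auto intro: eventually_gt_at_top eventually_mono[OF eventually_gt_at_top[of 0]])
  qed
  \<comment> \<open>\<open>2 * \<bar>c\<bar>\<close> covers a point between \<open>t + c\<close> and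
    \<zeta>; the extra 1 covers a point between \<zeta> and the approximate phase, which is
    eventually within distance 1.\<close>
  define H where "H t = \<bar>\<zeta> t - t\<bar> + 2 * \<bar>c\<bar> + 1" for t
  have Ho: "H \<in> o(\<lambda>t. t)"
  proof -
    have "(\<lambda>t. \<bar>\<zeta> t - t\<bar>) \<in> o(\<lambda>t. t)" using h by simp
    moreover have "(\<lambda>t::real. 2 * \<bar>c\<bar> + 1) \<in> o(\<lambda>t. t)"
      by (rule smalloI_tendsto[OF inv0]) (auto intro: eventually_mono[OF eventually_gt_at_top[of 0]])
    ultimately have "(\<lambda>t. \<bar>\<zeta> t - t\<bar> + (2 * \<bar>c\<bar> + 1)) \<in> o(\<lambda>t. t)" by (rule sum_in_smallo)
    thus ?thesis by (simp add: H_def[abs_def] add.assoc)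
  qed
  note shift = controlled_shift[OF Ho]
  let ?\<tau> = "\<lambda>t. t + c"
  define Dn where "Dn t = g1 (?\<tau> t) + p * g2 (?\<tau> t) * ln (g1 (?\<tau> t))" for t
  have sh\<zeta>: "\<forall>\<^sub>F t in at_top. \<bar>\<zeta> t - t\<bar> \<le> H t" by (simp add: H_def)
  have sh\<tau>: "\<forall>\<^sub>F t in at_top. \<bar>?\<tau> t - t\<bar> \<le> H t" by (simp add: H_def)
  \<comment> \<open>The margin 1 keeps the approximate phase to the right of \<open>t0\<close> as
    well.\<close>
  have gt\<zeta>: "\<forall>\<^sub>F t in at_top. \<zeta> t > t0 + 1" using \<zeta> by (simp add: filterlim_at_top_dense)
  have gt\<tau>: "\<forall>\<^sub>F t in at_top. ?\<tau> t > t0" using shift(1)[OF sh\<tau>] by (simp add: filterlim_at_top_dense)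

  \<comment> \<open>The intermediate points are collected into a function of \<open>t\<close>, so
    that asymptotic statements can be composed with it. The remainder is obtained from two mean
    value theorems, for \<open>g'\<close> and then for \<open>g''\<close>.\<close>
  have "\<exists>\<xi>. \<forall>t. \<zeta> t > t0 + 1 \<and> ?\<tau> t > t0 \<longrightarrow> \<bar>\<xi> t - t\<bar> \<le> H t \<and>
      \<bar>g1 (\<zeta> t) - g1 (?\<tau> t) - g2 (?\<tau> t) * (\<zeta> t - ?\<tau> t)\<bar> \<le> \<bar>g3 (\<xi> t)\<bar> * (\<zeta> t - ?\<tau> t)\<^sup>2"
  proof (intro choice allI)
    fix t
    show "\<exists>\<xi>. \<zeta> t > t0 + 1 \<and> ?\<tau> t > t0 \<longrightarrow> \<bar>\<xi> - t\<bar> \<le> H t \<and>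
      \<bar>g1 (\<zeta> t) - g1 (?\<tau> t) - g2 (?\<tau> t) * (\<zeta> t - ?\<tau> t)\<bar> \<le> \<bar>g3 \<xi>\<bar> * (\<zeta> t - ?\<tau> t)\<^sup>2"
    proof (cases "\<zeta> t > t0 + 1 \<and> ?\<tau> t > t0")
      case True
      obtain \<eta> where \<eta>: "\<bar>\<eta> - ?\<tau> t\<bar> \<le> \<bar>\<zeta> t - ?\<tau> t\<bar>" "\<bar>\<eta> - \<zeta> t\<bar> \<le> \<bar>\<zeta> t - ?\<tau> t\<bar>"
        "g1 (\<zeta> t) - g1 (?\<tau> t) = g2 \<eta> * (\<zeta> t - ?\<tau> t)"
        using mvt_between[where a=t0, OF deriv_g1, of "?\<tau> t" "\<zeta> t"] True by auto
      have \<eta>t: "\<eta> > t0" using \<eta>(1,2) True by argo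
      obtain \<xi> where \<xi>: "\<bar>\<xi> - ?\<tau> t\<bar> \<le> \<bar>\<eta> - ?\<tau> t\<bar>" "g2 \<eta> - g2 (?\<tau> t) = g3 \<xi> * (\<eta> - ?\<tau> t)"
        using mvt_between[where a=t0, OF deriv_g2, of "?\<tau> t" \<eta>] True \<eta>t by auto
      have "g1 (\<zeta> t) - g1 (?\<tau> t) - g2 (?\<tau> t) * (\<zeta> t - ?\<tau> t) = g3 \<xi> * ((\<eta> - ?\<tau> t) * (\<zeta> t - ?\<tau> t))"
        unfolding \<eta>(3) using \<xi>(2) by (simp flip: left_diff_distrib mult.assoc)
      moreover have "\<bar>(\<eta> - ?\<tau> t) * (\<zeta> t - ?\<tau> t)\<bar> \<le> (\<zeta> t - ?\<tau> t)\<^sup>2"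
        using mult_right_mono[OF \<eta>(1), of "\<bar>\<zeta> t - ?\<tau> t\<bar>"] by (simp add: abs_mult power2_eq_square)
      ultimately have "\<bar>g1 (\<zeta> t) - g1 (?\<tau> t) - g2 (?\<tau> t) * (\<zeta> t - ?\<tau> t)\<bar> \<le> \<bar>g3 \<xi>\<bar> * (\<zeta> t - ?\<tau> t)\<^sup>2"
        by (simp only: abs_mult[of "g3 \<xi>"]) (intro mult_left_mono; simp)
      moreover have "\<bar>\<xi> - t\<bar> \<le> H t" using \<xi>(1) \<eta>(1) unfolding H_def by argo
      ultimately show ?thesis by blast
    qed auto
  qed
  then obtain \<xi> where \<xi>: "\<And>t. \<zeta> t > t0 + 1 \<Longrightarrow> ?\<tau> t > t0 \<Longrightarrow> \<bar>\<xi> t - t\<bar> \<le> H t"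
    "\<And>t. \<zeta> t > t0 + 1 \<Longrightarrow> ?\<tau> t > t0 \<Longrightarrow> 
      \<bar>g1 (\<zeta> t) - g1 (?\<tau> t) - g2 (?\<tau> t) * (\<zeta> t - ?\<tau> t)\<bar> \<le> \<bar>g3 (\<xi> t)\<bar> * (\<zeta> t - ?\<tau> t)\<^sup>2"
    by blast
  have sh\<xi>: "\<forall>\<^sub>F t in at_top. \<bar>\<xi> t - t\<bar> \<le> H t"
    using gt\<zeta> gt\<tau> by eventually_elim (rule \<xi>(1))
  obtain C\<zeta> C\<tau> C\<xi> where C: "C\<zeta> \<ge> 0" "C\<tau> \<ge> 0" "C\<xi> \<ge> 0"
    and C\<zeta>: "\<forall>\<^sub>F t in at_top. \<bar>g2 (\<zeta> t)\<bar> \<le> C\<zeta> * \<bar>g2 t\<bar>"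
    and C\<tau>: "\<forall>\<^sub>F t in at_top. \<bar>g2 (?\<tau> t)\<bar> \<le> C\<tau> * \<bar>g2 t\<bar>"
    and C\<xi>: "\<forall>\<^sub>F t in at_top. \<bar>g2 (\<xi> t)\<bar> \<le> C\<xi> * \<bar>g2 t\<bar>"
    using shift(2)[OF sh\<zeta>] shift(2)[OF sh\<tau>] shift(2)[OF sh\<xi>] by blast
  obtain c0 where c0p: "c0 > 0" and c0: "\<forall>\<^sub>F t in at_top. norm (g3 t * ln (g1 t) ^ 0) \<le> c0 * norm (g2 t)"
    by (rule landau_o.bigE[OF g3_log[of 0]]) auto
  obtain c2 where c2p: "c2 > 0" and c2: "\<forall>\<^sub>F t in at_top. norm (g3 t * ln (g1 t) ^ 2) \<le> c2 * norm (g2 t)"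
    by (rule landau_o.bigE[OF g3_log[of 2]]) auto
  \<comment> \<open>\<open>2 * p\<close> pays for replacing the logarithm at one argument by that at
    another, \<open>B\<close> for \<open>s\<close>, and \<open>\<bar>c\<bar>\<close> for the
    shift.\<close>
  define K1 where "K1 = 2 * p + B + \<bar>c\<bar>"
  have K1: "K1 > 0" using p B by (simp add: K1_def add_pos_nonneg)
  define K2 where "K2 = 2 * p\<^sup>2 * c2 + 2 * K1\<^sup>2 * c0"
  have K2: "K2 \<ge> 0" using c0p c2p by (simp add: K2_def)
  define K3 where "K3 = K1 * C\<tau> + K2 * C\<xi>"
  have K3: "K3 \<ge> 0" using K1 K2 C by (simp add: K3_def)
  define K4 where "K4 = p * (4 * K3) + 2 * B * C\<zeta>"
  have K4: "K4 \<ge> 0" using K3 p B C by (simp add: K4_def)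
  have num: "\<forall>\<^sub>F t in at_top. \<bar>g1 (\<zeta> t) - Dn t\<bar> \<le> K3 * \<bar>g2 t\<bar>"
    using shift(3)[OF sh\<zeta>] shift(3)[OF sh\<tau>] shift(3)[OF sh\<xi>] C\<tau> C\<xi>
      eventually_compose_filterlim[OF c0 shift(1)[OF sh\<xi>]] eventually_compose_filterlim[OF c2 shift(1)[OF sh\<xi>]]
      gt\<zeta> gt\<tau> eq
  proof eventually_elim
    case (elim t)
    let ?w = "\<zeta> t - ?\<tau> t"
    have w: "?w = p * lg (\<zeta> t) + s (\<zeta> t) - c" using elim(10) by simp
    have l1: "\<bar>lg (\<zeta> t) - lg (?\<tau> t)\<bar> \<le> 2" "\<bar>lg (\<zeta> t)\<bar> \<le> \<bar>lg (\<xi> t)\<bar> + 2" using elim(1-3) by argo+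
    have a1: "\<bar>?w - p * lg (?\<tau> t)\<bar> \<le> K1"
    proof -
      have "?w - p * lg (?\<tau> t) = p * (lg (\<zeta> t) - lg (?\<tau> t)) + s (\<zeta> t) - c" unfolding w by (simp add: algebra_simps)
      also have "\<bar>\<dots>\<bar> \<le> \<bar>p * (lg (\<zeta> t) - lg (?\<tau> t))\<bar> + \<bar>s (\<zeta> t)\<bar> + \<bar>c\<bar>" by linarith
      also have "\<dots> \<le> p * 2 + B + \<bar>c\<bar>"
        using p l1(1) sB(1)[of "\<zeta> t"] by (intro add_mono) (auto simp: abs_mult)
      finally show ?thesis by (simp add: K1_def)
    qed
    \<comment> \<open>The logarithm is moved to \<xi> because the hypothesis on \<open>g3\<close>
      pairs it with the logarithm at the same argument.\<close>
    have a2: "?w\<^sup>2 \<le> 2 * p\<^sup>2 * (lg (\<xi> t))\<^sup>2 + 2 * K1\<^sup>2"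
    proof -
      have "\<bar>?w\<bar> \<le> \<bar>p * lg (\<zeta> t)\<bar> + \<bar>s (\<zeta> t)\<bar> + \<bar>c\<bar>" unfolding w by linarith
      also have "\<dots> \<le> p * (\<bar>lg (\<xi> t)\<bar> + 2) + B + \<bar>c\<bar>"
        using p l1(2) sB(1)[of "\<zeta> t"] by (intro add_mono) (auto simp: abs_mult)
      also have "\<dots> = p * \<bar>lg (\<xi> t)\<bar> + K1" by (simp add: K1_def algebra_simps)
      finally have "\<bar>?w\<bar>\<^sup>2 \<le> (p * \<bar>lg (\<xi> t)\<bar> + K1)\<^sup>2" by (intro power_mono) auto
      also have "\<dots> \<le> 2 * (p * \<bar>lg (\<xi> t)\<bar>)\<^sup>2 + 2 * K1\<^sup>2"
        using zero_le_power2[of "p * \<bar>lg (\<xi> t)\<bar> - K1"] by (simp add: power2_sum power2_diff)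
      finally show ?thesis by (simp add: power_mult_distrib)
    qed
    have "\<bar>g3 (\<xi> t)\<bar> * ?w\<^sup>2 \<le> \<bar>g3 (\<xi> t)\<bar> * (2 * p\<^sup>2 * (lg (\<xi> t))\<^sup>2 + 2 * K1\<^sup>2)"
      by (intro mult_left_mono a2) auto
    also have "\<dots> = 2 * p\<^sup>2 * \<bar>g3 (\<xi> t) * (lg (\<xi> t))\<^sup>2\<bar> + 2 * K1\<^sup>2 * \<bar>g3 (\<xi> t)\<bar>"
      by (simp add: algebra_simps abs_mult)
    also have "\<dots> \<le> 2 * p\<^sup>2 * (c2 * \<bar>g2 (\<xi> t)\<bar>) + 2 * K1\<^sup>2 * (c0 * \<bar>g2 (\<xi> t)\<bar>)"
      using elim(6,7) by (intro add_mono mult_left_mono) (auto simp: lg_def)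
    also have "\<dots> = K2 * \<bar>g2 (\<xi> t)\<bar>" by (simp add: K2_def algebra_simps)
    also have "\<dots> \<le> K2 * (C\<xi> * \<bar>g2 t\<bar>)" using elim(5) K2 by (intro mult_left_mono)
    finally have a3: "\<bar>g3 (\<xi> t)\<bar> * ?w\<^sup>2 \<le> K2 * C\<xi> * \<bar>g2 t\<bar>" by (simp add: mult.assoc)
    have a4: "\<bar>g2 (?\<tau> t) * (?w - p * lg (?\<tau> t))\<bar> \<le> K1 * C\<tau> * \<bar>g2 t\<bar>"
      using mult_mono[OF elim(4) a1] C by (simp add: abs_mult mult_ac)
    have "g1 (\<zeta> t) - Dn t = (g1 (\<zeta> t) - g1 (?\<tau> t) - g2 (?\<tau> t) * ?w) + g2 (?\<tau> t) * (?w - p * lg (?\<tau> t))"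
      by (simp add: Dn_def lg_def algebra_simps)
    hence "\<bar>g1 (\<zeta> t) - Dn t\<bar> \<le> K2 * C\<xi> * \<bar>g2 t\<bar> + K1 * C\<tau> * \<bar>g2 t\<bar>"
      using a3 a4 \<xi>(2)[OF elim(8,9)] by linarith
    thus ?case by (simp add: K3_def algebra_simps)
  qed
  \<comment> \<open>By (A4) the correction is eventually greater than minus half of
    \<open>g'(\<tau>)\<close>, so \<open>Dn\<close> stays above a quarter of \<open>g'(t)\<close>
    and its logarithm is harmless.\<close>
  have "((\<lambda>t. p * (g2 t / g1 t * ln (g1 t))) \<longlongrightarrow> p * 0) at_top" by (intro tendsto_intros g2_log)
  from filterlim_compose[OF this shift(1)[OF sh\<tau>]]
  have "((\<lambda>t. p * (g2 (?\<tau> t) / g1 (?\<tau> t) * ln (g1 (?\<tau> t)))) \<longlongrightarrow> 0) at_top" by simp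
  hence "\<forall>\<^sub>F t in at_top. p * (g2 (?\<tau> t) / g1 (?\<tau> t) * ln (g1 (?\<tau> t))) > -1/2"
    by (rule order_tendstoD) simp
  hence Dn: "\<forall>\<^sub>F t in at_top. Dn t \<ge> g1 t / 4"
    using shift(3)[OF sh\<tau>] gt\<tau>
  proof eventually_elim
    case (elim t)
    have q: "g1 (?\<tau> t) > 0" using g1_pos elim by auto
    have "g1 (?\<tau> t) * (-1/2) < g1 (?\<tau> t) * (p * (g2 (?\<tau> t) / g1 (?\<tau> t) * ln (g1 (?\<tau> t))))"
      using elim(1) q by (rule mult_strict_left_mono)
    also have "\<dots> = p * g2 (?\<tau> t) * ln (g1 (?\<tau> t))" using q by simp
    finally show ?case using elim(2) unfolding Dn_def by linarith
  qed
  let ?Z = "\<lambda>t. t + p * ln (Dn t)"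
  have close: "\<forall>\<^sub>F t in at_top. \<bar>\<zeta> t - ?Z t\<bar> \<le> K4 * (\<bar>g2 t\<bar> / g1 t)"
    using num Dn shift(3)[OF sh\<zeta>] C\<zeta> eventually_gt_at_top[of t0] gt\<zeta> eq eventually_compose_filterlim[OF sB(2) \<zeta>]
  proof eventually_elim
    case (elim t)
    have q: "g1 t > 0" "g1 (\<zeta> t) > 0" using g1_pos elim by auto
    have qz: "g1 (\<zeta> t) \<ge> g1 t / 4" using elim(3) q by linarith
    have qD: "Dn t > 0" using elim(2) q by linarith
    have bnd: "\<bar>g1 (\<zeta> t) - Dn t\<bar> / x \<le> 4 * K3 * (\<bar>g2 t\<bar> / g1 t)" if "x \<ge> g1 t / 4" for x
    proof -
      have "\<bar>g1 (\<zeta> t) - Dn t\<bar> / x \<le> (K3 * \<bar>g2 t\<bar>) / (g1 t / 4)"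
        using elim(1) that q K3 by (intro frac_le) auto
      thus ?thesis by (simp add: mult_ac)
    qed
    \<comment> \<open>The one-sided bound \<open>ln x - ln y \<le> (x - y) / y\<close> is applied in
      both orders, since each of the two numbers is at least \<open>g1 t / 4\<close>.\<close>
    have "ln (g1 (\<zeta> t)) - ln (Dn t) \<le> (g1 (\<zeta> t) - Dn t) / Dn t" using q qD by (intro ln_diff_le)
    also have "\<dots> \<le> \<bar>g1 (\<zeta> t) - Dn t\<bar> / Dn t" using qD by (intro divide_right_mono) auto
    also have "\<dots> \<le> 4 * K3 * (\<bar>g2 t\<bar> / g1 t)" by (rule bnd[OF elim(2)])
    finally have u: "lg (\<zeta> t) - ln (Dn t) \<le> 4 * K3 * (\<bar>g2 t\<bar> / g1 t)" by (simp add: lg_def)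
    have "ln (Dn t) - ln (g1 (\<zeta> t)) \<le> (Dn t - g1 (\<zeta> t)) / g1 (\<zeta> t)" using q qD by (intro ln_diff_le)
    also have "\<dots> \<le> \<bar>g1 (\<zeta> t) - Dn t\<bar> / g1 (\<zeta> t)" using q by (intro divide_right_mono) auto
    also have "\<dots> \<le> 4 * K3 * (\<bar>g2 t\<bar> / g1 t)" by (rule bnd[OF qz])
    finally have l: "ln (Dn t) - lg (\<zeta> t) \<le> 4 * K3 * (\<bar>g2 t\<bar> / g1 t)" by (simp add: lg_def)
    have "\<bar>lg (\<zeta> t) - ln (Dn t)\<bar> \<le> 4 * K3 * (\<bar>g2 t\<bar> / g1 t)" using u l by linarith
    hence v: "\<bar>p * (lg (\<zeta> t) - ln (Dn t))\<bar> \<le> p * (4 * K3 * (\<bar>g2 t\<bar> / g1 t))"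
      using p by (simp only: abs_mult abs_of_pos mult_left_mono less_imp_le)
    have "\<bar>\<epsilon> (\<zeta> t)\<bar> = \<bar>g2 (\<zeta> t)\<bar> / g1 (\<zeta> t)" using q by (simp add: \<epsilon>_def)
    also have "\<dots> \<le> (C\<zeta> * \<bar>g2 t\<bar>) / (g1 t / 2)" using elim(3,4) q C by (intro frac_le) auto
    finally have "B * \<bar>\<epsilon> (\<zeta> t)\<bar> \<le> B * (2 * C\<zeta> * (\<bar>g2 t\<bar> / g1 t))" using B by (intro mult_left_mono) (auto simp: mult_ac)
    hence w: "\<bar>s (\<zeta> t)\<bar> \<le> B * (2 * C\<zeta> * (\<bar>g2 t\<bar> / g1 t))" using elim(8) by linarith
    have "\<zeta> t - ?Z t = p * (lg (\<zeta> t) - ln (Dn t)) + s (\<zeta> t)" using elim(7) by (simp add: algebra_simps)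
    hence "\<bar>\<zeta> t - ?Z t\<bar> \<le> p * (4 * K3 * (\<bar>g2 t\<bar> / g1 t)) + B * (2 * C\<zeta> * (\<bar>g2 t\<bar> / g1 t))"
      using v w by linarith
    also have "\<dots> = K4 * (\<bar>g2 t\<bar> / g1 t)" by (simp add: K4_def algebra_simps add_divide_distrib)
    finally show ?case .
  qed
  have "((\<lambda>t. K4 * \<bar>\<epsilon> t\<bar>) \<longlongrightarrow> K4 * \<bar>0\<bar>) at_top" by (intro tendsto_intros \<epsilon>_tendsto_0)
  hence "\<forall>\<^sub>F t in at_top. K4 * \<bar>\<epsilon> t\<bar> < 1" by (rule order_tendstoD) simp
  hence close1: "\<forall>\<^sub>F t in at_top. \<bar>\<zeta> t - ?Z t\<bar> \<le> 1"
    using close eventually_gt_at_top[of t0]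
  proof eventually_elim
    case (elim t)
    have "\<bar>\<epsilon> t\<bar> = \<bar>g2 t\<bar> / g1 t" using g1_pos[OF elim(3)] by (simp add: \<epsilon>_def)
    thus ?case using elim(1,2) by simp
  qed
  have "\<exists>\<eta>. \<forall>t. \<zeta> t > t0 + 1 \<and> \<bar>\<zeta> t - ?Z t\<bar> \<le> 1 \<longrightarrow> \<bar>\<eta> t - t\<bar> \<le> H t \<and>
      g (\<zeta> t) - g (?Z t) = g1 (\<eta> t) * (\<zeta> t - ?Z t)"
  proof (intro choice allI)
    fix t
    show "\<exists>\<eta>. \<zeta> t > t0 + 1 \<and> \<bar>\<zeta> t - ?Z t\<bar> \<le> 1 \<longrightarrow> \<bar>\<eta> - t\<bar> \<le> H t \<and>
      g (\<zeta> t) - g (?Z t) = g1 \<eta> * (\<zeta> t - ?Z t)"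
    proof (cases "\<zeta> t > t0 + 1 \<and> \<bar>\<zeta> t - ?Z t\<bar> \<le> 1")
      case True
      hence "\<zeta> t > t0" "?Z t > t0" by argo+
      then obtain \<eta> where \<eta>: "\<bar>\<eta> - \<zeta> t\<bar> \<le> \<bar>\<zeta> t - ?Z t\<bar>" "g (\<zeta> t) - g (?Z t) = g1 \<eta> * (\<zeta> t - ?Z t)"
        using mvt_between[where a=t0, OF deriv_g, of "?Z t" "\<zeta> t"] by auto
      have "\<bar>\<eta> - t\<bar> \<le> H t" using \<eta>(1) True unfolding H_def by argo
      thus ?thesis using \<eta> by blast
    qed auto
  qed
  then obtain \<eta> where \<eta>: "\<And>t. \<zeta> t > t0 + 1 \<Longrightarrow> \<bar>\<zeta> t - ?Z t\<bar> \<le> 1 \<Longrightarrow> \<bar>\<eta> t - t\<bar> \<le> H t"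
    "\<And>t. \<zeta> t > t0 + 1 \<Longrightarrow> \<bar>\<zeta> t - ?Z t\<bar> \<le> 1 \<Longrightarrow> g (\<zeta> t) - g (?Z t) = g1 (\<eta> t) * (\<zeta> t - ?Z t)"
    by blast
  have sh\<eta>: "\<forall>\<^sub>F t in at_top. \<bar>\<eta> t - t\<bar> \<le> H t"
    using gt\<zeta> close1 by eventually_elim (rule \<eta>(1))
  have "\<forall>\<^sub>F t in at_top. norm (g (\<zeta> t) - g (?Z t)) \<le> 2 * K4 * norm (g2 t)"
    using gt\<zeta> close1 shift(3)[OF sh\<eta>] close eventually_gt_at_top[of t0]
  proof eventually_elim
    case (elim t)
    have q: "g1 t > 0" using g1_pos elim by auto
    have "g1 (\<eta> t) \<ge> 0" using elim(3) q by linarith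
    hence "norm (g (\<zeta> t) - g (?Z t)) = g1 (\<eta> t) * \<bar>\<zeta> t - ?Z t\<bar>"
      by (simp only: \<eta>(2)[OF elim(1,2)] real_norm_def abs_mult abs_of_nonneg)
    also have "\<dots> \<le> (2 * g1 t) * (K4 * (\<bar>g2 t\<bar> / g1 t))"
      using elim(3,4) q by (intro mult_mono) auto
    also have "\<dots> = 2 * K4 * norm (g2 t)" using q by simp
    finally show ?case .
  qed
  thus ?thesis unfolding Dn_def by (rule bigoI)
qed

text \<open>Undoes the change of variables for \<lambda> = 1. The value of \<open>a\<close> makes
  the factors \<theta> and \<alpha> - p cancel, so that the flux equation becomes the equation for
  \<open>n\<close>.\<close>

lemma local_singular_solution:
  fixes \<alpha> \<gamma> \<theta> p a :: real
  assumes p: "p > 0" and \<theta>: "\<theta> > 0" "\<theta> = \<gamma> + 1 + p - \<alpha>" and \<alpha>: "\<alpha> > p"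
    and a: "a = ln (\<theta> powr p * (\<alpha> - p))"
  obtains \<zeta> s B r0 \<Phi> where "filterlim \<zeta> at_top at_top" "\<forall>\<^sub>F t in at_top. \<zeta> t - p * lg (\<zeta> t) - s (\<zeta> t) = t"
    "\<And>z. \<bar>s z\<bar> \<le> B" "\<forall>\<^sub>F z in at_top. \<bar>s z\<bar> \<le> B * \<bar>\<epsilon> z\<bar>" "r0 > 0"
    "\<And>r. 0 < r \<Longrightarrow> r < r0 \<Longrightarrow> \<zeta> (a - \<theta> * ln r) > t0"
    "\<And>r. 0 < r \<Longrightarrow> r < r0 \<Longrightarrow>
       ((\<lambda>r. g (\<zeta> (a - \<theta> * ln r))) has_real_derivative - ((r powr (-\<alpha>) * \<Phi> r) powr (1/p))) (at r)"
    "\<And>r. 0 < r \<Longrightarrow> r < r0 \<Longrightarrow>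
       (\<Phi> has_real_derivative r powr \<gamma> * exp (\<zeta> (a - \<theta> * ln r))) (at r)"
    "\<And>r. \<Phi> r > 0"
proof -
  define \<kappa> where "\<kappa> = (\<alpha> - p) / \<theta>"
  have \<kappa>: "\<kappa> > 0" using \<theta> \<alpha> by (simp add: \<kappa>_def)
  obtain Z B s n where Z: "Z > t0" "B \<ge> 0"
    and sB: "\<And>z. \<bar>s z\<bar> \<le> B" and n1: "\<And>z. \<bar>n z\<bar> \<le> 1"
    and s\<epsilon>: "\<And>z. z \<ge> Z \<Longrightarrow> \<bar>s z\<bar> \<le> B * \<bar>\<epsilon> z\<bar>"
    and s': "\<And>z. z \<ge> Z \<Longrightarrow> (s has_real_derivative 1 - exp (- n z) - p * \<epsilon> z) (at z)"
    and n': "\<And>z. z \<ge> Z \<Longrightarrow> (n has_real_derivative \<kappa> / p * (exp (- n z) - exp (s z - (p + 1) * n z)) - \<epsilon> z) (at z)"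
    by (rule singular_phase_solution[OF \<kappa> p]) blast
  \<comment> \<open>\<open>T\<close> recovers \<open>t\<close> from \<open>z\<close>. In its
    derivative the \<epsilon> terms cancel, leaving \<open>exp (- n z) \<ge> exp (-1)\<close>; hence
    \<open>T\<close> is increasing and unbounded.\<close>
  define T where "T z = z - p * lg z - s z" for z
  have T': "(T has_real_derivative exp (- n z)) (at z)" if z: "z \<ge> Z" for z
  proof -
    have "(T has_real_derivative 1 - p * \<epsilon> z - (1 - exp (- n z) - p * \<epsilon> z)) (at z)"
      unfolding T_def[abs_def] by (intro DERIV_diff DERIV_ident DERIV_cmult deriv_lg s') (use z Z in auto)
    thus ?thesis by simp
  qed
  have Tlim: "filterlim T at_top at_top"
  proof (rule filterlim_at_top_mono[where f="\<lambda>z. T Z - exp (-1) * Z + exp (-1) * z"])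
    show "filterlim (\<lambda>z. T Z - exp (-1) * Z + exp (-1) * z) at_top at_top"
      by (intro filterlim_tendsto_add_at_top[OF tendsto_const]
           filterlim_tendsto_pos_mult_at_top[OF tendsto_const _ filterlim_ident]) simp
    show "\<forall>\<^sub>F z in at_top. T Z - exp (-1) * Z + exp (-1) * z \<le> T z"
      using eventually_ge_at_top[of Z]
    proof eventually_elim
      case (elim z)
      have "T Z - exp (-1) * Z \<le> T z - exp (-1) * z"
      proof (rule DERIV_nonneg_imp_nondecreasing[where f="\<lambda>z. T z - exp (-1) * z", OF elim])
        fix x assume "Z \<le> x"
        hence "((\<lambda>z. T z - exp (-1) * z) has_real_derivative exp (- n x) - exp (-1) * 1) (at x)"
          by (intro DERIV_diff T' DERIV_cmult DERIV_ident)
        moreover have "exp (- n x) - exp (-1) * 1 \<ge> 0" using n1[of x] by (simp add: abs_le_iff)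
        ultimately show "\<exists>y. ((\<lambda>z. T z - exp (-1) * z) has_real_derivative y) (at x) \<and> 0 \<le> y" by blast
      qed
      thus ?case by simp
    qed
  qed
  have Tc: "continuous_on {Z..} T"
    by (rule continuous_at_imp_continuous_on) (auto intro: DERIV_isCont[OF T'])
  obtain \<zeta> where \<zeta>: "\<And>t. t > T Z \<Longrightarrow> T (\<zeta> t) = t" "\<And>t. t > T Z \<Longrightarrow> \<zeta> t > Z"
    "\<And>t. t > T Z \<Longrightarrow> (\<zeta> has_real_derivative inverse (exp (- n (\<zeta> t)))) (at t)" "filterlim \<zeta> at_top at_top"
  proof (rule increasing_inverse_at_top[of Z T "\<lambda>z. exp (- n z)"])
    show "continuous_on {Z..} T" by (rule Tc)
    show "filterlim T at_top at_top" by (rule Tlim)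
  qed (auto intro: T')
  define \<tau> where "\<tau> r = a - \<theta> * ln r" for r
  define z where "z r = \<zeta> (\<tau> r)" for r
  \<comment> \<open>The flux \<open>r powr \<alpha> * \<bar>u'\<bar> powr p\<close> for
    \<open>u' = - (\<theta> / r) * g1 z * exp (n z)\<close>, written as one exponential to ease
    differentiation.\<close>
  define \<Phi> where "\<Phi> r = exp (p * ln \<theta> + (\<alpha> - p) * ln r + p * (lg (z r) + n (z r)))" for r
  define r0 where "r0 = exp ((a - T Z) / \<theta>)"
  have \<tau>: "\<tau> r > T Z" if "0 < r" "r < r0" for r
  proof -
    have "0 < r0" by (simp add: r0_def)
    hence "ln r < ln r0" using that by simp
    hence "ln r < (a - T Z) / \<theta>" by (simp add: r0_def)
    thus ?thesis using \<theta> by (simp add: \<tau>_def pos_less_divide_eq mult.commute)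
  qed
  have zr: "z r > Z" "z r = \<tau> r + p * lg (z r) + s (z r)" if "0 < r" "r < r0" for r
    using \<zeta>(1,2)[OF \<tau>[OF that]] by (simp_all add: z_def T_def)
  have z': "(z has_real_derivative - (\<theta> / r) * exp (n (z r))) (at r)" if r: "0 < r" "r < r0" for r
  proof -
    have "(\<tau> has_real_derivative - (\<theta> / r)) (at r)"
      unfolding \<tau>_def[abs_def] using r by (auto intro!: derivative_eq_intros)
    from DERIV_chain2[OF \<zeta>(3)[OF \<tau>[OF r]] this] show ?thesis
      by (simp add: z_def[abs_def] exp_minus mult.commute)
  qed
  have ea: "exp a = \<theta> powr p * (\<alpha> - p)" using \<theta> \<alpha> by (simp add: a)
  show ?thesis
  proof (rule that[of \<zeta> s B r0 \<Phi>])
    show "\<forall>\<^sub>F t in at_top. \<zeta> t - p * lg (\<zeta> t) - s (\<zeta> t) = t"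
      using eventually_gt_at_top[of "T Z"] by eventually_elim (use \<zeta>(1) in \<open>simp add: T_def\<close>)
    show "\<forall>\<^sub>F z in at_top. \<bar>s z\<bar> \<le> B * \<bar>\<epsilon> z\<bar>"
      using eventually_ge_at_top[of Z] by eventually_elim (rule s\<epsilon>)
    show "r0 > 0" by (simp add: r0_def)
    fix r assume r: "0 < r" "r < r0"
    show "t0 < \<zeta> (a - \<theta> * ln r)" using zr(1)[OF r] Z by (simp add: z_def \<tau>_def)
    have g1: "g1 (z r) = exp (lg (z r))" using g1_pos[of "z r"] zr[OF r] Z by (simp add: lg_def)
    have "r powr (-\<alpha>) * \<Phi> r = exp (p * (ln \<theta> - ln r + lg (z r) + n (z r)))"
      using r by (simp add: powr_def \<Phi>_def flip: exp_add) (simp add: algebra_simps)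
    hence pw: "(r powr (-\<alpha>) * \<Phi> r) powr (1/p) = exp (ln \<theta> - ln r + lg (z r) + n (z r))"
      using p by (simp add: powr_def)
    also have "\<dots> = g1 (z r) * ((\<theta> / r) * exp (n (z r)))"
      using r \<theta> by (simp add: g1 exp_add exp_diff)
    finally have pw: "- ((r powr (-\<alpha>) * \<Phi> r) powr (1/p)) = g1 (z r) * (- (\<theta> / r) * exp (n (z r)))" by simp
    have "((\<lambda>r. g (z r)) has_real_derivative g1 (z r) * (- (\<theta> / r) * exp (n (z r)))) (at r)"
      by (rule DERIV_chain2[OF deriv_g z'[OF r]]) (use zr[OF r] Z in auto)
    thus "((\<lambda>r. g (\<zeta> (a - \<theta> * ln r))) has_real_derivative - ((r powr (-\<alpha>) * \<Phi> r) powr (1/p))) (at r)"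
      unfolding pw by (simp add: z_def \<tau>_def)
    let ?E = "exp (- n (z r))" and ?F = "exp (s (z r) - (p + 1) * n (z r))"
    \<comment> \<open>In the logarithmic derivative of the flux the \<epsilon> from
      \<open>lg\<close> cancels the \<epsilon> in the equation for \<open>n\<close>.\<close>
    have d: "((\<lambda>r. p * ln \<theta> + (\<alpha> - p) * ln r + p * (lg (z r) + n (z r))) has_real_derivative
       (0 + (\<alpha> - p) * (1 / r)) + p * (\<epsilon> (z r) * (- (\<theta> / r) * exp (n (z r))) +
          (\<kappa> / p * (?E - ?F) - \<epsilon> (z r)) * (- (\<theta> / r) * exp (n (z r))))) (at r)"
      by (intro DERIV_add DERIV_const DERIV_cmult DERIV_chain2[OF deriv_lg z'[OF r]]
            DERIV_chain2[OF n' z'[OF r]]) (use zr[OF r] Z r in \<open>auto intro: DERIV_ln_divide\<close>)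
    have "(0 + (\<alpha> - p) * (1 / r)) + p * (\<epsilon> (z r) * (- (\<theta> / r) * exp (n (z r))) +
          (\<kappa> / p * (?E - ?F) - \<epsilon> (z r)) * (- (\<theta> / r) * exp (n (z r))))
       = (\<alpha> - p) / r - \<kappa> * \<theta> / r * (?E * exp (n (z r)) - ?F * exp (n (z r)))"
    proof -
      have *: "p * (e * c + (x - e) * c) = (p * x) * c" for e c x by (simp add: algebra_simps)
      have **: "p * (\<kappa> / p * (?E - ?F)) = \<kappa> * (?E - ?F)" using p by simp
      show ?thesis unfolding * ** by (simp add: algebra_simps diff_divide_distrib)
    qed
    also have "\<dots> = (\<alpha> - p) / r * exp (s (z r) - p * n (z r))"
      using \<theta> r by (simp add: \<kappa>_def flip: exp_add) (simp add: field_simps)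
    finally have "((\<lambda>r. p * ln \<theta> + (\<alpha> - p) * ln r + p * (lg (z r) + n (z r))) has_real_derivative
       (\<alpha> - p) / r * exp (s (z r) - p * n (z r))) (at r)" using d by (simp only:)
    from DERIV_chain2[OF DERIV_exp this]
    have "(\<Phi> has_real_derivative \<Phi> r * ((\<alpha> - p) / r * exp (s (z r) - p * n (z r)))) (at r)"
      by (simp add: \<Phi>_def[abs_def])
    moreover have "\<Phi> r * ((\<alpha> - p) / r * exp (s (z r) - p * n (z r))) = r powr \<gamma> * exp (z r)"
    proof -
      have "\<Phi> r * exp (s (z r) - p * n (z r)) * exp (- ln r)
          = \<theta> powr p * exp ((\<alpha> - p - 1) * ln r + p * lg (z r) + s (z r))"
        using \<theta> by (simp add: \<Phi>_def powr_def flip: exp_add) (simp add: algebra_simps)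
      hence h: "\<Phi> r * exp (s (z r) - p * n (z r)) / r
          = \<theta> powr p * exp ((\<alpha> - p - 1) * ln r + p * lg (z r) + s (z r))"
        using r by (simp add: exp_minus divide_inverse)
      have "\<Phi> r * ((\<alpha> - p) / r * exp (s (z r) - p * n (z r)))
          = (\<alpha> - p) * (\<Phi> r * exp (s (z r) - p * n (z r)) / r)" by simp
      also have "\<dots> = exp a * exp ((\<alpha> - p - 1) * ln r + p * lg (z r) + s (z r))"
        unfolding ea h by simp
      also have "\<dots> = r powr \<gamma> * exp (a - \<theta> * ln r + p * lg (z r) + s (z r))"
      proof -
        have "\<gamma> = \<alpha> - p - 1 + \<theta>" using \<theta>(2) by simp
        thus ?thesis using r by (simp add: powr_def flip: exp_add) (simp add: algebra_simps)
      qed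
      also have "\<dots> = r powr \<gamma> * exp (z r)" using zr(2)[OF r] by (simp add: \<tau>_def)
      finally show ?thesis .
    qed
    ultimately show "(\<Phi> has_real_derivative r powr \<gamma> * exp (\<zeta> (a - \<theta> * ln r))) (at r)"
      by (simp add: z_def \<tau>_def)
  qed (use \<zeta>(4) sB in \<open>auto simp: \<Phi>_def\<close>)
qed

end

section \<open>The global solution\<close>

text \<open>At \<open>b\<close> the left and right difference quotients have the same limit because
  values and derivatives match; elsewhere one branch is used locally.\<close>

lemma has_real_derivative_glue:
  fixes f h f' h' :: "real \<Rightarrow> real"
  assumes f: "\<And>r. 0 < r \<Longrightarrow> r \<le> b \<Longrightarrow> (f has_real_derivative f' r) (at r)"
    and h: "\<And>r. r \<in> {b..R} \<Longrightarrow> (h has_real_derivative h' r) (at r within {b..R})"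
    and eq: "f b = h b" "f' b = h' b" and r: "0 < r" "r < R" "b < R" "0 < b"
  shows "((\<lambda>r. if r \<le> b then f r else h r) has_real_derivative (if r \<le> b then f' r else h' r)) (at r)"
proof (cases r b rule: linorder_cases)
  case less
  have "(f has_real_derivative f' r) (at r)" using f less r by simp
  hence "((\<lambda>r. if r \<le> b then f r else h r) has_real_derivative f' r) (at r)"
    by (rule has_field_derivative_transform_within_open[where S="{..<b}"]) (use less in auto)
  thus ?thesis using less by simp
next
  case greater
  have "(h has_real_derivative h' r) (at r)" using h[of r] greater r at_within_Icc_at[of b r R] by simp
  hence "((\<lambda>r. if r \<le> b then f r else h r) has_real_derivative h' r) (at r)"
    by (rule has_field_derivative_transform_within_open[where S="{b<..}"]) (use greater in auto)
  thus ?thesis using greater by simp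
next
  case equal
  let ?k = "\<lambda>r. if r \<le> b then f r else h r"
  have "(f has_real_derivative f' b) (at b within {..<b})" using f[of b] r by (auto intro: DERIV_subset)
  hence "((\<lambda>y. (f y - f b) / (y - b)) \<longlongrightarrow> f' b) (at_left b)" by (simp add: has_field_derivative_iff)
  moreover have "\<forall>\<^sub>F y in at_left b. (f y - f b) / (y - b) = (?k y - ?k b) / (y - b)"
    by (auto simp: eventually_at_filter)
  ultimately have L: "((\<lambda>y. (?k y - ?k b) / (y - b)) \<longlongrightarrow> f' b) (at_left b)"
    by (rule Lim_transform_eventually)
  have "(h has_real_derivative f' b) (at_right b)" using h[of b] r eq at_within_Icc_at_right[of b R] by simp
  hence "((\<lambda>y. (h y - h b) / (y - b)) \<longlongrightarrow> f' b) (at_right b)" by (simp add: has_field_derivative_iff)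
  moreover have "\<forall>\<^sub>F y in at_right b. (h y - h b) / (y - b) = (?k y - ?k b) / (y - b)"
    using eq by (auto simp: eventually_at_filter)
  ultimately have "((\<lambda>y. (?k y - ?k b) / (y - b)) \<longlongrightarrow> f' b) (at_right b)"
    by (rule Lim_transform_eventually)
  with L have "((\<lambda>y. (?k y - ?k b) / (y - b)) \<longlongrightarrow> f' b) (at b)" by (rule filterlim_split_at)
  thus ?thesis using equal by (simp add: has_field_derivative_iff)
qed

text \<open>Replacing \<open>r\<close> by \<open>rz * r\<close> multiplies the equation by
  \<open>rz powr \<theta>\<close>. The solution is required slightly beyond its zero so that all
  derivatives at \<open>r = 1\<close> exist; the truncation at 0 is felt only there.\<close>

lemma singular_solution_rescale:
  fixes \<alpha> \<beta> \<gamma> \<theta> p rz R :: real and U P f :: "real \<Rightarrow> real"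
  assumes p: "p = \<beta> + 1" "\<beta> \<ge> 0" and \<theta>: "\<theta> = \<gamma> + 1 + p - \<alpha>" and rz: "0 < rz" "rz < R"
    and f: "continuous_on {0..} f"
    and U': "\<And>r. 0 < r \<Longrightarrow> r < R \<Longrightarrow> (U has_real_derivative - ((r powr (-\<alpha>) * P r) powr (1/p))) (at r)"
    and P': "\<And>r. 0 < r \<Longrightarrow> r < R \<Longrightarrow> (P has_real_derivative r powr \<gamma> * exp (f (max 0 (U r)))) (at r)"
    and P0: "\<And>r. 0 < r \<Longrightarrow> r < R \<Longrightarrow> P r > 0"
    and Uz: "U rz = 0" and lim: "filterlim U at_top (at_right 0)"
  shows "singular_solution \<alpha> \<beta> \<gamma> f (rz powr \<theta>) (\<lambda>r. U (rz * r))"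
proof -
  have p0: "p > 0" using p by simp
  define W where "W r = - ((r powr (-\<alpha>) * P r) powr (1/p))" for r
  define W2 where "W2 r = W r * (1 / p * (r powr \<gamma> * exp (f (max 0 (U r))) / P r - \<alpha> / r))" for r
  have Wneg: "W r < 0" if "0 < r" "r < R" for r using P0[OF that] that by (simp add: W_def)
  have W': "(W has_real_derivative W2 r) (at r)" if r: "0 < r" "r < R" for r
  proof -
    \<comment> \<open>The power is written as an exponential so that \<open>U''\<close> comes from
      one logarithmic differentiation.\<close>
    have W_exp: "W x = - exp (1 / p * (ln (P x) - \<alpha> * ln x))" if "0 < x" "x < R" for x
      using P0[OF that] that by (simp add: W_def powr_def ln_mult)
    have "((\<lambda>x. - exp (1 / p * (ln (P x) - \<alpha> * ln x))) has_real_derivative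
        - (exp (1 / p * (ln (P r) - \<alpha> * ln r)) * (1 / p * (1 / P r * (r powr \<gamma> * exp (f (max 0 (U r)))) - \<alpha> * (1 / r))))) (at r)"
      by (intro DERIV_minus DERIV_chain2[OF DERIV_exp] DERIV_cmult DERIV_diff
            DERIV_chain2[OF DERIV_ln_divide P'] DERIV_ln_divide r P0)
    hence "((\<lambda>x. - exp (1 / p * (ln (P x) - \<alpha> * ln x))) has_real_derivative W2 r) (at r)"
      by (simp add: W2_def W_exp[OF r])
    thus ?thesis
      by (rule has_field_derivative_transform_within_open[where S="{0<..<R}"]) (use r W_exp in auto)
  qed
  have sc: "0 < rz * r" "rz * r < R" if "0 < r" "r \<le> 1" for r
  proof -
    show "0 < rz * r" using that rz by simp
    have "rz * r \<le> rz * 1" using that rz by (intro mult_left_mono) auto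
    thus "rz * r < R" using rz by linarith
  qed
  have scale': "((\<lambda>r. F (rz * r)) has_real_derivative F' (rz * r) * rz) (at r)"
    if "(F has_real_derivative F' (rz * r)) (at (rz * r))" for F F' r
    by (rule DERIV_chain2[where f=F and g="\<lambda>r. rz * r", OF that]) (auto intro!: derivative_eq_intros)
  have v1: "((\<lambda>r. U (rz * r)) has_real_derivative W (rz * r) * rz) (at r)" if "0 < r" "r \<le> 1" for r
    by (rule scale') (use U'[OF sc[OF that]] in \<open>simp add: W_def\<close>)
  have v2: "((\<lambda>r. W (rz * r) * rz) has_real_derivative W2 (rz * r) * rz * rz) (at r)" if "0 < r" "r \<le> 1" for r
    by (intro DERIV_cmult_right scale' W' sc that)
  have Uc: "continuous_on {0<..<R} U" and Pc: "continuous_on {0<..<R} P" and Wc: "continuous_on {0<..<R} W"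
    using U' P' W' by (auto intro!: continuous_at_imp_continuous_on DERIV_isCont)
  have fm: "continuous_on UNIV (\<lambda>x. f (max 0 x))"
    by (rule continuous_on_compose2[OF f]) (auto intro!: continuous_intros)
  have fU: "continuous_on {0<..<R} (\<lambda>r. f (max 0 (U r)))"
    by (rule continuous_on_compose2[OF fm Uc]) auto
  have W2c: "continuous_on {0<..<R} W2"
    unfolding W2_def using P0 p0 by (intro continuous_intros Wc Pc fU) (auto simp: less_imp_neq[symmetric])
  have "C2_on_01 (\<lambda>r. U (rz * r))"
    unfolding C2_on_01_def
  proof (intro exI conjI ballI)
    fix r :: real assume "r \<in> {0<..1}"
    thus "((\<lambda>r. U (rz * r)) has_real_derivative W (rz * r) * rz) (at r within {0<..1})"
      "((\<lambda>r. W (rz * r) * rz) has_real_derivative W2 (rz * r) * rz * rz) (at r within {0<..1})"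
      using v1[of r] v2[of r] by (auto intro: DERIV_subset)
  next
    have "continuous_on {0<..1} (\<lambda>r. W2 (rz * r))"
      by (rule continuous_on_compose2[OF W2c]) (auto intro!: continuous_intros simp: sc rz)
    thus "continuous_on {0<..1} (\<lambda>r. W2 (rz * r) * rz * rz)" by (intro continuous_intros)
  qed
  moreover have pos: "U (rz * r) > 0" if r: "0 < r" "r < 1" for r
  proof -
    have lt: "rz * r < rz" using r rz by simp
    have "U rz < U (rz * r)"
    proof (rule DERIV_neg_imp_decreasing[OF lt])
      fix x assume "rz * r \<le> x" "x \<le> rz"
      hence "0 < x" "x < R" using sc(1)[OF r(1) less_imp_le[OF r(2)]] rz by linarith+
      thus "\<exists>y. (U has_real_derivative y) (at x) \<and> y < 0"
        using U'[of x] Wneg[of x] unfolding W_def by blast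
    qed
    thus ?thesis using Uz by simp
  qed
  moreover have "radial_L \<alpha> \<beta> \<gamma> (\<lambda>r. U (rz * r)) r + rz powr \<theta> * exp (f (U (rz * r))) = 0"
    if r: "0 < r" "r < 1" for r
  proof -
    \<comment> \<open>Rescaling multiplies the flux by the constant
      \<open>rz powr (p - \<alpha>)\<close>: \<open>p\<close> from the derivative of
      \<open>U\<close>, and \<alpha> from the weight.\<close>
    have flux: "s powr \<alpha> * \<bar>deriv (\<lambda>r. U (rz * r)) s\<bar> powr \<beta> * deriv (\<lambda>r. U (rz * r)) s
        = - (rz powr (p - \<alpha>)) * P (rz * s)" if s: "0 < s" "s < 1" for s
    proof -
      have s': "0 < rz * s" "rz * s < R" using sc[of s] s by auto
      note Pp = P0[OF s']
      define w where "w = - W (rz * s) * rz"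
      have w: "w > 0" using Wneg[OF s'] rz by (simp add: w_def mult_neg_pos)
      have dv: "deriv (\<lambda>r. U (rz * r)) s = - w" using DERIV_imp_deriv[OF v1[of s]] s by (simp add: w_def)
      have "w powr p = (rz * s) powr (-\<alpha>) * P (rz * s) * rz powr p"
        using Pp s' rz p0 by (simp add: w_def W_def powr_mult powr_powr)
      hence wp: "s powr \<alpha> * w powr p = rz powr (p - \<alpha>) * P (rz * s)"
        using s rz by (simp add: powr_mult powr_diff powr_minus field_simps)
      have "\<bar>- w\<bar> powr \<beta> * - w = - (w powr p)" using w by (simp add: p powr_add)
      thus ?thesis unfolding dv using wp by (simp add: mult.assoc)
    qed
    have "((\<lambda>s. - (rz powr (p - \<alpha>)) * P (rz * s)) has_real_derivative
        - (rz powr (p - \<alpha>)) * ((rz * r) powr \<gamma> * exp (f (max 0 (U (rz * r)))) * rz)) (at r)"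
      using sc[of r] r by (intro DERIV_cmult scale'[where F'="\<lambda>x. x powr \<gamma> * exp (f (max 0 (U x)))"] P') auto
    hence "((\<lambda>s. s powr \<alpha> * \<bar>deriv (\<lambda>r. U (rz * r)) s\<bar> powr \<beta> * deriv (\<lambda>r. U (rz * r)) s) has_real_derivative
        - (rz powr (p - \<alpha>)) * ((rz * r) powr \<gamma> * exp (f (max 0 (U (rz * r)))) * rz)) (at r)"
      by (rule has_field_derivative_transform_within_open[where S="{0<..<1}"]) (use r flux in auto)
    hence L: "radial_L \<alpha> \<beta> \<gamma> (\<lambda>r. U (rz * r)) r
      = r powr (-\<gamma>) * (- (rz powr (p - \<alpha>)) * ((rz * r) powr \<gamma> * exp (f (max 0 (U (rz * r)))) * rz))"
      unfolding radial_L_def by (subst DERIV_imp_deriv) auto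
    have "rz powr \<theta> = rz powr (p - \<alpha>) * rz powr \<gamma> * rz"
      using rz by (simp add: \<theta> powr_add powr_diff)
    moreover have "r powr (-\<gamma>) * r powr \<gamma> = 1" using r by (simp flip: powr_add)
    moreover have "max 0 (U (rz * r)) = U (rz * r)" using pos[OF r] by simp
    ultimately show ?thesis unfolding L using r rz by (simp add: powr_mult mult_ac)
  qed
  moreover have "filterlim (\<lambda>r. U (rz * r)) at_top (at_right 0)"
  proof (rule filterlim_compose[OF lim])
    have "((\<lambda>r. rz * r) \<longlongrightarrow> rz * 0) (at_right 0)" by (intro tendsto_intros)
    thus "filterlim (\<lambda>r. rz * r) (at_right 0) (at_right 0)"
      using rz by (intro tendsto_imp_filterlim_at_right) (auto simp: eventually_at_filter)
  qed
  ultimately show ?thesis unfolding singular_solution_def using Uz by auto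
qed

text \<open>On the compact range \<open>{0..b}\<close> the function \<open>exp (f x)\<close> has a
  positive minimum and a bounded derivative, and clamping does not increase distances. This supplies
  the two hypotheses on \<open>F\<close> of the flux problem.\<close>

lemma exp_C4_clamped_lipschitz:
  assumes f: "C4_nonneg f D" and b: "b \<ge> 0"
  obtains L m where "m > 0" "\<And>x. exp (f (max 0 (min x b))) \<ge> m"
    "\<And>x y. \<bar>exp (f (max 0 (min x b))) - exp (f (max 0 (min y b)))\<bar> \<le> L * \<bar>x - y\<bar>"
proof -
  define cl where "cl x = max 0 (min x b)" for x
  have cl: "cl x \<in> {0..b}" for x using b by (auto simp: cl_def)
  have D0: "D 0 = f" using f by (simp add: C4_nonneg_def)
  have c: "continuous_on {0..b} f" "continuous_on {0..b} (D 1)"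
    using C4_nonneg_continuous[OF f, of 0] C4_nonneg_continuous[OF f, of 1] D0
    by (auto intro: continuous_on_subset)
  have f': "(f has_real_derivative D 1 x) (at x within {0..b})" if "x \<in> {0..b}" for x
  proof -
    have "(D 0 has_real_derivative D (Suc 0) x) (at x within {0..})"
      using f that unfolding C4_nonneg_def by force
    thus ?thesis using D0 by (auto intro: DERIV_subset)
  qed
  obtain x0 where x0: "\<forall>x\<in>{0..b}. f x0 \<le> f x"
    using continuous_attains_inf[OF compact_Icc _ c(1)] b by auto
  have "bounded ((\<lambda>x. exp (f x) * D 1 x) ` {0..b})"
    by (intro compact_imp_bounded compact_continuous_image continuous_intros c) auto
  then obtain L where L: "\<And>x. x \<in> {0..b} \<Longrightarrow> norm (exp (f x) * D 1 x) \<le> L"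
    unfolding bounded_iff by (metis image_eqI)
  have L0: "L \<ge> 0" using L[of 0] b norm_ge_zero order_trans by (metis atLeastAtMost_iff order_refl)
  show ?thesis
  proof (rule that[of "exp (f x0)" L])
    show "exp (f x0) \<le> exp (f (max 0 (min x b)))" for x using x0 cl[of x] by (simp add: cl_def)
    fix x y
    have "norm (exp (f (cl x)) - exp (f (cl y))) \<le> L * norm (cl x - cl y)"
    proof (rule field_differentiable_bound[where S="{0..b}" and f="\<lambda>x. exp (f x)" and f'="\<lambda>x. exp (f x) * D 1 x"])
      fix z assume z: "z \<in> {0..b}"
      show "((\<lambda>x. exp (f x)) has_real_derivative exp (f z) * D 1 z) (at z within {0..b})"
        by (rule DERIV_chain2[OF DERIV_exp f'[OF z]])
    qed (use L cl in auto)
    also have "\<dots> \<le> L * \<bar>x - y\<bar>"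
      using L0 by (intro mult_left_mono) (auto simp: cl_def max_def min_def)
    finally show "\<bar>exp (f (max 0 (min x b))) - exp (f (max 0 (min y b)))\<bar> \<le> L * \<bar>x - y\<bar>"
      by (simp add: cl_def)
  qed auto
qed

text \<open>The flux problem is restarted inside the known interval and carried on until
  \<open>u\<close> is strictly negative, so the zero lies strictly before \<open>R\<close> and room
  remains on its right. Matching \<open>u\<close> and \<Phi> at the junction makes both sides of the
  system agree there.\<close>

lemma radial_flux_continuation:
  fixes \<alpha> \<gamma> \<theta> p r0 :: real and f u0 \<Phi> :: "real \<Rightarrow> real"
  assumes p: "p \<ge> 1" and exps: "\<theta> > 0" "\<gamma> + 1 > 0" "\<theta> = \<gamma> + 1 + p - \<alpha>" and r0: "r0 > 0"
    and f: "C4_nonneg f D"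
    and u0: "\<And>r. 0 < r \<Longrightarrow> r < r0 \<Longrightarrow> (u0 has_real_derivative - ((r powr (-\<alpha>) * \<Phi> r) powr (1/p))) (at r)"
    and \<Phi>: "\<And>r. 0 < r \<Longrightarrow> r < r0 \<Longrightarrow> (\<Phi> has_real_derivative r powr \<gamma> * exp (f (u0 r))) (at r)"
    and \<Phi>0: "\<And>r. \<Phi> r > 0" and u0_pos: "\<And>r. 0 < r \<Longrightarrow> r < r0 \<Longrightarrow> u0 r > 0"
  obtains U P rz R where "0 < rz" "rz < R" "U rz = 0" "\<forall>\<^sub>F r in at_right 0. U r = u0 r"
    "\<And>r. 0 < r \<Longrightarrow> r < R \<Longrightarrow> (U has_real_derivative - ((r powr (-\<alpha>) * P r) powr (1/p))) (at r)"
    "\<And>r. 0 < r \<Longrightarrow> r < R \<Longrightarrow> (P has_real_derivative r powr \<gamma> * exp (f (max 0 (U r)))) (at r)"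
    "\<And>r. 0 < r \<Longrightarrow> r < R \<Longrightarrow> P r > 0"
proof -
  \<comment> \<open>Strictly inside the known interval, so that the singular solution is
    differentiable from both sides at the junction.\<close>
  define r1 where "r1 = r0 / 2"
  have r1: "r1 > 0" "r1 < r0" using r0 by (auto simp: r1_def)
  define u1 where "u1 = u0 r1"
  have u1: "u1 > 0" using u0_pos[OF r1] by (simp add: u1_def)
  define F where "F x = exp (f (max 0 (min x u1)))" for x
  obtain L m where m: "m > 0" and Fm: "\<And>x. F x \<ge> m" and FL: "\<And>x y. \<bar>F x - F y\<bar> \<le> L * \<bar>x - y\<bar>"
  proof (rule exp_C4_clamped_lipschitz[OF f less_imp_le[OF u1], folded F_def], goal_cases)
    case (1 L m)
    show ?case by (rule that[of m L]) (fact 1(2-))+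
  qed
  obtain u2 \<Phi>2 R where R: "R > r1" and ini: "u2 r1 = u1" "\<Phi>2 r1 = \<Phi> r1" and u2R: "u2 R < 0"
    and u2: "\<And>r. r \<in> {r1..R} \<Longrightarrow> (u2 has_real_derivative - ((r powr (-\<alpha>) * \<Phi>2 r) powr (1/p))) (at r within {r1..R})"
    and \<Phi>2: "\<And>r. r \<in> {r1..R} \<Longrightarrow> (\<Phi>2 has_real_derivative r powr \<gamma> * F (u2 r)) (at r within {r1..R})"
    and \<Phi>20: "\<And>r. r \<in> {r1..R} \<Longrightarrow> \<Phi>2 r > 0"
    by (rule radial_flux_ivp_vanishing[OF p r1(1) \<Phi>0[of r1] m exps(1,2) exps(3)[symmetric] Fm FL, of u1]) blast
  have u2c: "continuous_on {r1..R} u2" by (rule DERIV_continuous_on[OF u2])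
  have u2_le: "u2 r \<le> u1" if r: "r \<in> {r1..R}" for r
  proof -
    have "u2 r \<le> u2 r1"
    proof (rule DERIV_nonpos_imp_decreasing_open[where f=u2])
      show "continuous_on {r1..r} u2" using r by (intro continuous_on_subset[OF u2c]) auto
      fix x assume x: "r1 < x" "x < r"
      hence "(u2 has_real_derivative - ((x powr (-\<alpha>) * \<Phi>2 x) powr (1/p))) (at x)"
        using u2[of x] r at_within_Icc_at[of r1 x R] by simp
      thus "\<exists>y. (u2 has_real_derivative y) (at x) \<and> y \<le> 0" by (intro exI conjI) auto
    qed (use r in auto)
    thus ?thesis using ini by simp
  qed
  obtain rz where rz: "r1 \<le> rz" "rz \<le> R" "u2 rz = 0"
    using IVT2'[of u2 R 0 r1] u2R u1 ini R u2c by auto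
  have rz': "r1 < rz" "rz < R" using rz u2R u1 ini by (auto simp: order_less_le)
  define U where "U r = (if r \<le> r1 then u0 r else u2 r)" for r
  define P where "P r = (if r \<le> r1 then \<Phi> r else \<Phi>2 r)" for r
  have Fu1: "F (u2 r) = exp (f (max 0 (u2 r)))" if "r \<in> {r1..R}" for r
    using u2_le[OF that] by (simp add: F_def min_absorb1)
  show ?thesis
  proof (rule that[of rz R U P])
    show "0 < rz" "rz < R" "U rz = 0" using rz rz' r1 by (auto simp: U_def)
    show "\<forall>\<^sub>F r in at_right 0. U r = u0 r"
      using eventually_at_right_less[of 0] eventually_at_right_real[OF r1(1)]
      by eventually_elim (auto simp: U_def)
    fix r assume r: "0 < r" "r < R"
    have "(U has_real_derivative (if r \<le> r1 then - ((r powr (-\<alpha>) * \<Phi> r) powr (1/p))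
        else - ((r powr (-\<alpha>) * \<Phi>2 r) powr (1/p)))) (at r)"
      unfolding U_def[abs_def]
      by (rule has_real_derivative_glue[where f'="\<lambda>r. - ((r powr (-\<alpha>) * \<Phi> r) powr (1/p))"
            and h'="\<lambda>r. - ((r powr (-\<alpha>) * \<Phi>2 r) powr (1/p))" and R=R])
         (use u0 u2 r r1 R ini in \<open>auto simp: u1_def\<close>)
    thus "(U has_real_derivative - ((r powr (-\<alpha>) * P r) powr (1/p))) (at r)"
      by (simp add: P_def split: if_splits)
    have "(P has_real_derivative (if r \<le> r1 then r powr \<gamma> * exp (f (u0 r))
        else r powr \<gamma> * F (u2 r))) (at r)"
      unfolding P_def[abs_def]
      by (rule has_real_derivative_glue[where f'="\<lambda>r. r powr \<gamma> * exp (f (u0 r))"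
            and h'="\<lambda>r. r powr \<gamma> * F (u2 r)" and R=R])
         (use \<Phi> \<Phi>2 r r1 R ini u1 in \<open>auto simp: u1_def F_def\<close>)
    moreover have "(if r \<le> r1 then r powr \<gamma> * exp (f (u0 r)) else r powr \<gamma> * F (u2 r))
        = r powr \<gamma> * exp (f (max 0 (U r)))"
      using Fu1[of r] u0_pos[of r] r r1 by (auto simp: U_def max_def)
    ultimately show "(P has_real_derivative r powr \<gamma> * exp (f (max 0 (U r)))) (at r)" by simp
    show "P r > 0" using \<Phi>0 \<Phi>20[of r] r by (auto simp: P_def)
  qed
qed

theorem theorem1p1:
  fixes \<alpha> \<beta> \<gamma> :: real and f g :: "real \<Rightarrow> real" and D :: "nat \<Rightarrow> real \<Rightarrow> real"
  defines "\<theta> \<equiv> \<gamma> + 2 + \<beta> - \<alpha>"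
  assumes g_inv: "\<forall>u\<ge>0. g (f u) = u"
  assumes A1: "C4_nonneg f D" "\<forall>u\<ge>0. D 1 u > 0" "filterlim f at_top at_top"
  assumes A2: "((deriv ^^ 2) g \<longlongrightarrow> 0) at_top"
    "\<forall>\<epsilon>. \<epsilon> \<in> O((deriv ^^ 2) g) \<longrightarrow> ((\<lambda>t. f (g t + \<epsilon> t) / t) \<longlongrightarrow> 1) at_top"
  assumes A3: "\<forall>h. h \<in> o(\<lambda>t. t) \<longrightarrow> ((\<lambda>t. deriv g t / deriv g (t + h t)) \<longlongrightarrow> 1) at_top"
  assumes A4: "((\<lambda>t. (deriv ^^ 2) g t / deriv g t * ln (deriv g t)) \<longlongrightarrow> 0) at_top"
  assumes A5a: "\<forall>n\<le>2. (\<lambda>t. (deriv ^^ 3) g t * (ln (deriv g t)) ^ n) \<in> O((deriv ^^ 2) g)"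
    "(\<lambda>t. (deriv ^^ 4) g t * ln (deriv g t)) \<in> O((deriv ^^ 2) g)"
  assumes A5b: "(\<lambda>t. SUP s\<in>{t..}. \<bar>(deriv ^^ 2) g s\<bar>) \<in> O((deriv ^^ 2) g)"
    "\<forall>h. h \<in> o(\<lambda>t. t) \<longrightarrow> (\<lambda>t. (deriv ^^ 2) g (t + h t)) \<in> O((deriv ^^ 2) g)"
  assumes A6: "\<alpha> > \<beta> + 1" "\<beta> \<ge> 0" "\<theta> > 0"
  shows "\<exists>lam>0. \<exists>u. singular_solution \<alpha> \<beta> \<gamma> f lam u \<and>
    (let \<tau> = (\<lambda>r. ln ((\<beta> + 1) / (lam * r powr \<theta>)));
         Z = (\<lambda>r. ln (\<theta> powr (\<beta> + 1) * (\<alpha> - \<beta> - 1)) - ln lam - \<theta> * ln r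
               + (\<beta> + 1) * ln (deriv g (\<tau> r)
                    + (\<beta> + 1) * (deriv ^^ 2) g (\<tau> r) * ln (deriv g (\<tau> r))))
     in (\<lambda>r. u r - g (Z r)) \<in> O[at_right 0](\<lambda>r. (deriv ^^ 2) g (ln (r powr (-\<theta>)))))"
proof -
  note inv = C4_nonneg_inverse[OF g_inv A1]
  note invd = C4_nonneg_inverse_derivatives[OF g_inv A1]
  interpret slowly_varying_inverse g "deriv g" "(deriv ^^ 2) g" "(deriv ^^ 3) g" "f 0"
    by unfold_locales (use invd A2(1) A3 A4 A5a(1) A5b in auto)
  define p where "p = \<beta> + 1"
  have p: "p \<ge> 1" "p > 0" using A6 by (auto simp: p_def)
  have \<theta>: "\<theta> > 0" "\<theta> = \<gamma> + 1 + p - \<alpha>" using A6 by (auto simp: \<theta>_def p_def)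
  have \<alpha>: "\<alpha> > p" using A6 by (simp add: p_def)
  have \<gamma>: "\<gamma> + 1 > 0" using \<theta> \<alpha> by linarith
  define a where "a = ln (\<theta> powr p * (\<alpha> - p))"
  obtain \<zeta> s B r0 \<Phi> where \<zeta>: "filterlim \<zeta> at_top at_top" "\<forall>\<^sub>F t in at_top. \<zeta> t - p * lg (\<zeta> t) - s (\<zeta> t) = t"
    and sB: "\<And>z. \<bar>s z\<bar> \<le> B" "\<forall>\<^sub>F z in at_top. \<bar>s z\<bar> \<le> B * \<bar>\<epsilon> z\<bar>" and r0: "r0 > 0"
    and gt: "\<And>r. 0 < r \<Longrightarrow> r < r0 \<Longrightarrow> \<zeta> (a - \<theta> * ln r) > f 0"
    and u0: "\<And>r. 0 < r \<Longrightarrow> r < r0 \<Longrightarrow>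
       ((\<lambda>r. g (\<zeta> (a - \<theta> * ln r))) has_real_derivative - ((r powr (-\<alpha>) * \<Phi> r) powr (1/p))) (at r)"
    and \<Phi>: "\<And>r. 0 < r \<Longrightarrow> r < r0 \<Longrightarrow> (\<Phi> has_real_derivative r powr \<gamma> * exp (\<zeta> (a - \<theta> * ln r))) (at r)"
    and \<Phi>0: "\<And>r. \<Phi> r > 0"
    by (rule local_singular_solution[OF p(2) \<theta> \<alpha> a_def]) blast
  define u0 where "u0 r = g (\<zeta> (a - \<theta> * ln r))" for r
  note u0' = u0[folded u0_def[abs_def]]
  have fu0: "f (u0 r) = \<zeta> (a - \<theta> * ln r)" "u0 r > 0" if "0 < r" "r < r0" for r
    using inv(1,2)[OF gt[OF that]] by (simp_all add: u0_def)
  have \<Phi>': "(\<Phi> has_real_derivative r powr \<gamma> * exp (f (u0 r))) (at r)" if "0 < r" "r < r0" for r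
    using \<Phi>[OF that] fu0[OF that] by simp
  obtain U P rz R where rz: "0 < rz" "rz < R" "U rz = 0" and Uu0: "\<forall>\<^sub>F r in at_right 0. U r = u0 r"
    and U': "\<And>r. 0 < r \<Longrightarrow> r < R \<Longrightarrow> (U has_real_derivative - ((r powr (-\<alpha>) * P r) powr (1/p))) (at r)"
    and P': "\<And>r. 0 < r \<Longrightarrow> r < R \<Longrightarrow> (P has_real_derivative r powr \<gamma> * exp (f (max 0 (U r)))) (at r)"
    and P0: "\<And>r. 0 < r \<Longrightarrow> r < R \<Longrightarrow> P r > 0"
  proof (rule radial_flux_continuation[of p \<theta> \<gamma> \<alpha> r0 f D u0 \<Phi>], goal_cases)
    case (11 U P rz R)
    show ?case by (rule that[of rz R U P]) (fact 11(2-))+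
  qed (rule p(1) \<theta>(1) \<gamma> \<theta>(2) r0 A1(1) \<Phi>0 | (rule u0' \<Phi>' fu0(2); assumption))+
  have log_lim: "filterlim (\<lambda>r. b - \<theta> * ln r) at_top (at_right 0)" for b
  proof -
    have "filterlim (\<lambda>r. \<theta> * - ln r) at_top (at_right 0)"
      by (rule filterlim_tendsto_pos_mult_at_top[OF tendsto_const \<theta>(1)])
         (rule filterlim_compose[OF filterlim_uminus_at_top_at_bot ln_at_0])
    from filterlim_tendsto_add_at_top[OF tendsto_const[of b] this] show ?thesis by simp
  qed
  have "filterlim u0 at_top (at_right 0)"
    unfolding u0_def by (intro filterlim_compose[OF inv(4)] filterlim_compose[OF \<zeta>(1)] log_lim)
  hence Ulim: "filterlim U at_top (at_right 0)"
    using filterlim_cong[OF refl refl Uu0] by blast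
  have f0: "continuous_on {0..} f"
    using C4_nonneg_continuous[OF A1(1), of 0] A1(1) by (simp add: C4_nonneg_def)
  \<comment> \<open>The value of \<lambda> is forced by moving the zero \<open>rz\<close> to
    1.\<close>
  define lam where "lam = rz powr \<theta>"
  have lam: "lam > 0" "ln lam = \<theta> * ln rz" using rz by (simp_all add: lam_def ln_powr)
  define v where "v r = U (rz * r)" for r
  have sol: "singular_solution \<alpha> \<beta> \<gamma> f lam v"
    unfolding lam_def v_def
    by (rule singular_solution_rescale[OF p_def A6(2) \<theta>(2) rz(1,2) f0 U' P' P0 rz(3) Ulim])
  define T where "T r = (a - \<theta> * ln rz) - \<theta> * ln r" for r
  have Tlim: "filterlim T at_top (at_right 0)" unfolding T_def by (rule log_lim)
  \<comment> \<open>With \<open>ln lam = \<theta> * ln rz\<close>, the \<tau> of the statement is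
    \<open>T r + c\<close>: the two logarithms differ only in having \<open>p\<close> where
    \<open>T\<close> has \<open>exp a\<close>.\<close>
  define c where "c = ln p - a"
  define Zs where "Zs t = t + p * ln (deriv g (t + c) + p * (deriv ^^ 2) g (t + c) * ln (deriv g (t + c)))" for t
  have "(\<lambda>t. g (\<zeta> t) - g (Zs t)) \<in> O((deriv ^^ 2) g)"
    unfolding Zs_def by (rule singular_expansion[OF \<zeta>(1) p(2) \<zeta>(2) sB])
  from landau_o.big.compose[OF this Tlim]
  have 1: "(\<lambda>r. g (\<zeta> (T r)) - g (Zs (T r))) \<in> O[at_right 0](\<lambda>r. (deriv ^^ 2) g (T r))" .
  \<comment> \<open>\<open>T r\<close> and \<open>ln (r powr (-\<theta>))\<close> differ by a
    constant, so (A5)(b) lets the error be measured at the latter.\<close>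
  have "(\<lambda>t. (deriv ^^ 2) g (t + (a - \<theta> * ln rz))) \<in> O((deriv ^^ 2) g)"
  proof (rule g2_shift)
    have "((\<lambda>t::real. (a - \<theta> * ln rz) / t) \<longlongrightarrow> 0) at_top"
      by (simp add: tendsto_divide_0[OF tendsto_const] filterlim_at_top_imp_at_infinity filterlim_ident)
    thus "(\<lambda>t. a - \<theta> * ln rz) \<in> o(\<lambda>t. t)"
      by (rule smalloI_tendsto) (auto intro: eventually_mono[OF eventually_gt_at_top[of 0]])
  qed
  from landau_o.big.compose[OF this log_lim[of 0]]
  have "(\<lambda>r. (deriv ^^ 2) g (T r)) \<in> O[at_right 0](\<lambda>r. (deriv ^^ 2) g (0 - \<theta> * ln r))"
    by (simp add: T_def algebra_simps)
  from landau_o.big_trans[OF 1 this]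
  have 2: "(\<lambda>r. g (\<zeta> (T r)) - g (Zs (T r))) \<in> O[at_right 0](\<lambda>r. (deriv ^^ 2) g (0 - \<theta> * ln r))" .
  define \<tau> where "\<tau> r = ln ((\<beta> + 1) / (lam * r powr \<theta>))" for r
  define Z where "Z r = ln (\<theta> powr (\<beta> + 1) * (\<alpha> - \<beta> - 1)) - ln lam - \<theta> * ln r
               + (\<beta> + 1) * ln (deriv g (\<tau> r) + (\<beta> + 1) * (deriv ^^ 2) g (\<tau> r) * ln (deriv g (\<tau> r)))" for r
  have ev: "\<forall>\<^sub>F r in at_right 0. v r - g (Z r) = g (\<zeta> (T r)) - g (Zs (T r)) \<and>
      (deriv ^^ 2) g (ln (r powr (-\<theta>))) = (deriv ^^ 2) g (0 - \<theta> * ln r)"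
  proof -
    have "((\<lambda>r. rz * r) \<longlongrightarrow> rz * 0) (at_right 0)" by (intro tendsto_intros)
    hence "filterlim (\<lambda>r. rz * r) (at_right 0) (at_right 0)"
      using rz by (intro tendsto_imp_filterlim_at_right) (auto simp: eventually_at_filter)
    from eventually_compose_filterlim[OF Uu0 this] eventually_at_right_less[of 0] show ?thesis
    proof eventually_elim
      case (elim r)
      have "a - \<theta> * ln (rz * r) = T r" using elim(2) rz by (simp add: T_def ln_mult algebra_simps)
      hence 1: "v r = g (\<zeta> (T r))" using elim(1) by (simp add: v_def u0_def)
      have 2: "\<tau> r = T r + c"
        using elim(2) lam p rz by (simp add: \<tau>_def T_def c_def ln_div ln_mult ln_powr p_def)
      have "Z r = Zs (T r)"
        unfolding Z_def Zs_def 2 T_def a_def using lam by (simp add: p_def diff_diff_eq)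
      thus ?case using 1 elim(2) by (simp add: ln_powr)
    qed
  qed
  have "(\<lambda>r. v r - g (Z r)) \<in> O[at_right 0](\<lambda>r. (deriv ^^ 2) g (ln (r powr (-\<theta>))))"
  proof (subst landau_o.big.in_cong)
    show "\<forall>\<^sub>F r in at_right 0. v r - g (Z r) = g (\<zeta> (T r)) - g (Zs (T r))"
      using ev by (rule eventually_mono) simp
    show "(\<lambda>r. g (\<zeta> (T r)) - g (Zs (T r))) \<in> O[at_right 0](\<lambda>r. (deriv ^^ 2) g (ln (r powr (-\<theta>))))"
    proof -
      have "\<forall>\<^sub>F r in at_right 0. (deriv ^^ 2) g (ln (r powr (-\<theta>))) = (deriv ^^ 2) g (0 - \<theta> * ln r)"
        using ev by (rule eventually_mono) simp
      thus ?thesis using 2 by (simp only: landau_o.big.cong)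
    qed
  qed
  thus ?thesis
    unfolding Let_def by (intro exI[of _ lam] exI[of _ v] conjI lam(1) sol) (simp only: Z_def \<tau>_def)
qed

end
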